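(* Let $G=(V,E)$ be a minimally $d$-rigid graph with at least $d+1$ vertices and let $G'$ be obtained from $G$ by a $d$-dimensional vertex-split. Then $r_d(G')\ge 2r_d(G)$.
   Context: A $d$-dimensional vertex-split takes a graph $G$, a vertex $x$, and a partition of the neighbourhood of $x$ into sets $N_1$, $N_2$ and $\{w_1,\dots,w_{d-1}\}$; it outputs the graph obtained from $G-x$ by adding new vertices $x_1,x_2$, with $x_i$ joined to all of $N_i$ ($i=1,2$), both joined to each $w_j$, and the edge $x_1x_2$. On $\mathbb{R}^d$, $\|\cdot\|$ is the Euclidean norm. A realisation $p:V\to\mathbb{R}^d$ is generic if its coordinates are algebraically independent over $\mathbb{Q}$; realisations are equivalent if all edge lengths agree, congruent if related by an isometry. $G$ is $d$-rigid if some generic framework is rigid (every continuous edge-length-preserving motion is a congruence), minimally $d$-rigid if moreover $G-e$ is not $d$-rigid for all edges $e$. $r_d(G)$ is the maximum over generic $p:V\to\mathbb{R}^d$ of the number of congruence classes of real realisations equivalent to $p$. *)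

theory Defs
  imports "HOL-Analysis.Analysis" "HOL-Library.Extended_Nat"
begin

definition simple_graph :: "'v set \<Rightarrow> 'v set set \<Rightarrow> bool" where
  "simple_graph V E \<longleftrightarrow> finite V \<and>
     (\<forall>e\<in>E. \<exists>u v. e = {u, v} \<and> u \<noteq> v \<and> u \<in> V \<and> v \<in> V)"

definition neighbours :: "'v set set \<Rightarrow> 'v \<Rightarrow> 'v set" where
  "neighbours E x = {u. {x, u} \<in> E}"

text \<open>Algebraic independence over the rationals of a family x indexed by a finite set I:
  no nonzero polynomial with rational coefficients (a finitely supported map from
  exponent vectors to rationals) vanishes at x.\<close>
definition alg_indep_Q :: "'i set \<Rightarrow> ('i \<Rightarrow> real) \<Rightarrow> bool" where
  "alg_indep_Q I x \<longleftrightarrow>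
     (\<forall>c :: ('i \<Rightarrow> nat) \<Rightarrow> rat.
        finite {m. c m \<noteq> 0} \<and> (\<forall>m. c m \<noteq> 0 \<longrightarrow> (\<forall>i. i \<notin> I \<longrightarrow> m i = 0)) \<and>
        (\<Sum>m\<in>{m. c m \<noteq> 0}. of_rat (c m) * (\<Prod>i\<in>I. x i ^ m i)) = 0
        \<longrightarrow> (\<forall>m. c m = 0))"

definition generic :: "'v set \<Rightarrow> ('v \<Rightarrow> real^'d) \<Rightarrow> bool" where
  "generic V p \<longleftrightarrow> alg_indep_Q (V \<times> (UNIV :: 'd set)) (\<lambda>(v, i). p v $ i)"

definition equivalent :: "'v set set \<Rightarrow> ('v \<Rightarrow> real^'d) \<Rightarrow> ('v \<Rightarrow> real^'d) \<Rightarrow> bool" where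
  "equivalent E p q \<longleftrightarrow> (\<forall>u v. {u, v} \<in> E \<longrightarrow> norm (p u - p v) = norm (q u - q v))"

definition isometry :: "(real^'d \<Rightarrow> real^'d) \<Rightarrow> bool" where
  "isometry T \<longleftrightarrow> (\<forall>a b. norm (T a - T b) = norm (a - b))"

definition congruent :: "'v set \<Rightarrow> ('v \<Rightarrow> real^'d) \<Rightarrow> ('v \<Rightarrow> real^'d) \<Rightarrow> bool" where
  "congruent V p q \<longleftrightarrow> (\<exists>T. isometry T \<and> (\<forall>v\<in>V. q v = T (p v)))"

definition rigid_framework :: "'v set \<Rightarrow> 'v set set \<Rightarrow> ('v \<Rightarrow> real^'d) \<Rightarrow> bool" where
  "rigid_framework V E p \<longleftrightarrow>
     (\<forall>P :: real \<Rightarrow> 'v \<Rightarrow> real^'d.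
        (\<forall>v\<in>V. continuous_on {0..1} (\<lambda>t. P t v)) \<and> (\<forall>v\<in>V. P 0 v = p v) \<and>
        (\<forall>t\<in>{0..1}. equivalent E p (P t))
        \<longrightarrow> (\<forall>t\<in>{0..1}. congruent V p (P t)))"

definition d_rigid :: "'d::finite itself \<Rightarrow> 'v set \<Rightarrow> 'v set set \<Rightarrow> bool" where
  "d_rigid (dd :: 'd::finite itself) V E \<longleftrightarrow>
     (\<exists>p :: 'v \<Rightarrow> real^'d. generic V p \<and> rigid_framework V E p)"

definition minimally_d_rigid :: "'d::finite itself \<Rightarrow> 'v set \<Rightarrow> 'v set set \<Rightarrow> bool" where
  "minimally_d_rigid dd V E \<longleftrightarrow> d_rigid dd V E \<and> (\<forall>e\<in>E. \<not> d_rigid dd V (E - {e}))"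

definition ecard :: "'a set \<Rightarrow> enat" where
  "ecard S = (if finite S then enat (card S) else \<infinity>)"

definition num_classes :: "'v set \<Rightarrow> 'v set set \<Rightarrow> ('v \<Rightarrow> real^'d) \<Rightarrow> enat" where
  "num_classes V E p = ecard ((\<lambda>q. {q'. congruent V q q'}) ` {q. equivalent E p q})"

definition r_d :: "'d::finite itself \<Rightarrow> 'v set \<Rightarrow> 'v set set \<Rightarrow> enat" where
  "r_d (dd :: 'd::finite itself) V E = (SUP p \<in> {p :: 'v \<Rightarrow> real^'d. generic V p}. num_classes V E p)"

definition vertex_split ::
  "nat \<Rightarrow> 'v set \<Rightarrow> 'v set set \<Rightarrow> 'v \<Rightarrow> 'v set \<Rightarrow> 'v set \<Rightarrow> 'v set \<Rightarrow> 'v \<Rightarrow> 'v \<Rightarrow>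
     'v set \<Rightarrow> 'v set set \<Rightarrow> bool" where
  "vertex_split d V E x N1 N2 W x1 x2 V' E' \<longleftrightarrow>
     x \<in> V \<and>
     N1 \<union> N2 \<union> W = neighbours E x \<and>
     N1 \<inter> N2 = {} \<and> N1 \<inter> W = {} \<and> N2 \<inter> W = {} \<and>
     finite W \<and> card W = d - 1 \<and>
     x1 \<noteq> x2 \<and> x1 \<notin> V - {x} \<and> x2 \<notin> V - {x} \<and>
     V' = (V - {x}) \<union> {x1, x2} \<and>
     E' = {e \<in> E. x \<notin> e} \<union> {{x1, u} | u. u \<in> N1} \<union> {{x2, u} | u. u \<in> N2}
          \<union> {{x1, w} | w. w \<in> W} \<union> {{x2, w} | w. w \<in> W} \<union> {{x1, x2}}"

end

theory Submission
  imports Defs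
begin

text \<open>
  Collapse the new edge: placing \<open>x1\<close> and \<open>x2\<close> both at \<open>x\<close> turns a realisation \<open>q\<close> of \<open>G\<close> into a
  degenerate realisation of \<open>G'\<close>, and the direction \<open>z\<close> of the collapsed edge is only constrained to be
  a unit vector with prescribed inner products with the vectors \<open>q w - q x\<close> (\<open>w\<close> in \<open>W\<close>). Prescribing 0
  leaves exactly the two unit normals \<open>\<plusminus>z\<close> of the hyperplane through \<open>x\<close> and \<open>W\<close>. So \<open>n\<close> pairwise
  incongruent realisations of \<open>G\<close> with equal edge lengths give \<open>2n\<close> degenerate solutions of one
  polynomial system, and if all of them are regular, each extends to nearby frameworks with a short
  edge \<open>x1 x2\<close>, over a generic choice of lengths. These are incongruent: two of them lie over
  incongruent realisations, or on different sides of a hyperplane.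

  Regularity rests on the fact that every realisation \<open>q\<close> with the edge lengths of a generic framework
  is generic up to congruence. The edge lengths of a minimally rigid graph are
  algebraically independent, and there are as many of them as coordinates of \<open>q\<close> after
  fixing the congruence along a flag; as the lengths are polynomials in these
  coordinates, the coordinates are algebraically independent as well, and the Jacobian
  criterion applies.
\<close>

section \<open>Rational polynomial functions and algebraic independence\<close>

text \<open>The obstacle is that the length of \<open>x1 x2\<close> has zero differential where
  \<open>x1\<close> and \<open>x2\<close> coincide, so the lengths of \<open>G'\<close> are singular
  there. The displacement is therefore written as a scale times a direction, a blow-up of the locus
  \<open>x1 = x2\<close>. In these variables the difference of the two squared lengths to
  \<open>w\<close> vanishes with the scale; divided by the scale it becomes an inner product, and
  the resulting system is regular at scale 0. The flag used for pinning is \<open>x\<close> followed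
  by \<open>W\<close>, so the hyperplane through them is one and the same coordinate hyperplane for
  all realisations, and the two normals do not depend on \<open>q\<close>. Only one framework of
  \<open>G'\<close> has to be generic: it is a perturbation of one degenerate solution, and the
  \<open>2n\<close> solutions found afterwards are merely equivalent to it. They are told apart by
  polynomials constant on congruence classes at fixed nonzero scale, whose distinct values at the
  collapsed points persist nearby. Polynomials are only evaluated, substituted and differentiated
  along lines, so an inductive class of functions serves throughout.\<close>

inductive ratpoly :: "'i set \<Rightarrow> (('i \<Rightarrow> real) \<Rightarrow> real) \<Rightarrow> bool" for I where
  ratpoly_const: "ratpoly I (\<lambda>x. of_rat c)"
| ratpoly_var: "i \<in> I \<Longrightarrow> ratpoly I (\<lambda>x. x i)"
| ratpoly_add: "ratpoly I F \<Longrightarrow> ratpoly I G \<Longrightarrow> ratpoly I (\<lambda>x. F x + G x)"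
| ratpoly_mult: "ratpoly I F \<Longrightarrow> ratpoly I G \<Longrightarrow> ratpoly I (\<lambda>x. F x * G x)"

definition monom_val :: "'i set \<Rightarrow> ('i \<Rightarrow> real) \<Rightarrow> ('i \<Rightarrow> nat) \<Rightarrow> real" where
  "monom_val I x m = (\<Prod>i\<in>I. x i ^ m i)"

definition exps_on :: "'i set \<Rightarrow> ('i \<Rightarrow> nat) set" where
  "exps_on I = {m. \<forall>i. i \<notin> I \<longrightarrow> m i = 0}"

lemma monom_val_add: "monom_val I x (\<lambda>i. m i + n i) = monom_val I x m * monom_val I x n"
  by (simp add: monom_val_def power_add prod.distrib)

lemma ratpoly_0 [simp]: "ratpoly I (\<lambda>x. 0)"
  using ratpoly_const[of I 0] by simp

lemma ratpoly_1 [simp]: "ratpoly I (\<lambda>x. 1)"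
  using ratpoly_const[of I 1] by simp

lemma ratpoly_of_nat: "ratpoly I (\<lambda>x. of_nat n)"
  using ratpoly_const[of I "of_nat n"] by simp

lemma ratpoly_uminus: "ratpoly I F \<Longrightarrow> ratpoly I (\<lambda>x. - F x)"
  using ratpoly_mult[OF ratpoly_const[of I "-1"], of F] by (simp add: of_rat_minus)

lemma ratpoly_diff: "ratpoly I F \<Longrightarrow> ratpoly I G \<Longrightarrow> ratpoly I (\<lambda>x. F x - G x)"
  using ratpoly_add[of I F "\<lambda>x. - G x"] ratpoly_uminus[of I G] by simp

lemma ratpoly_power: "ratpoly I F \<Longrightarrow> ratpoly I (\<lambda>x. F x ^ n)"
  by (induction n) (auto intro: ratpoly_mult)

lemma ratpoly_sum: "(\<And>a. a \<in> A \<Longrightarrow> ratpoly I (F a)) \<Longrightarrow> ratpoly I (\<lambda>x. \<Sum>a\<in>A. F a x)"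
  by (induction A rule: infinite_finite_induct) (auto intro: ratpoly_add)

lemma ratpoly_prod: "(\<And>a. a \<in> A \<Longrightarrow> ratpoly I (F a)) \<Longrightarrow> ratpoly I (\<lambda>x. \<Prod>a\<in>A. F a x)"
  by (induction A rule: infinite_finite_induct) (auto intro: ratpoly_mult)

lemma ratpoly_if: "(P \<Longrightarrow> ratpoly I F) \<Longrightarrow> (\<not> P \<Longrightarrow> ratpoly I G) \<Longrightarrow>
    ratpoly I (\<lambda>x. if P then F x else G x)"
  by (cases P) auto

lemma ratpoly_subst:
  assumes "ratpoly I F" "\<And>i. i \<in> I \<Longrightarrow> ratpoly J (\<phi> i)"
  shows "ratpoly J (\<lambda>x. F (\<lambda>i. \<phi> i x))"
  using assms by induction (auto intro: ratpoly.intros)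

lemma ratpoly_cong:
  assumes "ratpoly I F" "\<And>i. i \<in> I \<Longrightarrow> x i = y i" shows "F x = F y"
  using assms by induction auto

definition poly_of :: "'i set \<Rightarrow> (('i \<Rightarrow> nat) \<Rightarrow> rat) \<Rightarrow> ('i \<Rightarrow> real) \<Rightarrow> real" where
  "poly_of I c x = (\<Sum>m\<in>{m. c m \<noteq> 0}. of_rat (c m) * monom_val I x m)"

lemma poly_of_superset:
  assumes "finite S" "{m. c m \<noteq> 0} \<subseteq> S"
  shows "poly_of I c x = (\<Sum>m\<in>S. of_rat (c m) * monom_val I x m)"
  unfolding poly_of_def by (rule sum.mono_neutral_left) (use assms in auto)

lemma ratpoly_monom_val: "ratpoly I (\<lambda>x. monom_val I x m)"
  unfolding monom_val_def by (auto intro!: ratpoly_prod ratpoly_power ratpoly_var)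

lemma ratpoly_poly_of: "ratpoly I (poly_of I c)"
  unfolding poly_of_def by (auto intro!: ratpoly_sum ratpoly_mult ratpoly_const ratpoly_monom_val)

text \<open>Link between the inductive class of functions and the coefficient families of
  \<open>alg_indep_Q\<close>. Products of coefficient families have to be expanded only once, in
  \<open>ratpoly_imp_poly_rep\<close>.\<close>

definition poly_rep :: "'i set \<Rightarrow> (('i \<Rightarrow> real) \<Rightarrow> real) \<Rightarrow> bool" where
  "poly_rep I F \<longleftrightarrow> (\<exists>c. finite {m. c m \<noteq> 0} \<and> {m. c m \<noteq> 0} \<subseteq> exps_on I \<and> F = poly_of I c)"

lemma poly_rep_add:
  assumes "poly_rep I F" "poly_rep I G" shows "poly_rep I (\<lambda>x. F x + G x)"
proof -
  obtain c where c: "finite {m. c m \<noteq> 0}" "{m. c m \<noteq> 0} \<subseteq> exps_on I" "F = poly_of I c"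
    using assms(1) unfolding poly_rep_def by blast
  obtain d where d: "finite {m. d m \<noteq> 0}" "{m. d m \<noteq> 0} \<subseteq> exps_on I" "G = poly_of I d"
    using assms(2) unfolding poly_rep_def by blast
  let ?S = "{m. c m \<noteq> 0} \<union> {m. d m \<noteq> 0}" and ?e = "\<lambda>m. c m + d m"
  have fS: "finite ?S" and sub: "{m. ?e m \<noteq> 0} \<subseteq> ?S" using c d by auto
  have "F x + G x = poly_of I ?e x" for x
    using poly_of_superset[OF fS, of c I x] poly_of_superset[OF fS, of d I x]
      poly_of_superset[OF fS sub, of I x] c(3) d(3)
    by (simp add: of_rat_add distrib_right sum.distrib)
  moreover have "finite {m. ?e m \<noteq> 0}" using fS sub by (rule rev_finite_subset)
  moreover have "{m. ?e m \<noteq> 0} \<subseteq> exps_on I" using sub c(2) d(2) by auto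
  ultimately show ?thesis unfolding poly_rep_def by (intro exI[of _ ?e]) auto
qed

lemma poly_rep_term:
  assumes "m \<in> exps_on I" shows "poly_rep I (\<lambda>x. of_rat a * monom_val I x m)"
proof -
  let ?c = "\<lambda>n. if n = m then a else 0"
  have "poly_of I ?c x = of_rat a * monom_val I x m" for x
    by (subst poly_of_superset[of "{m}"]) auto
  then show ?thesis unfolding poly_rep_def using assms
    by (intro exI[of _ ?c]) auto
qed

lemma poly_rep_sum:
  assumes "finite A" "\<And>a. a \<in> A \<Longrightarrow> poly_rep I (F a)"
  shows "poly_rep I (\<lambda>x. \<Sum>a\<in>A. F a x)"
  using assms
proof (induction A rule: finite_induct)
  case empty
  have "poly_rep I (\<lambda>x. of_rat 0 * monom_val I x (\<lambda>i. 0))"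
    by (rule poly_rep_term) (auto simp: exps_on_def)
  then show ?case by simp
qed (auto intro: poly_rep_add)

lemma ratpoly_imp_poly_rep:
  assumes "finite I" "ratpoly I F" shows "poly_rep I F"
  using assms(2)
proof induction
  case (ratpoly_const c)
  have "poly_rep I (\<lambda>x. of_rat c * monom_val I x (\<lambda>i. 0))"
    by (rule poly_rep_term) (auto simp: exps_on_def)
  then show ?case by (simp add: monom_val_def)
next
  case (ratpoly_var i)
  have "monom_val I x (\<lambda>j. if j = i then 1 else 0) = x i" for x :: "'a \<Rightarrow> real"
  proof -
    have "monom_val I x (\<lambda>j. if j = i then 1 else 0) = (\<Prod>j\<in>I. if j = i then x j else 1)"
      unfolding monom_val_def by (intro prod.cong) auto
    then show ?thesis using assms(1) ratpoly_var by simp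
  qed
  moreover have "poly_rep I (\<lambda>x. of_rat 1 * monom_val I x (\<lambda>j. if j = i then 1 else 0))"
    by (rule poly_rep_term) (use ratpoly_var in \<open>auto simp: exps_on_def\<close>)
  ultimately show ?case by simp
next
  case (ratpoly_add F G)
  then show ?case by (intro poly_rep_add)
next
  case (ratpoly_mult F G)
  obtain c where c: "finite {m. c m \<noteq> 0}" "{m. c m \<noteq> 0} \<subseteq> exps_on I" "F = poly_of I c"
    using ratpoly_mult unfolding poly_rep_def by blast
  obtain d where d: "finite {m. d m \<noteq> 0}" "{m. d m \<noteq> 0} \<subseteq> exps_on I" "G = poly_of I d"
    using ratpoly_mult unfolding poly_rep_def by blast
  have "F x * G x = (\<Sum>(m,n)\<in>{m. c m \<noteq> 0} \<times> {m. d m \<noteq> 0}.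
      of_rat (c m * d n) * monom_val I x (\<lambda>i. m i + n i))" for x
    unfolding c(3) d(3) poly_of_def sum_product sum.cartesian_product
    by (intro sum.cong) (auto simp: monom_val_add of_rat_mult)
  moreover have "poly_rep I (\<lambda>x. \<Sum>mn\<in>{m. c m \<noteq> 0} \<times> {m. d m \<noteq> 0}.
      of_rat (c (fst mn) * d (snd mn)) * monom_val I x (\<lambda>i. fst mn i + snd mn i))"
    by (rule poly_rep_sum, use c d in simp, rule poly_rep_term)
      (use c(2) d(2) in \<open>auto simp: exps_on_def\<close>)
  ultimately show ?case by (simp add: case_prod_unfold)
qed

lemma alg_indep_poly_of:
  "alg_indep_Q I x \<longleftrightarrow> (\<forall>c. finite {m. c m \<noteq> 0} \<and> {m. c m \<noteq> 0} \<subseteq> exps_on I \<and>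
      poly_of I c x = 0 \<longrightarrow> (\<forall>m. c m = 0))"
  unfolding alg_indep_Q_def poly_of_def monom_val_def exps_on_def
  by (intro arg_cong[where f=All] ext) auto

text \<open>The form in which genericity is used: a polynomial identity that holds at an independent
  point holds everywhere, so a single explicit point can refute it.\<close>

lemma alg_indep_vanish:
  assumes "finite I" "alg_indep_Q I x" "ratpoly I F" "F x = 0"
  shows "F z = 0"
proof -
  obtain c where c: "finite {m. c m \<noteq> 0}" "{m. c m \<noteq> 0} \<subseteq> exps_on I" "F = poly_of I c"
    using ratpoly_imp_poly_rep[OF assms(1,3)] unfolding poly_rep_def by blast
  then have "\<forall>m. c m = 0" using assms(2,4) unfolding alg_indep_poly_of by blast
  then show ?thesis using c(3) by (simp add: poly_of_def)
qed

lemma alg_indep_empty: "alg_indep_Q {} x"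
  unfolding alg_indep_poly_of
proof (intro allI impI)
  fix c :: "('a \<Rightarrow> nat) \<Rightarrow> rat" and m
  assume c: "finite {m. c m \<noteq> 0} \<and> {m. c m \<noteq> 0} \<subseteq> exps_on {} \<and> poly_of {} c x = 0"
  have e: "exps_on {} = {\<lambda>i::'a. 0::nat}" by (auto simp: exps_on_def)
  have "poly_of {} c x = of_rat (c (\<lambda>i. 0))"
    using c unfolding e by (subst poly_of_superset[of "{\<lambda>i. 0}"]) (simp_all add: monom_val_def)
  then have "c (\<lambda>i. 0) = 0" using c by simp
  moreover have "m = (\<lambda>i. 0)" if "c m \<noteq> 0" using c e that by blast
  ultimately show "c m = 0" by metis
qed

lemma alg_indep_cong:
  assumes "\<And>i. i \<in> I \<Longrightarrow> x i = y i" shows "alg_indep_Q I x \<longleftrightarrow> alg_indep_Q I y"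
proof -
  have "monom_val I x m = monom_val I y m" for m
    unfolding monom_val_def using assms by (intro prod.cong) auto
  then show ?thesis unfolding alg_indep_poly_of poly_of_def by simp
qed

text \<open>Sorting the monomials of a dependence by their exponent at \<open>i\<close> makes
  \<open>y i\<close> a root of a polynomial over the other coordinates. Nontriviality is asserted
  for the numbers \<open>a l y\<close>, not just for the functions \<open>a l\<close>; this is where
  independence on \<open>I\<close> enters.\<close>

lemma dependent_relation:
  assumes I: "finite I" "i \<notin> I" and ind: "alg_indep_Q I y" and dep: "\<not> alg_indep_Q (insert i I) y"
  shows "\<exists>n a. (\<forall>l. ratpoly I (a l)) \<and> (\<Sum>l\<le>(n::nat). a l y * y i ^ l) = 0 \<and> (\<exists>l\<le>n. a l y \<noteq> 0)"
proof -
  obtain c m0 where c: "finite {m. c m \<noteq> 0}" "{m. c m \<noteq> 0} \<subseteq> exps_on (insert i I)"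
    "poly_of (insert i I) c y = 0" and m0: "c m0 \<noteq> 0"
    using dep unfolding alg_indep_poly_of by blast
  let ?S = "{m. c m \<noteq> 0}"
  define n where "n = Max ((\<lambda>m. m i) ` ?S)"
  have le_n: "m i \<le> n" if "m \<in> ?S" for m
    unfolding n_def using c(1) that by (intro Max_ge) auto
  define a where "a = (\<lambda>l x. \<Sum>m\<in>{m\<in>?S. m i = l}. of_rat (c m) * monom_val I x m)"
  have split: "monom_val (insert i I) y m = monom_val I y m * y i ^ m i" for m
    using I by (simp add: monom_val_def)
  have "(\<Sum>l\<le>n. a l y * y i ^ l)
      = (\<Sum>l\<le>n. \<Sum>m\<in>{m\<in>?S. m i = l}. of_rat (c m) * monom_val (insert i I) y m)"
    unfolding a_def sum_distrib_right by (intro sum.cong) (auto simp: split)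
  also have "\<dots> = poly_of (insert i I) c y"
    unfolding poly_of_def by (rule sum.group) (use c(1) le_n in auto)
  finally have rel: "(\<Sum>l\<le>n. a l y * y i ^ l) = 0" using c(3) by simp
  have "a (m0 i) y \<noteq> 0"
  proof
    assume a0: "a (m0 i) y = 0"
    let ?l = "m0 i"
    let ?T = "{m\<in>?S. m i = ?l}"
    \<comment> \<open>The slice of \<open>c\<close> with exponent \<open>?l\<close> at
      \<open>i\<close>, with that exponent reset to 0: a nonzero relation supported in
      \<open>exps_on I\<close>, contradicting independence.\<close>
    define d where "d = (\<lambda>m. if m i = 0 then c (m(i := ?l)) else 0)"
    have Sd: "{m. d m \<noteq> 0} = (\<lambda>m. m(i := 0)) ` ?T"
    proof (intro equalityI subsetI)
      fix m assume "m \<in> {m. d m \<noteq> 0}"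
      then have "m i = 0" "c (m(i := ?l)) \<noteq> 0" by (auto simp: d_def split: if_splits)
      then show "m \<in> (\<lambda>m. m(i := 0)) ` ?T"
        by (intro image_eqI[of _ _ "m(i := ?l)"]) (auto simp: fun_upd_idem)
    next
      fix m assume "m \<in> (\<lambda>m. m(i := 0)) ` ?T"
      then obtain m' where "m' \<in> ?T" "m = m'(i := 0)" by blast
      then show "m \<in> {m. d m \<noteq> 0}" by (auto simp: d_def fun_upd_idem)
    qed
    have inj: "inj_on (\<lambda>m. m(i := 0)) ?T"
      by (rule inj_on_inverseI[of _ "\<lambda>m. m(i := ?l)"]) (auto simp: fun_upd_idem)
    have "poly_of I d y = (\<Sum>m\<in>?T. of_rat (d (m(i := 0))) * monom_val I y (m(i := 0)))"
      unfolding poly_of_def Sd by (subst sum.reindex[OF inj]) simp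
    also have "\<dots> = a ?l y"
      unfolding a_def
    proof (intro sum.cong refl)
      fix m assume "m \<in> ?T"
      moreover have "monom_val I y (m(i := 0)) = monom_val I y m"
        unfolding monom_val_def using I(2) by (intro prod.cong) auto
      ultimately show "of_rat (d (m(i := 0))) * monom_val I y (m(i := 0))
          = of_rat (c m) * monom_val I y m"
        by (auto simp: d_def fun_upd_idem)
    qed
    finally have "poly_of I d y = 0" using a0 by simp
    moreover have "finite {m. d m \<noteq> 0}" unfolding Sd using c(1) by auto
    moreover have "{m. d m \<noteq> 0} \<subseteq> exps_on I"
      unfolding Sd using c(2) by (fastforce simp: exps_on_def)
    ultimately have "d (m0(i := 0)) = 0" using ind unfolding alg_indep_poly_of by blast
    then show False using m0 by (simp add: d_def)
  qed
  moreover have "m0 i \<le> n" using le_n m0 by auto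
  moreover have "ratpoly I (a l)" for l
    unfolding a_def by (auto intro!: ratpoly_sum ratpoly_mult ratpoly_const ratpoly_monom_val)
  ultimately show ?thesis using rel by blast
qed

text \<open>A relation of least degree in the last variable is separable, so its derivative in that
  variable does not vanish.\<close>
lemma dependent_separable_relation:
  assumes "finite I" "i \<notin> I" "alg_indep_Q I y" "\<not> alg_indep_Q (insert i I) y"
  shows "\<exists>n a. (\<forall>l. ratpoly I (a l)) \<and> (\<Sum>l\<le>(n::nat). a l y * y i ^ l) = 0 \<and>
    (\<Sum>l\<le>n. a l y * (real l * y i ^ (l - 1))) \<noteq> 0"
proof -
  define P where "P = (\<lambda>n a. (\<forall>l. ratpoly I (a l)) \<and> (\<Sum>l\<le>(n::nat). a l y * y i ^ l) = 0 \<and>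
      (\<exists>l\<le>n. a l y \<noteq> 0))"
  obtain n where n: "\<exists>a. P n a" and least: "\<And>k. k < n \<Longrightarrow> \<not> (\<exists>a. P k a)"
    using dependent_relation[OF assms] exists_least_iff[of "\<lambda>n. \<exists>a. P n a"]
    unfolding P_def by auto
  then obtain a where a: "\<And>l. ratpoly I (a l)" "(\<Sum>l\<le>n. a l y * y i ^ l) = 0" "\<exists>l\<le>n. a l y \<noteq> 0"
    unfolding P_def by blast
  have n0: "n \<noteq> 0"
  proof
    assume "n = 0"
    then show False using a(2,3) by simp
  qed
  then obtain k where k: "n = Suc k" by (cases n) auto
  have "(\<Sum>l\<le>n. a l y * (real l * y i ^ (l - 1))) \<noteq> 0"
  proof
    assume z: "(\<Sum>l\<le>n. a l y * (real l * y i ^ (l - 1))) = 0"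
    let ?b = "\<lambda>l x. real (Suc l) * a (Suc l) x"
    have "(\<Sum>l\<le>k. ?b l y * y i ^ l) = 0"
      using z unfolding k by (subst (asm) sum.atMost_Suc_shift) (simp add: mult_ac)
    moreover have "ratpoly I (?b l)" for l
      using ratpoly_mult[OF ratpoly_of_nat a(1)] .
    \<comment> \<open>The derivative has degree at most \<open>k < n\<close>, so minimality kills
      all its coefficients at \<open>y\<close>. As \<open>real (Suc l)\<close> is nonzero, only
      \<open>a 0\<close> could survive, and then the relation kills it too.\<close>
    ultimately have "\<forall>l\<le>k. ?b l y = 0" using least[of k] unfolding P_def k by auto
    then have z: "a (Suc l) y = 0" if "l \<le> k" for l using that by auto
    then have "a 0 y = 0" using a(2) unfolding k by (subst (asm) sum.atMost_Suc_shift) simp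
    then have "a l y = 0" if "l \<le> n" for l using z that k by (cases l) auto
    then show False using a(3) by auto
  qed
  then show ?thesis using a by blast
qed

section \<open>Countability, and density of algebraically independent points\<close>

datatype qexpr = QConst rat | QVar nat | QAdd qexpr qexpr | QMult qexpr qexpr

instance qexpr :: countable by countable_datatype

primrec qeval :: "(nat \<Rightarrow> real) \<Rightarrow> qexpr \<Rightarrow> real" where
  "qeval e (QConst c) = of_rat c"
| "qeval e (QVar n) = e n"
| "qeval e (QAdd s t) = qeval e s + qeval e t"
| "qeval e (QMult s t) = qeval e s * qeval e t"

text \<open>Every such value is the value of a term of the countable type \<open>qexpr\<close> under
  one fixed assignment of the variables.\<close>

lemma countable_ratpoly_values:
  assumes "finite I" shows "countable {F y | F. ratpoly I F}"
proof -
  define e where "e = (\<lambda>n. y (from_nat_into I n))"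
  have "\<exists>s. F y = qeval e s" if "ratpoly I F" for F
    using that
  proof induction
    case (ratpoly_const c) then show ?case by (intro exI[of _ "QConst c"]) simp
  next
    case (ratpoly_var i)
    then have "e (to_nat_on I i) = y i" using assms by (simp add: e_def countable_finite)
    then show ?case by (intro exI[of _ "QVar (to_nat_on I i)"]) simp
  next
    case (ratpoly_add F G)
    then obtain s t where "F y = qeval e s" "G y = qeval e t" by blast
    then show ?case by (intro exI[of _ "QAdd s t"]) simp
  next
    case (ratpoly_mult F G)
    then obtain s t where "F y = qeval e s" "G y = qeval e t" by blast
    then show ?case by (intro exI[of _ "QMult s t"]) simp
  qed
  then have "{F y | F. ratpoly I F} \<subseteq> range (qeval e)" by auto
  then show ?thesis by (rule countable_subset) simp
qed

text \<open>Roots are indexed by coefficient lists: lists over a countable set are countable, and a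
  list with a nonzero entry has finitely many roots. With the values of rational polynomials as
  \<open>A\<close>, this covers all numbers algebraic over the coordinates already chosen.\<close>

lemma countable_roots:
  assumes "countable A"
  shows "countable {t::real. \<exists>n (a :: nat \<Rightarrow> real). (\<forall>l\<le>n. a l \<in> A) \<and>
    (\<exists>l\<le>n. a l \<noteq> 0) \<and> (\<Sum>l\<le>n. a l * t ^ l) = 0}" (is "countable ?T")
proof -
  let ?f = "\<lambda>as. {t::real. (\<exists>l<length as. as ! l \<noteq> 0) \<and> (\<Sum>l<length as. as ! l * t ^ l) = 0}"
  have "finite (?f as)" for as
  proof (cases "\<exists>l<length as. as ! l \<noteq> 0")
    case True
    then obtain l where l: "l < length as" "as ! l \<noteq> 0" by blast
    then have "finite {t. (\<Sum>l\<le>length as - 1. as ! l * t ^ l) = 0}"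
      by (intro polyfun_roots_finite[of "\<lambda>l. as ! l" l]) auto
    moreover have "{..<length as} = {..length as - 1}" using l by auto
    ultimately show ?thesis by simp
  qed auto
  then have "countable (\<Union>as\<in>lists A. ?f as)"
    using assms by (intro countable_UN) (auto intro: countable_finite)
  moreover have "?T \<subseteq> (\<Union>as\<in>lists A. ?f as)"
  proof
    fix t assume "t \<in> ?T"
    then obtain n a where a: "\<forall>l\<le>n. a l \<in> A" "\<exists>l\<le>n. a l \<noteq> 0" "(\<Sum>l\<le>n. a l * t ^ l) = 0"
      by blast
    let ?as = "map a [0..<Suc n]"
    have "?as \<in> lists A" using a(1) by (auto simp: in_lists_conv_set)
    moreover have "t \<in> ?f ?as"
    proof -
      have "(\<Sum>l<length ?as. ?as ! l * t ^ l) = (\<Sum>l\<le>n. a l * t ^ l)"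
        by (rule sum.cong) (auto simp del: upt_Suc)
      then show ?thesis using a(2,3) by (auto simp: less_Suc_eq_le simp del: upt_Suc)
    qed
    ultimately show "t \<in> (\<Union>as\<in>lists A. ?f as)" by blast
  qed
  ultimately show ?thesis by (rule countable_subset[rotated])
qed

text \<open>Coordinates are replaced one at a time: the values algebraic over the earlier ones are
  countable, an interval is not. The lemma supplies generic frameworks near degenerate ones.\<close>

lemma alg_indep_dense:
  assumes "finite I" "\<epsilon> > 0"
  shows "\<exists>y. alg_indep_Q I y \<and> (\<forall>i. \<bar>y i - x i\<bar> < \<epsilon>)"
  using assms(1)
proof (induction I rule: finite_induct)
  case empty
  then show ?case using alg_indep_empty assms(2) by (intro exI[of _ x]) auto
next
  case (insert i I)
  then obtain y where y: "alg_indep_Q I y" "\<And>i. \<bar>y i - x i\<bar> < \<epsilon>" by blast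
  let ?A = "{F y | F. ratpoly I F}"
  let ?T = "{t::real. \<exists>n (a :: nat \<Rightarrow> real). (\<forall>l\<le>n. a l \<in> ?A) \<and>
    (\<exists>l\<le>n. a l \<noteq> 0) \<and> (\<Sum>l\<le>n. a l * t ^ l) = 0}"
  have "countable ?T" by (rule countable_roots[OF countable_ratpoly_values[OF insert(1)]])
  moreover have "uncountable {x i - \<epsilon> <..< x i + \<epsilon>}"
    using assms(2) by (simp add: uncountable_open_interval)
  ultimately obtain t where t: "t \<in> {x i - \<epsilon> <..< x i + \<epsilon>}" "t \<notin> ?T"
    by (meson countable_subset subsetI)
  let ?y = "y(i := t)"
  have agree: "?y j = y j" if "j \<in> I" for j using that insert(2) by auto
  have "alg_indep_Q (insert i I) ?y"
  proof (rule ccontr)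
    assume dep: "\<not> ?thesis"
    have "alg_indep_Q I ?y" using y(1) alg_indep_cong[of I ?y y] agree by simp
    from dependent_relation[OF insert(1,2) this dep] obtain n a where
      a: "\<forall>l. ratpoly I (a l)" "(\<Sum>l\<le>(n::nat). a l ?y * ?y i ^ l) = 0" "\<exists>l\<le>n. a l ?y \<noteq> 0" by blast
    have "a l ?y = a l y" for l using ratpoly_cong[of I "a l" ?y y] a(1) agree by auto
    then have "t \<in> ?T" using a by (intro CollectI exI[of _ n] exI[of _ "\<lambda>l. a l y"]) auto
    then show False using t by blast
  qed
  moreover have "\<forall>j. \<bar>?y j - x j\<bar> < \<epsilon>" using t(1) y(2) by auto
  ultimately show ?case by blast
qed

text \<open>Frees later arguments from coefficients. In the direction from functions to
  coefficients, a polynomial that vanishes everywhere also vanishes at an independent point provided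
  by \<open>alg_indep_dense\<close>, so its coefficients are zero.\<close>

lemma alg_indep_iff:
  assumes "finite I"
  shows "alg_indep_Q I x \<longleftrightarrow> (\<forall>F. ratpoly I F \<and> F x = 0 \<longrightarrow> (\<forall>z. F z = 0))"
proof
  assume r: "\<forall>F. ratpoly I F \<and> F x = 0 \<longrightarrow> (\<forall>z. F z = 0)"
  obtain y where y: "alg_indep_Q I y" using alg_indep_dense[OF assms, of 1] by auto
  show "alg_indep_Q I x" unfolding alg_indep_poly_of
  proof (intro allI impI)
    fix c m
    assume c: "finite {m. c m \<noteq> 0} \<and> {m. c m \<noteq> 0} \<subseteq> exps_on I \<and> poly_of I c x = 0"
    then have "poly_of I c y = 0" using r ratpoly_poly_of[of I c] by blast
    then show "c m = 0" using y c unfolding alg_indep_poly_of by blast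
  qed
qed (use alg_indep_vanish[OF assms] in blast)

lemma alg_indep_reindex:
  assumes "finite I" "inj_on h I"
  shows "alg_indep_Q (h ` I) x \<longleftrightarrow> alg_indep_Q I (\<lambda>i. x (h i))"
proof
  assume a: "alg_indep_Q (h ` I) x"
  show "alg_indep_Q I (\<lambda>i. x (h i))"
    unfolding alg_indep_iff[OF assms(1)]
  proof (intro allI impI)
    fix F z assume F: "ratpoly I F \<and> F (\<lambda>i. x (h i)) = 0"
    have r: "ratpoly (h ` I) (\<lambda>x. F (\<lambda>i. x (h i)))"
      by (rule ratpoly_subst[of I F]) (use F in \<open>auto intro: ratpoly_var\<close>)
    have "F (\<lambda>i. z (the_inv_into I h (h i))) = 0"
      using alg_indep_vanish[OF _ a r, of "\<lambda>j. z (the_inv_into I h j)"] F assms(1) by simp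
    then show "F z = 0"
      using ratpoly_cong[of I F z "\<lambda>i. z (the_inv_into I h (h i))"] F assms(2)
      by (simp add: the_inv_into_f_f)
  qed
next
  assume a: "alg_indep_Q I (\<lambda>i. x (h i))"
  have fin: "finite (h ` I)" using assms(1) by simp
  show "alg_indep_Q (h ` I) x"
    unfolding alg_indep_iff[OF fin]
  proof (intro allI impI)
    fix F z assume F: "ratpoly (h ` I) F \<and> F x = 0"
    let ?g = "the_inv_into I h"
    have r: "ratpoly I (\<lambda>w. F (\<lambda>j. w (?g j)))"
      by (rule ratpoly_subst[of "h ` I" F])
        (use F in \<open>auto intro!: ratpoly_var simp: the_inv_into_f_f[OF assms(2)]\<close>)
    have "F (\<lambda>j. x (h (?g j))) = F x"
      using F by (intro ratpoly_cong[of "h ` I" F]) (auto simp: the_inv_into_f_f[OF assms(2)])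
    then have "F (\<lambda>j. z (h (?g j))) = 0"
      using alg_indep_vanish[OF assms(1) a r, of "\<lambda>i. z (h i)"] F by simp
    moreover have "F (\<lambda>j. z (h (?g j))) = F z"
      using F by (intro ratpoly_cong[of "h ` I" F]) (auto simp: the_inv_into_f_f[OF assms(2)])
    ultimately show "F z = 0" by simp
  qed
qed

lemma alg_indep_nonzero:
  assumes "finite I" "alg_indep_Q I x" "i \<in> I" shows "x i \<noteq> 0"
  using alg_indep_vanish[OF assms(1,2) ratpoly_var[OF assms(3)], of "\<lambda>_. 1"] by auto

section \<open>Transcendence degree by counting monomials\<close>

interpretation ratvs: vector_space "\<lambda>(r::rat) (x::real). of_rat r * x"
  by unfold_locales (auto simp: algebra_simps of_rat_add of_rat_mult)

text \<open>Mixed-radix weights that tell finitely many exponent vectors apart; they stand in for a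
  monomial order and single out a leading monomial. Weights are at least 1 so that a bound on the
  total weight bounds every exponent.\<close>

lemma separating_weights:
  assumes "finite K" "finite S"
  shows "\<exists>w :: 'i \<Rightarrow> nat. (\<forall>i. 1 \<le> w i) \<and> (\<forall>m\<in>S. \<forall>m'\<in>S.
    (\<Sum>i\<in>K. w i * m i) = (\<Sum>i\<in>K. w i * m' i) \<longrightarrow> (\<forall>i\<in>K. m i = m' i))"
  using assms(1)
proof (induction K rule: finite_induct)
  case empty
  show ?case by (intro exI[of _ "\<lambda>_. 1"]) auto
next
  case (insert i K)
  then obtain w where w1: "\<And>i. 1 \<le> w i" and w: "\<And>m m'. m \<in> S \<Longrightarrow> m' \<in> S \<Longrightarrow>
    (\<Sum>i\<in>K. w i * m i) = (\<Sum>i\<in>K. w i * m' i) \<Longrightarrow> \<forall>i\<in>K. m i = m' i" by blast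
  \<comment> \<open>Exceeds all exponents at \<open>i\<close>, so \<open>m i\<close> is the
    remainder of the new weight modulo \<open>B\<close>, and the old weight is the quotient.\<close>
  define B where "B = Suc (Max (insert 0 ((\<lambda>m. m i) ` S)))"
  have B: "m i < B" if "m \<in> S" for m
    using that assms(2) by (auto simp: B_def less_Suc_eq_le intro!: Max_ge)
  define w' where "w' = (\<lambda>j. if j = i then 1 else B * w j)"
  have sum: "(\<Sum>j\<in>insert i K. w' j * m j) = m i + B * (\<Sum>j\<in>K. w j * m j)" for m
  proof -
    have "(\<Sum>j\<in>K. w' j * m j) = (\<Sum>j\<in>K. B * (w j * m j))"
      using insert(2) by (intro sum.cong) (auto simp: w'_def)
    then show ?thesis using insert(1,2) by (simp add: w'_def sum_distrib_left)
  qed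
  have "\<forall>j\<in>insert i K. m j = m' j" if "m \<in> S" "m' \<in> S"
    "(\<Sum>j\<in>insert i K. w' j * m j) = (\<Sum>j\<in>insert i K. w' j * m' j)" for m m'
  proof -
    let ?s = "\<Sum>j\<in>K. w j * m j" and ?s' = "\<Sum>j\<in>K. w j * m' j"
    have eq: "m i + B * ?s = m' i + B * ?s'" using that(3) by (simp only: sum)
    then have "(m i + B * ?s) mod B = (m' i + B * ?s') mod B" by simp
    then have i: "m i = m' i" using B that(1,2) by simp
    then have "B * ?s = B * ?s'" using eq by simp
    moreover have "B \<noteq> 0" by (simp add: B_def)
    ultimately have "?s = ?s'" by simp
    then show ?thesis using w[OF that(1,2)] i by auto
  qed
  moreover have "1 \<le> w' j" for j using w1[of j] by (simp add: w'_def B_def)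
  ultimately show ?case by blast
qed

text \<open>The counting argument: rational combinations of the monomials of weight at most \<open>M\<close> in
  \<open>d\<close> variables form a space of dimension of order \<open>M ^ d\<close>, and of lower order
  if the variables satisfy a relation, because the leading monomial can be eliminated.\<close>

definition exps_upto :: "'i set \<Rightarrow> ('i \<Rightarrow> nat) \<Rightarrow> nat \<Rightarrow> ('i \<Rightarrow> nat) set" where
  "exps_upto K w M = {m \<in> exps_on K. (\<Sum>i\<in>K. w i * m i) \<le> M}"

abbreviation monom_span :: "'i set \<Rightarrow> ('i \<Rightarrow> real) \<Rightarrow> ('i \<Rightarrow> nat) \<Rightarrow> nat \<Rightarrow> real set" where
  "monom_span K x w M \<equiv> ratvs.span (monom_val K x ` exps_upto K w M)"

lemma span_monom_mult:
  assumes "u \<in> monom_span K x w M"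
    and "v \<in> monom_span K x w N"
  shows "u * v \<in> monom_span K x w (M + N)"
proof -
  have 1: "monom_val K x m * v \<in> monom_span K x w (M + N)"
    if "m \<in> exps_upto K w M" for m
    using assms(2)
  proof (induction rule: ratvs.span_induct_alt)
    case base then show ?case by (simp add: ratvs.span_zero)
  next
    case (step c a y)
    then obtain n where n: "n \<in> exps_upto K w N" "a = monom_val K x n" by blast
    have "(\<lambda>i. m i + n i) \<in> exps_upto K w (M + N)"
      using that n(1) by (auto simp: exps_upto_def exps_on_def distrib_left sum.distrib add_mono)
    then have "monom_val K x m * a \<in> monom_span K x w (M + N)"
      unfolding n(2) monom_val_add[symmetric] by (intro ratvs.span_base) blast
    then have "of_rat c * (monom_val K x m * a) + monom_val K x m * y
        \<in> monom_span K x w (M + N)"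
      using step(2) by (intro ratvs.span_add ratvs.span_scale)
    then show ?case by (simp add: algebra_simps)
  qed
  show ?thesis using assms(1)
  proof (induction rule: ratvs.span_induct_alt)
    case base then show ?case by (simp add: ratvs.span_zero)
  next
    case (step c a y)
    then have "of_rat c * (a * v) + y * v \<in> monom_span K x w (M + N)"
      using 1 by (intro ratvs.span_add ratvs.span_scale) auto
    then show ?case by (simp add: algebra_simps)
  qed
qed

lemma span_monom_mono:
  assumes "u \<in> monom_span K x w M" "M \<le> N"
  shows "u \<in> monom_span K x w N"
proof -
  have "exps_upto K w M \<subseteq> exps_upto K w N" using assms(2) by (auto simp: exps_upto_def)
  then show ?thesis using assms(1) ratvs.span_mono[OF image_mono] by blast
qed

lemma span_monom_const: "of_rat c \<in> monom_span K x w M"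
proof -
  have "(\<lambda>i. 0) \<in> exps_upto K w M" by (auto simp: exps_upto_def exps_on_def)
  moreover have "monom_val K x (\<lambda>i. 0) = 1" by (simp add: monom_val_def)
  ultimately have "1 \<in> monom_val K x ` exps_upto K w M" by (metis imageI)
  from ratvs.span_scale[OF ratvs.span_base[OF this], of c] show ?thesis by simp
qed

lemma ratpoly_value_in_span:
  assumes "finite K" "ratpoly K F"
  shows "\<exists>M. F x \<in> monom_span K x w M"
  using assms(2)
proof induction
  case (ratpoly_const c)
  show ?case by (rule exI[of _ 0], rule span_monom_const)
next
  case (ratpoly_var i)
  let ?m = "\<lambda>j. if j = i then 1 else 0"
  have "monom_val K x ?m = (\<Prod>j\<in>K. if j = i then x j else 1)"
    unfolding monom_val_def by (intro prod.cong) auto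
  then have "monom_val K x ?m = x i" using assms(1) ratpoly_var by simp
  moreover have "?m \<in> exps_upto K w (\<Sum>j\<in>K. w j * ?m j)"
    using ratpoly_var by (auto simp: exps_upto_def exps_on_def)
  ultimately have "x i \<in> monom_val K x ` exps_upto K w (\<Sum>j\<in>K. w j * ?m j)"
    by (intro image_eqI[of _ _ ?m]) simp_all
  then show ?case by (intro exI ratvs.span_base)
next
  case (ratpoly_add F G)
  then obtain M N where "F x \<in> monom_span K x w M"
    "G x \<in> monom_span K x w N" by blast
  then have "F x + G x \<in> monom_span K x w (max M N)"
    by (intro ratvs.span_add) (rule span_monom_mono, assumption, simp)+
  then show ?case by (rule exI)
next
  case (ratpoly_mult F G)
  then obtain M N where "F x \<in> monom_span K x w M"
    "G x \<in> monom_span K x w N" by blast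
  then show ?case by (intro exI, rule span_monom_mult)
qed

lemma span_monom_power:
  assumes "u \<in> monom_span K x w M"
  shows "u ^ n \<in> monom_span K x w (n * M)"
proof (induction n)
  case 0 then show ?case using span_monom_const[of 1] by simp
next
  case (Suc n) then show ?case using span_monom_mult[OF assms Suc] by simp
qed

lemma span_monom_prod:
  assumes "finite E" "\<And>e. e \<in> E \<Longrightarrow> u e \<in> monom_span K x w (M e)"
  shows "(\<Prod>e\<in>E. u e) \<in> monom_span K x w (\<Sum>e\<in>E. M e)"
  using assms
proof (induction E rule: finite_induct)
  case empty then show ?case using span_monom_const[of 1] by simp
next
  case (insert e E) then show ?case by (simp add: span_monom_mult)
qed

lemma card_bounded_exps:
  assumes "finite K"
  shows "card {m \<in> exps_on K. \<forall>i\<in>K. m i < b i} = (\<Prod>i\<in>K. b i)"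
    and "finite {m \<in> exps_on K. \<forall>i\<in>K. m i < b i}"
proof -
  let ?T = "{m \<in> exps_on K. \<forall>i\<in>K. m i < b i}" and ?P = "PiE K (\<lambda>i. {..<b i})"
  let ?f = "\<lambda>m. \<lambda>i\<in>K. m i"
  have bij: "bij_betw ?f ?T ?P"
  proof (rule bij_betw_byWitness[where f' = "\<lambda>g i. if i \<in> K then g i else 0"])
    show "\<forall>a\<in>?T. (\<lambda>i. if i \<in> K then ?f a i else 0) = a" by (auto simp: exps_on_def)
    show "\<forall>g\<in>?P. ?f (\<lambda>i. if i \<in> K then g i else 0) = g"
      by (auto simp: fun_eq_iff PiE_def extensional_def)
    show "?f ` ?T \<subseteq> ?P" by auto
    show "(\<lambda>g i. if i \<in> K then g i else 0) ` ?P \<subseteq> ?T" by (auto simp: exps_on_def PiE_def)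
  qed
  have "finite ?P" using assms by (intro finite_PiE) auto
  then show "finite ?T" using bij_betw_finite[OF bij] by blast
  have "card ?P = (\<Prod>i\<in>K. b i)" using assms by (simp add: card_PiE)
  then show "card ?T = (\<Prod>i\<in>K. b i)" using bij_betw_same_card[OF bij] by (rule trans[rotated])
qed

text \<open>Division by the leading monomial: if \<open>t\<close> divides \<open>b\<close>, the
  relation multiplied by the monomial of exponent \<open>b - t\<close> expresses the monomial
  \<open>b\<close> by monomials of smaller weight, and induction on the weight applies.\<close>

lemma span_monom_reduced:
  fixes w :: "'i \<Rightarrow> nat"
  assumes K: "finite K" and c: "finite {m. c m \<noteq> 0}" "{m. c m \<noteq> 0} \<subseteq> exps_on K" "poly_of K c x = 0"
    and top: "c t \<noteq> 0" "\<And>m. c m \<noteq> 0 \<Longrightarrow> m \<noteq> t \<Longrightarrow> (\<Sum>i\<in>K. w i * m i) < (\<Sum>i\<in>K. w i * t i)"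
    and b: "b \<in> exps_upto K w M"
  shows "monom_val K x b \<in> ratvs.span (monom_val K x ` {m \<in> exps_upto K w M. \<not> (\<forall>i\<in>K. t i \<le> m i)})"
  using b
proof (induction "\<Sum>i\<in>K. w i * b i" arbitrary: b rule: less_induct)
  case less
  let ?R = "{m \<in> exps_upto K w M. \<not> (\<forall>i\<in>K. t i \<le> m i)}"
  show ?case
  proof (cases "\<forall>i\<in>K. t i \<le> b i")
    case False
    then show ?thesis using less(2) by (intro ratvs.span_base) auto
  next
    case True
    let ?S = "{m. c m \<noteq> 0}"
    \<comment> \<open>The natural subtraction is exact: \<open>t i \<le> b i\<close> on
      \<open>K\<close>, and both exponents vanish outside \<open>K\<close>.\<close>
    let ?r = "\<lambda>m i. (b i - t i) + m i"
    have bt: "?r t = b"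
    proof
      fix i show "?r t i = b i"
        using True less(2) c(2) top(1) by (cases "i \<in> K") (auto simp: exps_upto_def exps_on_def)
    qed
    have weight: "(\<Sum>i\<in>K. w i * ?r m i) = (\<Sum>i\<in>K. w i * (b i - t i)) + (\<Sum>i\<in>K. w i * m i)" for m
      by (simp add: distrib_left sum.distrib)
    have IH: "monom_val K x (?r m) \<in> ratvs.span (monom_val K x ` ?R)" if "m \<in> ?S - {t}" for m
    proof -
      have "(\<Sum>i\<in>K. w i * ?r m i) < (\<Sum>i\<in>K. w i * ?r t i)"
        unfolding weight using top(2)[of m] that by auto
      then have lt: "(\<Sum>i\<in>K. w i * ?r m i) < (\<Sum>i\<in>K. w i * b i)" by (simp only: fun_cong[OF bt])
      moreover have "?r m \<in> exps_on K"
        using less(2) c(2) that by (auto simp: exps_upto_def exps_on_def)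
      moreover have "(\<Sum>i\<in>K. w i * b i) \<le> M" using less(2) by (simp add: exps_upto_def)
      ultimately have "?r m \<in> exps_upto K w M" by (simp add: exps_upto_def)
      from less(1)[OF lt this] show ?thesis .
    qed
    have "(\<Sum>m\<in>?S. of_rat (c m) * monom_val K x (?r m))
        = monom_val K x (\<lambda>i. b i - t i) * poly_of K c x"
      unfolding poly_of_def sum_distrib_left monom_val_add by (intro sum.cong) auto
    also have "\<dots> = 0" using c(3) by simp
    finally have "of_rat (c t) * monom_val K x b
        + (\<Sum>m\<in>?S - {t}. of_rat (c m) * monom_val K x (?r m)) = 0"
      using c(1) top(1) by (subst (asm) sum.remove[of _ t]) (auto simp only: bt mem_Collect_eq)
    then have "of_rat (c t) * monom_val K x b
        = - (\<Sum>m\<in>?S - {t}. of_rat (c m) * monom_val K x (?r m))" by simp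
    moreover have "- (\<Sum>m\<in>?S - {t}. of_rat (c m) * monom_val K x (?r m)) \<in> ratvs.span (monom_val K x ` ?R)"
      by (intro ratvs.span_neg ratvs.span_sum ratvs.span_scale IH)
    ultimately have "of_rat (c t) * monom_val K x b \<in> ratvs.span (monom_val K x ` ?R)"
      by (simp only:)
    then have "of_rat (inverse (c t)) * (of_rat (c t) * monom_val K x b)
        \<in> ratvs.span (monom_val K x ` ?R)" by (rule ratvs.span_scale)
    moreover have "of_rat (inverse (c t)) * (of_rat (c t) * monom_val K x b) = monom_val K x b"
      using top(1) by (simp add: of_rat_inverse)
    ultimately show ?thesis by (simp only:)
  qed
qed

text \<open>If \<open>t\<close> does not divide \<open>m\<close>, some exponent of \<open>m\<close>
  is below that of \<open>t\<close>, a number of choices that does not depend on \<open>M\<close>;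
  the remaining exponents are at most \<open>M\<close>. So one power of \<open>M + 1\<close> is
  lost.\<close>

lemma card_reduced_exps:
  fixes w :: "'i \<Rightarrow> nat"
  assumes K: "finite K" and w: "\<And>i. 1 \<le> w i"
  shows "card {m \<in> exps_upto K w M. \<not> (\<forall>i\<in>K. t i \<le> m i)} \<le> (\<Sum>i\<in>K. t i) * (M + 1) ^ (card K - 1)"
    and "finite {m \<in> exps_upto K w M. \<not> (\<forall>i\<in>K. t i \<le> m i)}"
proof -
  let ?R = "{m \<in> exps_upto K w M. \<not> (\<forall>i\<in>K. t i \<le> m i)}"
  let ?b = "\<lambda>i j. if j = i then t i else M + 1"
  let ?T = "\<lambda>i. {m \<in> exps_on K. \<forall>j\<in>K. m j < ?b i j}"
  have sub: "?R \<subseteq> (\<Union>i\<in>K. ?T i)"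
  proof
    fix m assume m: "m \<in> ?R"
    then obtain i where i: "i \<in> K" "m i < t i" by (auto simp: not_le)
    have "m j \<le> M" if "j \<in> K" for j
    proof -
      have "m j \<le> w j * m j" using w[of j] by simp
      also have "\<dots> \<le> (\<Sum>i\<in>K. w i * m i)" using K that by (intro member_le_sum) auto
      also have "\<dots> \<le> M" using m by (simp add: exps_upto_def)
      finally show ?thesis .
    qed
    then have "m \<in> ?T i" using m i by (auto simp: exps_upto_def less_Suc_eq_le)
    then show "m \<in> (\<Union>i\<in>K. ?T i)" using i(1) by blast
  qed
  have cardT: "card (?T i) = t i * (M + 1) ^ (card K - 1)" if "i \<in> K" for i
  proof -
    have "card (?T i) = (\<Prod>j\<in>K. ?b i j)" by (rule card_bounded_exps(1)[OF K])
    also have "\<dots> = t i * (\<Prod>j\<in>K - {i}. ?b i j)" using K that by (subst prod.remove[of _ i]) auto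
    also have "(\<Prod>j\<in>K - {i}. ?b i j) = (\<Prod>j\<in>K - {i}. M + 1)" by (intro prod.cong) auto
    finally show ?thesis using K that by (simp add: card_Diff_singleton)
  qed
  have finT: "finite (\<Union>i\<in>K. ?T i)" by (intro finite_UN_I K card_bounded_exps(2))
  then show "finite ?R" using sub by (rule rev_finite_subset)
  have "card ?R \<le> card (\<Union>i\<in>K. ?T i)" using finT sub by (rule card_mono)
  also have "\<dots> \<le> (\<Sum>i\<in>K. card (?T i))" using K by (rule card_UN_le)
  also have "\<dots> = (\<Sum>i\<in>K. t i * (M + 1) ^ (card K - 1))" by (intro sum.cong cardT) auto
  finally show "card ?R \<le> (\<Sum>i\<in>K. t i) * (M + 1) ^ (card K - 1)" by (simp add: sum_distrib_right)
qed

lemma monomials_independent: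
  assumes "finite E" "alg_indep_Q E y" "finite B" "B \<subseteq> exps_on E"
  shows "ratvs.independent (monom_val E y ` B)" "inj_on (monom_val E y) B"
proof -
  show inj: "inj_on (monom_val E y) B"
  proof (rule inj_onI, rule ccontr)
    fix m n assume mn: "m \<in> B" "n \<in> B" "monom_val E y m = monom_val E y n" "m \<noteq> n"
    define c where "c = (\<lambda>k. if k = m then 1 else if k = n then -1 else (0::rat))"
    have S: "{k. c k \<noteq> 0} = {m, n}" by (auto simp: c_def)
    have "poly_of E c y = 0"
      unfolding poly_of_def S using mn by (simp add: c_def of_rat_minus)
    moreover have "finite {k. c k \<noteq> 0}" "{k. c k \<noteq> 0} \<subseteq> exps_on E"
      unfolding S using mn(1,2) assms(4) by auto
    ultimately have "c m = 0" using assms(2) unfolding alg_indep_poly_of by blast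
    then show False by (simp add: c_def)
  qed
  show "ratvs.independent (monom_val E y ` B)"
  proof
    assume "ratvs.dependent (monom_val E y ` B)"
    then obtain u where u: "\<exists>v\<in>monom_val E y ` B. u v \<noteq> 0"
      "(\<Sum>v\<in>monom_val E y ` B. of_rat (u v) * v) = 0"
      using assms(3) by (subst (asm) ratvs.dependent_finite) auto
    define c where "c = (\<lambda>m. if m \<in> B then u (monom_val E y m) else 0)"
    have sub: "{m. c m \<noteq> 0} \<subseteq> B" by (auto simp: c_def)
    have "poly_of E c y = (\<Sum>m\<in>B. of_rat (u (monom_val E y m)) * monom_val E y m)"
      by (subst poly_of_superset[OF assms(3) sub], intro sum.cong) (auto simp: c_def)
    also have "\<dots> = 0" using u(2) by (simp add: sum.reindex[OF inj])
    finally have "\<forall>m. c m = 0"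
      using assms(2,4) sub finite_subset[OF sub assms(3)] unfolding alg_indep_poly_of by blast
    then show False using u(1) by (auto simp: c_def split: if_splits)
  qed
qed

text \<open>Applied in contrapositive form: when at least \<open>card K\<close> polynomials in the
  variables have independent values, the variables are independent themselves.\<close>

theorem dependent_variables_bound:
  fixes K :: "'i set" and E :: "'e set"
  assumes K: "finite K" and E: "finite E" and F: "\<And>e. e \<in> E \<Longrightarrow> ratpoly K (F e)"
    and ind: "alg_indep_Q E (\<lambda>e. F e x)" and dep: "\<not> alg_indep_Q K x"
  shows "card E < card K"
proof (rule ccontr)
  assume "\<not> card E < card K"
  then have ge: "card K \<le> card E" by simp
  obtain c m0 where c: "finite {m. c m \<noteq> 0}" "{m. c m \<noteq> 0} \<subseteq> exps_on K"
    "poly_of K c x = 0" and m0: "c m0 \<noteq> 0"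
    using dep unfolding alg_indep_poly_of by blast
  let ?S = "{m. c m \<noteq> 0}"
  have K0: "K \<noteq> {}" using dep alg_indep_empty by blast
  obtain w :: "'i \<Rightarrow> nat" where w1: "\<And>i. 1 \<le> w i" and w: "\<And>m m'. m \<in> ?S \<Longrightarrow> m' \<in> ?S \<Longrightarrow>
    (\<Sum>i\<in>K. w i * m i) = (\<Sum>i\<in>K. w i * m' i) \<Longrightarrow> \<forall>i\<in>K. m i = m' i"
    using separating_weights[OF K c(1)] by blast
  let ?W = "\<lambda>m. \<Sum>i\<in>K. w i * m i"
  obtain t where t: "t \<in> ?S" "\<And>m. m \<in> ?S \<Longrightarrow> ?W m \<le> ?W t"
  proof -
    have "Max (?W ` ?S) \<in> ?W ` ?S" using c(1) m0 by (intro Max_in) auto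
    then obtain t where "t \<in> ?S" "Max (?W ` ?S) = ?W t" by blast
    moreover have "?W m \<le> Max (?W ` ?S)" if "m \<in> ?S" for m
      using c(1) that by (intro Max_ge) auto
    ultimately show thesis using that[of t] by simp
  qed
  have top: "?W m < ?W t" if "c m \<noteq> 0" "m \<noteq> t" for m
  proof -
    have "?W m \<noteq> ?W t"
    proof
      assume "?W m = ?W t"
      then have "\<forall>i\<in>K. m i = t i" using w that t(1) by blast
      moreover have "m \<in> exps_on K" "t \<in> exps_on K" using c(2) t(1) that(1) by blast+
      ultimately have "m i = t i" for i by (cases "i \<in> K") (simp_all add: exps_on_def)
      then show False using that(2) by blast
    qed
    then show ?thesis using t(2)[of m] that by simp
  qed
  have "\<forall>e\<in>E. \<exists>M. F e x \<in> monom_span K x w M"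
    using ratpoly_value_in_span[OF K F] by blast
  then obtain M where M: "\<And>e. e \<in> E \<Longrightarrow> F e x \<in> monom_span K x w (M e)"
    by (auto simp: bchoice_iff)
  \<comment> \<open>A monomial in the values \<open>F e\<close> with all exponents at most
    \<open>N\<close> lies in the span of monomials of weight at most \<open>N * C\<close>.\<close>
  define C where "C = (\<Sum>e\<in>E. M e)"
  define s where "s = (\<Sum>i\<in>K. t i)"
  define k where "k = card K - 1"
  have k: "card K = Suc k" using K K0 by (simp add: k_def card_gt_0_iff)
  \<comment> \<open>Chosen so that the bound \<open>s * ((N + 1) * (C + 1)) ^ k\<close> for the
    spanning set equals \<open>N * (N + 1) ^ k\<close>, which is just below the number
    \<open>(N + 1) ^ Suc k\<close> of independent monomials needed at least.\<close>
  define N where "N = s * (C + 1) ^ k"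
  define B where "B = {m \<in> exps_on E. \<forall>e\<in>E. m e < N + 1}"
  have B: "finite B" "card B = (N + 1) ^ card E"
    using card_bounded_exps[OF E, of "\<lambda>_. N + 1"] by (auto simp: B_def)
  let ?y = "\<lambda>e. F e x"
  let ?R = "{m \<in> exps_upto K w (N * C). \<not> (\<forall>i\<in>K. t i \<le> m i)}"
  have "monom_val E ?y m \<in> ratvs.span (monom_val K x ` ?R)" if m: "m \<in> B" for m
  proof -
    have "monom_val E ?y m \<in> monom_span K x w (\<Sum>e\<in>E. m e * M e)"
      unfolding monom_val_def[of E] using E M by (intro span_monom_prod span_monom_power)
    moreover have "(\<Sum>e\<in>E. m e * M e) \<le> N * C"
      unfolding C_def sum_distrib_left using m
      by (intro sum_mono mult_right_mono) (auto simp: B_def less_Suc_eq_le)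
    ultimately have "monom_val E ?y m \<in> monom_span K x w (N * C)"
      by (rule span_monom_mono)
    moreover have "monom_val K x ` exps_upto K w (N * C) \<subseteq> ratvs.span (monom_val K x ` ?R)"
      using span_monom_reduced[OF K c, of t w] t(1) top by auto
    then have "monom_span K x w (N * C) \<subseteq> ratvs.span (monom_val K x ` ?R)"
      by (rule ratvs.span_minimal) (rule ratvs.subspace_span)
    ultimately show ?thesis by blast
  qed
  then have sub: "monom_val E ?y ` B \<subseteq> ratvs.span (monom_val K x ` ?R)" by blast
  have Bs: "B \<subseteq> exps_on E" by (auto simp: B_def)
  note indep = monomials_independent[OF E ind B(1) Bs]
  have finR: "finite ?R" by (rule card_reduced_exps(2)[OF K w1])
  have "card (monom_val E ?y ` B) \<le> card (monom_val K x ` ?R)"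
    using ratvs.independent_span_bound[OF finite_imageI[OF finR] indep(1) sub] by blast
  also have "\<dots> \<le> card ?R" using finR by (rule card_image_le)
  also have "\<dots> \<le> s * (N * C + 1) ^ k"
    using card_reduced_exps(1)[OF K w1, where M = "N * C" and t = t] by (simp add: s_def k_def)
  also have "\<dots> \<le> s * ((N + 1) * (C + 1)) ^ k"
    by (intro mult_left_mono power_mono) auto
  also have "\<dots> = N * (N + 1) ^ k" by (simp only: N_def power_mult_distrib) (simp add: mult_ac)
  also have "\<dots> < (N + 1) ^ Suc k" by simp
  also have "\<dots> \<le> (N + 1) ^ card E" using ge k by (intro power_increasing) auto
  finally show False using B(2) card_image[OF indep(2)] by simp
qed

text \<open>An extra variable \<open>None\<close> with value 0 makes the variables dependent, and
  the strict bound for one more variable is the claim.\<close>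

corollary alg_indep_card_le:
  fixes K :: "'i set" and E :: "'e set"
  assumes K: "finite K" and E: "finite E" and F: "\<And>e. e \<in> E \<Longrightarrow> ratpoly K (F e)"
    and ind: "alg_indep_Q E (\<lambda>e. F e x)"
  shows "card E \<le> card K"
proof -
  let ?K = "insert None (Some ` K)" and ?x = "\<lambda>i. case i of None \<Rightarrow> 0 | Some i \<Rightarrow> x i"
  let ?F = "\<lambda>e z. F e (\<lambda>i. z (Some i))"
  have "ratpoly ?K (?F e)" if "e \<in> E" for e
    using ratpoly_subst[OF F[OF that], of ?K "\<lambda>i z. z (Some i)"] by (auto intro: ratpoly_var)
  moreover have "\<not> alg_indep_Q ?K ?x"
    using alg_indep_nonzero[of ?K ?x None] K by auto
  ultimately have "card E < card ?K"
    using ind K E by (intro dependent_variables_bound[of ?K E ?F ?x]) auto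
  moreover have "card ?K = Suc (card K)" using K by (subst card_insert_disjoint) (auto simp: card_image)
  ultimately show ?thesis by simp
qed

section \<open>Linear systems indexed by arbitrary finite sets\<close>

lemma homogeneous_solution:
  fixes A :: "'e \<Rightarrow> 'k \<Rightarrow> 'f::field"
  assumes "finite E" "finite K" "card E < card K"
  shows "\<exists>h. (\<exists>k\<in>K. h k \<noteq> 0) \<and> (\<forall>e\<in>E. (\<Sum>k\<in>K. A e k * h k) = 0)"
  using assms
proof (induction E arbitrary: K A rule: finite_induct)
  case empty
  then have "K \<noteq> {}" by auto
  then show ?case by (intro exI[of _ "\<lambda>_. 1"]) auto
next
  case (insert e E)
  show ?case
  proof (cases "\<exists>k\<in>K. A e k \<noteq> 0")
    case False
    have "card E < card K" using insert by simp
    then obtain h where "\<exists>k\<in>K. h k \<noteq> 0" "\<forall>e\<in>E. (\<Sum>k\<in>K. A e k * h k) = 0"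
      using insert by blast
    then show ?thesis using False by (intro exI[of _ h]) auto
  next
    case True
    then obtain l where l: "l \<in> K" "A e l \<noteq> 0" by blast
    let ?K = "K - {l}" and ?A = "\<lambda>e' k. A e' k - A e' l * A e k / A e l"
    have "card E < card ?K" using insert l(1) by simp
    then obtain h where h: "\<exists>k\<in>?K. h k \<noteq> 0" "\<forall>e'\<in>E. (\<Sum>k\<in>?K. ?A e' k * h k) = 0"
      using insert.IH[of ?K ?A] insert.prems by blast
    \<comment> \<open>The value of the pivot unknown \<open>l\<close> dictated by equation
      \<open>e\<close>; the coefficients \<open>?A\<close> arise by substituting it into the other
      equations.\<close>
    define t where "t = - (\<Sum>k\<in>?K. A e k * h k) / A e l"
    let ?h = "h(l := t)"
    have sum: "(\<Sum>k\<in>K. A e' k * ?h k) = A e' l * t + (\<Sum>k\<in>?K. A e' k * h k)" for e'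
      using insert.prems l(1) by (subst sum.remove[of _ l]) (auto intro!: sum.cong)
    have "(\<Sum>k\<in>K. A e' k * ?h k) = 0" if "e' \<in> insert e E" for e'
    proof (cases "e' = e")
      case True then show ?thesis using l(2) by (simp only: sum) (simp add: t_def)
    next
      case False
      have "(\<Sum>k\<in>?K. ?A e' k * h k) = (\<Sum>k\<in>?K. A e' k * h k) + A e' l * t"
        by (simp add: left_diff_distrib right_diff_distrib sum_subtractf t_def sum_distrib_left sum_divide_distrib mult_ac)
      then show ?thesis using h(2) that False by (simp only: sum) (simp add: add.commute)
    qed
    moreover have "\<exists>k\<in>K. ?h k \<noteq> 0" using h(1) by auto
    ultimately show ?thesis by blast
  qed
qed

text \<open>The right-hand side becomes the column of an additional unknown \<open>None\<close>. A
  nontrivial homogeneous solution exists by counting, injectivity forces its value at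
  \<open>None\<close> to be nonzero, and dividing by that value solves the system.\<close>

lemma injective_square_solvable:
  fixes A :: "'e \<Rightarrow> 'k \<Rightarrow> 'f::field"
  assumes "finite E" "finite K" "card E \<le> card K"
    and inj: "\<And>h. (\<And>e. e \<in> E \<Longrightarrow> (\<Sum>k\<in>K. A e k * h k) = 0) \<Longrightarrow> \<forall>k\<in>K. h k = 0"
  shows "\<exists>h. \<forall>e\<in>E. (\<Sum>k\<in>K. A e k * h k) = r e"
proof -
  let ?K = "insert None (Some ` K)" and ?A = "\<lambda>e k. case k of None \<Rightarrow> - r e | Some k \<Rightarrow> A e k"
  have "card ?K = Suc (card K)"
    using assms(2) by (subst card_insert_disjoint) (auto simp: card_image)
  then obtain h where h: "\<exists>k\<in>?K. h k \<noteq> 0" "\<forall>e\<in>E. (\<Sum>k\<in>?K. ?A e k * h k) = 0"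
    using homogeneous_solution[of E ?K ?A] assms(1-3) by auto
  have sum: "(\<Sum>k\<in>K. A e k * h (Some k)) = r e * h None" if "e \<in> E" for e
  proof -
    have "(\<Sum>k\<in>?K. ?A e k * h k) = - r e * h None + (\<Sum>k\<in>K. A e k * h (Some k))"
      using assms(2) by (subst sum.insert) (auto simp: sum.reindex)
    then show ?thesis using h(2) that by simp
  qed
  have "h None \<noteq> 0"
  proof
    assume z: "h None = 0"
    then have "\<forall>k\<in>K. h (Some k) = 0" using inj[of "\<lambda>k. h (Some k)"] sum by simp
    then show False using h(1) z by auto
  qed
  then have "(\<Sum>k\<in>K. A e k * (h (Some k) / h None)) = r e" if "e \<in> E" for e
    using sum[OF that] by (simp add: sum_divide_distrib[symmetric])
  then show ?thesis by (intro exI[of _ "\<lambda>k. h (Some k) / h None"]) blast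
qed

section \<open>The chord method and the Jacobian criterion\<close>

lemma ratpoly_tendsto:
  assumes "ratpoly K G" "\<And>k. k \<in> K \<Longrightarrow> ((\<lambda>n. X n k) \<longlongrightarrow> y k) F"
  shows "((\<lambda>n. G (X n)) \<longlongrightarrow> G y) F"
  using assms by induction (auto intro!: tendsto_intros)

lemma ratpoly_continuous_on:
  assumes "ratpoly K G" "\<And>k. k \<in> K \<Longrightarrow> continuous_on T (\<lambda>s. X s k)"
  shows "continuous_on T (\<lambda>s. G (X s))"
  using assms by induction (auto intro!: continuous_intros)

text \<open>Both points of the pair tend to \<open>a\<close>, observed on \<open>K\<close> only.
  This is the limit that defines strict differentiability, where both ends of a difference quotient
  move.\<close>

definition near2 :: "'k set \<Rightarrow> ('k \<Rightarrow> real) \<Rightarrow> (('k \<Rightarrow> real) \<times> ('k \<Rightarrow> real)) filter" where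
  "near2 K a = (INF \<epsilon>\<in>{0<..}. principal {p. \<forall>k\<in>K. \<bar>fst p k - a k\<bar> \<le> \<epsilon> \<and> \<bar>snd p k - a k\<bar> \<le> \<epsilon>})"

lemma eventually_near2:
  "eventually P (near2 K a) \<longleftrightarrow> (\<exists>\<epsilon>>0. \<forall>p. (\<forall>k\<in>K. \<bar>fst p k - a k\<bar> \<le> \<epsilon> \<and> \<bar>snd p k - a k\<bar> \<le> \<epsilon>) \<longrightarrow> P p)"
  unfolding near2_def
proof (subst eventually_INF_base)
  fix \<epsilon> \<delta> :: real assume "\<epsilon> \<in> {0<..}" "\<delta> \<in> {0<..}"
  then show "\<exists>z\<in>{0<..}. principal {p. \<forall>k\<in>K. \<bar>fst p k - a k\<bar> \<le> z \<and> \<bar>snd p k - a k\<bar> \<le> z}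
      \<le> inf (principal {p. \<forall>k\<in>K. \<bar>fst p k - a k\<bar> \<le> \<epsilon> \<and> \<bar>snd p k - a k\<bar> \<le> \<epsilon>})
          (principal {p. \<forall>k\<in>K. \<bar>fst p k - a k\<bar> \<le> \<delta> \<and> \<bar>snd p k - a k\<bar> \<le> \<delta>})"
    by (intro bexI[of _ "min \<epsilon> \<delta>"]) auto
qed (auto simp: eventually_principal Bex_def)

lemma near2_coordinates:
  assumes "k \<in> K"
  shows "((\<lambda>p. fst p k) \<longlongrightarrow> a k) (near2 K a)" "((\<lambda>p. snd p k) \<longlongrightarrow> a k) (near2 K a)"
proof -
  have "\<forall>\<^sub>F p in near2 K a. dist (fst p k) (a k) < e \<and> dist (snd p k) (a k) < e" if "e > 0" for e
    unfolding eventually_near2 using that assms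
    by (intro exI[of _ "e / 2"]) (fastforce simp: dist_real_def)
  then show "((\<lambda>p. fst p k) \<longlongrightarrow> a k) (near2 K a)" "((\<lambda>p. snd p k) \<longlongrightarrow> a k) (near2 K a)"
    unfolding tendsto_iff by (auto simp: eventually_conj_iff)
qed

text \<open>Polynomials have exact difference quotients, built along the inductive definition by the
  product rule. Their continuity on the diagonal yields the derivative and its strictness at
  once.\<close>

lemma ratpoly_difference_quotients:
  assumes K: "finite K" and "ratpoly K g"
  shows "\<exists>D. (\<forall>x y. g y - g x = (\<Sum>k\<in>K. D k x y * (y k - x k))) \<and>
    (\<forall>a k. ((\<lambda>p. D k (fst p) (snd p)) \<longlongrightarrow> D k a a) (near2 K a))"
  using assms(2)
proof induction
  case (ratpoly_const c)
  show ?case by (intro exI[of _ "\<lambda>_ _ _. 0"]) auto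
next
  case (ratpoly_var i)
  show ?case
  proof (intro exI[of _ "\<lambda>k _ _. if k = i then 1 else 0"] conjI allI)
    fix x y :: "'a \<Rightarrow> real"
    have "(\<Sum>k\<in>K. (if k = i then 1 else 0) * (y k - x k)) = (\<Sum>k\<in>K. if k = i then y k - x k else 0)"
      by (intro sum.cong) auto
    then show "y i - x i = (\<Sum>k\<in>K. (if k = i then 1 else 0) * (y k - x k))"
      using K ratpoly_var by simp
  qed auto
next
  case (ratpoly_add F G)
  then obtain D D' where D: "\<And>x y. F y - F x = (\<Sum>k\<in>K. D k x y * (y k - x k))"
      "\<And>a k. ((\<lambda>p. D k (fst p) (snd p)) \<longlongrightarrow> D k a a) (near2 K a)"
    and D': "\<And>x y. G y - G x = (\<Sum>k\<in>K. D' k x y * (y k - x k))"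
      "\<And>a k. ((\<lambda>p. D' k (fst p) (snd p)) \<longlongrightarrow> D' k a a) (near2 K a)" by blast
  show ?case
  proof (intro exI[of _ "\<lambda>k x y. D k x y + D' k x y"] conjI allI)
    fix x y :: "'a \<Rightarrow> real"
    have "F y + G y - (F x + G x) = (F y - F x) + (G y - G x)" by simp
    then show "F y + G y - (F x + G x) = (\<Sum>k\<in>K. (D k x y + D' k x y) * (y k - x k))"
      unfolding D(1) D'(1) by (simp add: distrib_right sum.distrib)
  qed (intro tendsto_intros D(2) D'(2))
next
  case (ratpoly_mult F G)
  then obtain D D' where D: "\<And>x y. F y - F x = (\<Sum>k\<in>K. D k x y * (y k - x k))"
      "\<And>a k. ((\<lambda>p. D k (fst p) (snd p)) \<longlongrightarrow> D k a a) (near2 K a)"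
    and D': "\<And>x y. G y - G x = (\<Sum>k\<in>K. D' k x y * (y k - x k))"
      "\<And>a k. ((\<lambda>p. D' k (fst p) (snd p)) \<longlongrightarrow> D' k a a) (near2 K a)" by blast
  show ?case
  proof (intro exI[of _ "\<lambda>k x y. F y * D' k x y + G x * D k x y"] conjI allI)
    fix x y :: "'a \<Rightarrow> real"
    have "F y * G y - F x * G x = F y * (G y - G x) + G x * (F y - F x)" by (simp add: algebra_simps)
    then show "F y * G y - F x * G x = (\<Sum>k\<in>K. (F y * D' k x y + G x * D k x y) * (y k - x k))"
      unfolding D(1) D'(1) by (simp only: distrib_right sum.distrib sum_distrib_left mult.assoc)
  next
    fix a k
    have "((\<lambda>p. F (snd p)) \<longlongrightarrow> F a) (near2 K a)"
      using ratpoly_mult(1) near2_coordinates(2) by (rule ratpoly_tendsto)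
    moreover have "((\<lambda>p. G (fst p)) \<longlongrightarrow> G a) (near2 K a)"
      using ratpoly_mult(2) near2_coordinates(1) by (rule ratpoly_tendsto)
    ultimately show "((\<lambda>p. F (snd p) * D' k (fst p) (snd p) + G (fst p) * D k (fst p) (snd p))
        \<longlongrightarrow> F a * D' k a a + G a * D k a a) (near2 K a)"
      by (intro tendsto_intros D(2) D'(2))
  qed
qed

lemma near2_line:
  assumes "finite K"
  shows "filterlim (\<lambda>s. (a, \<lambda>k. a k + s * h k)) (near2 K a) (at 0)"
proof -
  have "\<forall>\<^sub>F s in at 0. \<forall>k\<in>K. \<bar>s * h k\<bar> \<le> \<epsilon>" if "\<epsilon> > 0" for \<epsilon> :: real
  proof (rule eventually_ball_finite[OF assms], rule ballI)
    fix k
    have "((\<lambda>s. s * h k) \<longlongrightarrow> 0) (at 0)" by (auto intro!: tendsto_eq_intros)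
    then have "\<forall>\<^sub>F s in at 0. \<bar>s * h k\<bar> < \<epsilon>" using that by (auto simp: tendsto_iff dist_real_def)
    then show "\<forall>\<^sub>F s in at 0. \<bar>s * h k\<bar> \<le> \<epsilon>" by eventually_elim simp
  qed
  then show ?thesis unfolding near2_def by (auto simp: filterlim_INF filterlim_principal)
qed

text \<open>Along a line only one real variable is involved, so the index type needs neither a
  topology nor finiteness.\<close>

definition dir_deriv :: "(('k \<Rightarrow> real) \<Rightarrow> real) \<Rightarrow> ('k \<Rightarrow> real) \<Rightarrow> ('k \<Rightarrow> real) \<Rightarrow> real \<Rightarrow> bool" where
  "dir_deriv g a h r \<longleftrightarrow> ((\<lambda>s. g (\<lambda>k. a k + s * h k)) has_real_derivative r) (at 0)"

lemma dir_deriv_unique: "dir_deriv g a h r \<Longrightarrow> dir_deriv g a h r' \<Longrightarrow> r = r'"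
  unfolding dir_deriv_def by (rule DERIV_unique)

text \<open>The strict version is what the contraction estimate needs: it compares two consecutive
  iterates, neither of which is \<open>a\<close>.\<close>

definition strict_gradient :: "'k set \<Rightarrow> (('k \<Rightarrow> real) \<Rightarrow> real) \<Rightarrow> ('k \<Rightarrow> real) \<Rightarrow> ('k \<Rightarrow> real) \<Rightarrow> bool" where
  "strict_gradient K g a A \<longleftrightarrow> (\<forall>\<eta>>0. \<exists>\<epsilon>>0. \<forall>x y.
    (\<forall>k\<in>K. \<bar>x k - a k\<bar> \<le> \<epsilon> \<and> \<bar>y k - a k\<bar> \<le> \<epsilon>) \<longrightarrow>
      \<bar>g y - g x - (\<Sum>k\<in>K. A k * (y k - x k))\<bar> \<le> \<eta> * (\<Sum>k\<in>K. \<bar>y k - x k\<bar>))"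

lemma ratpoly_gradient:
  assumes K: "finite K" and g: "ratpoly K g"
  shows "\<exists>A. strict_gradient K g a A \<and> (\<forall>h. dir_deriv g a h (\<Sum>k\<in>K. A k * h k))"
proof -
  obtain D where D: "\<And>x y. g y - g x = (\<Sum>k\<in>K. D k x y * (y k - x k))"
    and lim: "\<And>k. ((\<lambda>p. D k (fst p) (snd p)) \<longlongrightarrow> D k a a) (near2 K a)"
    using ratpoly_difference_quotients[OF K g] by blast
  show ?thesis
  proof (intro exI[of _ "\<lambda>k. D k a a"] conjI allI)
    fix h
    let ?z = "\<lambda>s k. a k + s * h k"
    have "((\<lambda>s. D k a (?z s)) \<longlongrightarrow> D k a a) (at 0)" for k
      using filterlim_compose[OF lim near2_line[OF K]] by simp
    then have "((\<lambda>s. \<Sum>k\<in>K. D k a (?z s) * h k) \<longlongrightarrow> (\<Sum>k\<in>K. D k a a * h k)) (at 0)"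
      by (intro tendsto_intros)
    moreover have "\<forall>\<^sub>F s in at 0. (\<Sum>k\<in>K. D k a (?z s) * h k) = (g (?z s) - g a) / s"
      unfolding D by (auto simp: eventually_at_filter sum_divide_distrib intro!: always_eventually sum.cong)
    ultimately have "((\<lambda>s. (g (?z s) - g a) / s) \<longlongrightarrow> (\<Sum>k\<in>K. D k a a * h k)) (at 0)"
      by (rule Lim_transform_eventually)
    then show "dir_deriv g a h (\<Sum>k\<in>K. D k a a * h k)"
      by (simp add: dir_deriv_def DERIV_def)
  next
    show "strict_gradient K g a (\<lambda>k. D k a a)" unfolding strict_gradient_def
    proof (intro allI impI)
      fix \<eta> :: real assume \<eta>: "\<eta> > 0"
      have "\<forall>\<^sub>F p in near2 K a. \<forall>k\<in>K. \<bar>D k (fst p) (snd p) - D k a a\<bar> \<le> \<eta>"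
      proof (rule eventually_ball_finite[OF K], rule ballI)
        fix k
        have "\<forall>\<^sub>F p in near2 K a. \<bar>D k (fst p) (snd p) - D k a a\<bar> < \<eta>"
          using lim[of k] \<eta> by (auto simp: tendsto_iff dist_real_def)
        then show "\<forall>\<^sub>F p in near2 K a. \<bar>D k (fst p) (snd p) - D k a a\<bar> \<le> \<eta>" by eventually_elim simp
      qed
      then obtain \<epsilon> where \<epsilon>: "\<epsilon> > 0" "\<And>x y k. (\<And>k. k\<in>K \<Longrightarrow> \<bar>x k - a k\<bar> \<le> \<epsilon> \<and> \<bar>y k - a k\<bar> \<le> \<epsilon>) \<Longrightarrow>
          k \<in> K \<Longrightarrow> \<bar>D k x y - D k a a\<bar> \<le> \<eta>"
        unfolding eventually_near2 by (auto simp: split_paired_all)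
      have "\<bar>g y - g x - (\<Sum>k\<in>K. D k a a * (y k - x k))\<bar> \<le> \<eta> * (\<Sum>k\<in>K. \<bar>y k - x k\<bar>)"
        if "\<forall>k\<in>K. \<bar>x k - a k\<bar> \<le> \<epsilon> \<and> \<bar>y k - a k\<bar> \<le> \<epsilon>" for x y
      proof -
        have "g y - g x - (\<Sum>k\<in>K. D k a a * (y k - x k)) = (\<Sum>k\<in>K. (D k x y - D k a a) * (y k - x k))"
          unfolding D by (simp add: left_diff_distrib sum_subtractf)
        also have "\<bar>\<dots>\<bar> \<le> (\<Sum>k\<in>K. \<bar>(D k x y - D k a a) * (y k - x k)\<bar>)" by (rule sum_abs)
        also have "\<dots> \<le> (\<Sum>k\<in>K. \<eta> * \<bar>y k - x k\<bar>)"
          unfolding abs_mult using \<epsilon>(2)[of x y] that by (intro sum_mono mult_right_mono) auto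
        finally show ?thesis by (simp add: sum_distrib_left)
      qed
      then show "\<exists>\<epsilon>>0. \<forall>x y. (\<forall>k\<in>K. \<bar>x k - a k\<bar> \<le> \<epsilon> \<and> \<bar>y k - a k\<bar> \<le> \<epsilon>) \<longrightarrow>
        \<bar>g y - g x - (\<Sum>k\<in>K. D k a a * (y k - x k))\<bar> \<le> \<eta> * (\<Sum>k\<in>K. \<bar>y k - x k\<bar>)"
        using \<epsilon>(1) by blast
    qed
  qed
qed

text \<open>Surjectivity of the Jacobian, expressed through directions instead of a matrix.\<close>

definition regular_at :: "'e set \<Rightarrow> ('e \<Rightarrow> ('k \<Rightarrow> real) \<Rightarrow> real) \<Rightarrow> ('k \<Rightarrow> real) \<Rightarrow> bool" where
  "regular_at E g a \<longleftrightarrow> (\<forall>r. \<exists>h. \<forall>e\<in>E. dir_deriv (g e) a h (r e))"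

text \<open>The chord method: \<open>M\<close> is a right inverse of the derivative at \<open>a\<close>, and every step
  \<open>X n + M (c - g (X n))\<close> halves the residual.\<close>
lemma chord_method:
  fixes g :: "'e \<Rightarrow> ('k \<Rightarrow> real) \<Rightarrow> real"
  assumes K: "finite K" and E: "finite E" and g: "\<And>e. e \<in> E \<Longrightarrow> ratpoly K (g e)"
    and reg: "regular_at E g a"
  shows "\<exists>C \<epsilon>. \<exists>\<Phi> :: ('e \<Rightarrow> real) \<Rightarrow> ('k \<Rightarrow> real) \<Rightarrow> 'k \<Rightarrow> real. C > 0 \<and> \<epsilon> > 0 \<and>
    (\<forall>x c. (\<forall>k\<in>K. \<bar>x k - a k\<bar> \<le> \<epsilon>) \<and> (\<Sum>e\<in>E. \<bar>c e - g e x\<bar>) \<le> \<epsilon> \<longrightarrow>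
      (\<forall>e\<in>E. g e (\<Phi> c x) = c e) \<and> (\<forall>k. \<bar>\<Phi> c x k - x k\<bar> \<le> C * (\<Sum>e\<in>E. \<bar>c e - g e x\<bar>))) \<and>
    (\<forall>(X :: real \<Rightarrow> 'k \<Rightarrow> real) T c. (\<forall>k. continuous_on T (\<lambda>s. X s k)) \<and>
      (\<forall>s\<in>T. (\<forall>k\<in>K. \<bar>X s k - a k\<bar> \<le> \<epsilon>) \<and> (\<Sum>e\<in>E. \<bar>c e - g e (X s)\<bar>) \<le> \<epsilon>) \<longrightarrow>
      (\<forall>k. continuous_on T (\<lambda>s. \<Phi> c (X s) k)))"
proof -
  have "\<forall>e\<in>E. \<exists>A. strict_gradient K (g e) a A \<and> (\<forall>h. dir_deriv (g e) a h (\<Sum>k\<in>K. A k * h k))"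
    using ratpoly_gradient[OF K g] by blast
  then obtain A where A1: "\<And>e h. e \<in> E \<Longrightarrow> dir_deriv (g e) a h (\<Sum>k\<in>K. A e k * h k)"
    and A2: "\<And>e. e \<in> E \<Longrightarrow> strict_gradient K (g e) a (A e)"
    unfolding bchoice_iff by blast
  have "\<forall>e'. \<exists>h. \<forall>e\<in>E. (\<Sum>k\<in>K. A e k * h k) = (if e = e' then 1 else 0)"
  proof
    fix e'
    obtain h where h: "\<forall>e\<in>E. dir_deriv (g e) a h (if e = e' then 1 else 0)"
      using reg unfolding regular_at_def by (drule_tac x="\<lambda>e. if e = e' then 1 else 0" in spec) blast
    then show "\<exists>h. \<forall>e\<in>E. (\<Sum>k\<in>K. A e k * h k) = (if e = e' then 1 else 0)"
      using dir_deriv_unique[OF A1] by blast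
  qed
  then obtain M0 where M0: "\<And>e e'. e \<in> E \<Longrightarrow> (\<Sum>k\<in>K. A e k * M0 e' k) = (if e = e' then 1 else 0)"
    unfolding choice_iff by blast
  \<comment> \<open>Cut off outside \<open>K\<close>, so that the iteration leaves foreign
    coordinates untouched and the displacement bound holds for every \<open>k\<close>.\<close>
  define M where "M = (\<lambda>e k. if k \<in> K then M0 e k else 0)"
  have M: "(\<Sum>k\<in>K. A e k * M e' k) = (if e = e' then 1 else 0)" if "e \<in> E" for e e'
    unfolding M0[OF that, symmetric] by (intro sum.cong) (auto simp: M_def)
  define C where "C = (\<Sum>e\<in>E. \<Sum>k\<in>K. \<bar>M e k\<bar>) + 1"
  have C: "C > 0" unfolding C_def by (simp add: add_nonneg_pos sum_nonneg)
  define step where "step = (\<lambda>r k. \<Sum>e\<in>E. r e * M e k)"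
  have step_sum: "(\<Sum>k\<in>K. \<bar>step r k\<bar>) \<le> C * (\<Sum>e\<in>E. \<bar>r e\<bar>)" for r
  proof -
    have "(\<Sum>k\<in>K. \<bar>step r k\<bar>) \<le> (\<Sum>k\<in>K. \<Sum>e\<in>E. \<bar>r e\<bar> * \<bar>M e k\<bar>)"
      unfolding step_def by (intro sum_mono order.trans[OF sum_abs]) (simp add: abs_mult)
    also have "\<dots> = (\<Sum>e\<in>E. \<bar>r e\<bar> * (\<Sum>k\<in>K. \<bar>M e k\<bar>))"
      by (subst sum.swap) (simp add: sum_distrib_left)
    also have "\<dots> \<le> (\<Sum>e\<in>E. \<bar>r e\<bar> * C)"
    proof (intro sum_mono mult_left_mono)
      fix e assume "e \<in> E"
      then have "(\<Sum>k\<in>K. \<bar>M e k\<bar>) \<le> (\<Sum>e\<in>E. \<Sum>k\<in>K. \<bar>M e k\<bar>)"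
        using E by (intro member_le_sum) (auto intro: sum_nonneg)
      then show "(\<Sum>k\<in>K. \<bar>M e k\<bar>) \<le> C" by (simp add: C_def)
    qed auto
    finally show ?thesis by (simp add: sum_distrib_left mult.commute)
  qed
  have step_le: "\<bar>step r k\<bar> \<le> C * (\<Sum>e\<in>E. \<bar>r e\<bar>)" for r k
  proof (cases "k \<in> K")
    case True
    then have "\<bar>step r k\<bar> \<le> (\<Sum>k\<in>K. \<bar>step r k\<bar>)" using K by (intro member_le_sum) auto
    then show ?thesis using step_sum by (rule order_trans)
  next
    case False
    then show ?thesis using C by (simp add: step_def M_def sum_nonneg)
  qed
  \<comment> \<open>Each of the \<open>card E\<close> new residuals is at most
    \<open>\<eta> * C\<close> times the old total; with this \<open>\<eta>\<close> they add up to at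
    most half of it.\<close>
  define \<eta> where "\<eta> = 1 / (2 * C * (card E + 1))"
  have \<eta>: "\<eta> > 0" using C by (simp add: \<eta>_def)
  have "\<forall>e\<in>E. \<exists>\<epsilon>. \<epsilon> > 0 \<and> (\<forall>x y. (\<forall>k\<in>K. \<bar>x k - a k\<bar> \<le> \<epsilon> \<and> \<bar>y k - a k\<bar> \<le> \<epsilon>) \<longrightarrow>
      \<bar>g e y - g e x - (\<Sum>k\<in>K. A e k * (y k - x k))\<bar> \<le> \<eta> * (\<Sum>k\<in>K. \<bar>y k - x k\<bar>))"
    using A2 \<eta> unfolding strict_gradient_def by blast
  then obtain \<epsilon>' where \<epsilon>': "\<And>e. e \<in> E \<Longrightarrow> \<epsilon>' e > 0"
    "\<And>e x y. e \<in> E \<Longrightarrow> (\<forall>k\<in>K. \<bar>x k - a k\<bar> \<le> \<epsilon>' e \<and> \<bar>y k - a k\<bar> \<le> \<epsilon>' e) \<Longrightarrow>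
      \<bar>g e y - g e x - (\<Sum>k\<in>K. A e k * (y k - x k))\<bar> \<le> \<eta> * (\<Sum>k\<in>K. \<bar>y k - x k\<bar>)"
    unfolding bchoice_iff by blast
  define \<epsilon>1 where "\<epsilon>1 = Min (insert 1 (\<epsilon>' ` E))"
  have \<epsilon>1: "\<epsilon>1 > 0" "\<And>e. e \<in> E \<Longrightarrow> \<epsilon>1 \<le> \<epsilon>' e"
    unfolding \<epsilon>1_def using E \<epsilon>'(1) by (auto intro!: Min_le)
  have strict: "\<bar>g e y - g e x - (\<Sum>k\<in>K. A e k * (y k - x k))\<bar> \<le> \<eta> * (\<Sum>k\<in>K. \<bar>y k - x k\<bar>)"
    if "e \<in> E" "\<And>k. k \<in> K \<Longrightarrow> \<bar>x k - a k\<bar> \<le> \<epsilon>1" "\<And>k. k \<in> K \<Longrightarrow> \<bar>y k - a k\<bar> \<le> \<epsilon>1" for e x y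
    using \<epsilon>'(2)[OF that(1)] \<epsilon>1(2)[OF that(1)] that(2,3) by (meson order_trans)
  \<comment> \<open>Iterates start within \<open>\<epsilon>\<close> of \<open>a\<close> and travel
    at most \<open>2 * C * \<epsilon>\<close>; the sum is \<open>\<epsilon>1\<close>, the size of
    the box where the strict estimate is available.\<close>
  define \<epsilon> where "\<epsilon> = \<epsilon>1 / (1 + 2 * C)"
  have \<epsilon>: "\<epsilon> > 0" "\<epsilon> + 2 * C * \<epsilon> = \<epsilon>1"
  proof -
    have "1 + 2 * C > 0" using C by simp
    then have "(1 + 2 * C) * \<epsilon> = \<epsilon>1" by (simp add: \<epsilon>_def)
    then show "\<epsilon> + 2 * C * \<epsilon> = \<epsilon>1" by (simp add: distrib_right)
    show "\<epsilon> > 0" using \<open>1 + 2 * C > 0\<close> \<epsilon>1(1) by (simp add: \<epsilon>_def)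
  qed
  define X where "X = (\<lambda>c x n. ((\<lambda>z k. z k + step (\<lambda>e. c e - g e z) k) ^^ n) x)"
  define R where "R = (\<lambda>c z. \<Sum>e\<in>E. \<bar>c e - g e z\<bar>)"
  have X0: "X c x 0 = x" for c x by (simp add: X_def)
  have XS: "X c x (Suc n) = (\<lambda>k. X c x n k + step (\<lambda>e. c e - g e (X c x n)) k)" for c x n
    by (simp add: X_def)
  have R0: "R c z \<ge> 0" for c z by (simp add: R_def sum_nonneg)
  \<comment> \<open>The factor \<open>1 - (1/2)^n\<close> is the partial sum of the geometric series
    of step lengths; carrying it along keeps the iterates in the box without a separate
    argument.\<close>
  have inv: "R c (X c x n) \<le> R c x * (1/2)^n \<and> (\<forall>k. \<bar>X c x n k - x k\<bar> \<le> 2 * C * R c x * (1 - (1/2)^n))"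
    if near: "\<And>k. k \<in> K \<Longrightarrow> \<bar>x k - a k\<bar> \<le> \<epsilon>" and small: "R c x \<le> \<epsilon>" for c x n
  proof (induction n)
    case 0 then show ?case by (simp add: X0)
  next
    case (Suc n)
    let ?z = "X c x n" and ?z' = "X c x (Suc n)"
    let ?r = "\<lambda>e. c e - g e ?z"
    have close: "\<bar>?z' k - x k\<bar> \<le> 2 * C * R c x * (1 - (1/2)^Suc n)" for k
    proof -
      have "\<bar>?z' k - x k\<bar> \<le> \<bar>?z k - x k\<bar> + \<bar>step ?r k\<bar>" by (simp add: XS)
      also have "\<dots> \<le> 2 * C * R c x * (1 - (1/2)^n) + C * R c ?z"
        using Suc step_le[of ?r k] by (intro add_mono) (auto simp: R_def)
      also have "C * R c ?z \<le> C * (R c x * (1/2)^n)" using Suc C by (intro mult_left_mono) auto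
      finally show ?thesis by (simp add: algebra_simps)
    qed
    have box: "\<bar>w k - a k\<bar> \<le> \<epsilon>1"
      if "k \<in> K" "\<bar>w k - x k\<bar> \<le> 2 * C * R c x * (1 - (1/2)^m)" for w k m
    proof -
      have "2 * C * R c x * (1 - (1/2)^m) \<le> 2 * C * R c x * 1"
        using C R0 by (intro mult_left_mono) auto
      also have "\<dots> \<le> 2 * C * \<epsilon>" using C small by simp
      finally have "\<bar>w k - x k\<bar> \<le> 2 * C * \<epsilon>" using that(2) by simp
      then show ?thesis using near[OF that(1)] \<epsilon>(2) by linarith
    qed
    have "\<bar>c e - g e ?z'\<bar> \<le> \<eta> * (C * R c ?z)" if "e \<in> E" for e
    proof -
      have "(\<Sum>k\<in>K. A e k * (?z' k - ?z k)) = (\<Sum>e'\<in>E. ?r e' * (\<Sum>k\<in>K. A e k * M e' k))"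
        unfolding XS step_def by (simp add: sum_distrib_left mult_ac) (rule sum.swap)
      also have "\<dots> = (\<Sum>e'\<in>E. if e = e' then ?r e' else 0)"
        by (intro sum.cong) (auto simp: M[OF that])
      also have "\<dots> = ?r e" using E that by simp
      finally have "c e - g e ?z' = - (g e ?z' - g e ?z - (\<Sum>k\<in>K. A e k * (?z' k - ?z k)))" by simp
      then have "\<bar>c e - g e ?z'\<bar> = \<bar>g e ?z' - g e ?z - (\<Sum>k\<in>K. A e k * (?z' k - ?z k))\<bar>"
        by (metis abs_minus_cancel)
      also have "\<dots> \<le> \<eta> * (\<Sum>k\<in>K. \<bar>?z' k - ?z k\<bar>)"
      proof (rule strict[OF that])
        show "\<bar>?z k - a k\<bar> \<le> \<epsilon>1" if "k \<in> K" for k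
          by (rule box[OF that, where m = n]) (use Suc in blast)
        show "\<bar>?z' k - a k\<bar> \<le> \<epsilon>1" if "k \<in> K" for k
          by (rule box[OF that, where m = "Suc n"]) (rule close)
      qed
      also have "(\<Sum>k\<in>K. \<bar>?z' k - ?z k\<bar>) \<le> C * R c ?z"
        using step_sum[of ?r] by (simp add: XS R_def)
      finally show ?thesis using \<eta> by simp
    qed
    then have "(\<Sum>e\<in>E. \<bar>c e - g e ?z'\<bar>) \<le> (\<Sum>e\<in>E. \<eta> * (C * R c ?z))" by (rule sum_mono)
    then have "R c ?z' \<le> (\<Sum>e\<in>E. \<eta> * (C * R c ?z))" by (simp only: R_def)
    also have "\<dots> = (card E * \<eta> * C) * R c ?z" by simp
    also have "\<dots> \<le> (1/2) * R c ?z"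
      using C R0 by (intro mult_right_mono) (auto simp: \<eta>_def divide_simps)
    also have "\<dots> \<le> (1/2) * (R c x * (1/2)^n)" using Suc by simp
    finally show ?case using close by simp
  qed
  define d where "d = (\<lambda>c k n x. X c x (Suc n) k - X c x n k)"
  \<comment> \<open>The limit is written as a series of increments so that the Weierstrass test
    gives continuity in the starting point.\<close>
  define \<Phi> where "\<Phi> = (\<lambda>c x k. x k + (\<Sum>n. d c k n x))"
  have d: "\<bar>d c k n x\<bar> \<le> C * R c x * (1/2)^n"
    if "\<And>k. k \<in> K \<Longrightarrow> \<bar>x k - a k\<bar> \<le> \<epsilon>" "R c x \<le> \<epsilon>" for c x n k
  proof -
    have "\<bar>d c k n x\<bar> \<le> C * R c (X c x n)"
      using step_le[of "\<lambda>e. c e - g e (X c x n)" k] by (simp add: d_def XS R_def)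
    also have "\<dots> \<le> C * (R c x * (1/2)^n)" using inv[OF that] C by (intro mult_left_mono) auto
    finally show ?thesis by (simp add: mult_ac)
  qed
  have partial: "X c x n k = x k + (\<Sum>i<n. d c k i x)" for c x n k
    by (induction n) (simp_all add: X0 d_def)
  have geo: "summable (\<lambda>n. r * (1/2::real)^n)" for r by (intro summable_mult summable_geometric) auto
  have geo_sum: "(\<Sum>n. r * (1/2::real)^n) = 2 * r" for r
    by (subst suminf_mult) (auto simp: suminf_geometric summable_geometric)
  have solution: "(\<forall>e\<in>E. g e (\<Phi> c x) = c e) \<and> (\<forall>k. \<bar>\<Phi> c x k - x k\<bar> \<le> 2 * C * (\<Sum>e\<in>E. \<bar>c e - g e x\<bar>))"
    if "(\<forall>k\<in>K. \<bar>x k - a k\<bar> \<le> \<epsilon>) \<and> (\<Sum>e\<in>E. \<bar>c e - g e x\<bar>) \<le> \<epsilon>" for x c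
  proof -
    from that have near: "\<And>k. k \<in> K \<Longrightarrow> \<bar>x k - a k\<bar> \<le> \<epsilon>" and small: "R c x \<le> \<epsilon>" by (auto simp: R_def)
    have dn: "norm (d c k n x) \<le> C * R c x * (1/2)^n" for k n using d[OF near small] by simp
    have sm: "summable (\<lambda>n. norm (d c k n x))" for k
      by (rule summable_comparison_test'[OF geo[of "C * R c x"], of 0]) (use dn in auto)
    have lim: "(\<lambda>n. X c x n k) \<longlonglongrightarrow> \<Phi> c x k" for k
      unfolding partial \<Phi>_def by (intro tendsto_intros summable_LIMSEQ summable_norm_cancel[OF sm])
    have "g e (\<Phi> c x) = c e" if "e \<in> E" for e
    proof -
      have l1: "(\<lambda>n. g e (X c x n)) \<longlonglongrightarrow> g e (\<Phi> c x)" using g[OF that] lim by (rule ratpoly_tendsto)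
      have "(\<lambda>n. c e - g e (X c x n)) \<longlonglongrightarrow> 0"
      proof (rule tendsto_rabs_zero_cancel, rule tendsto_sandwich[where f = "\<lambda>_. 0" and h = "\<lambda>n. R c x * (1/2)^n"])
        have "\<bar>c e - g e (X c x n)\<bar> \<le> R c (X c x n)" for n
          unfolding R_def using E that by (intro member_le_sum) auto
        then have "\<bar>c e - g e (X c x n)\<bar> \<le> R c x * (1/2)^n" for n using inv[OF near small, of n] order_trans by blast
        then show "\<forall>\<^sub>F n in sequentially. \<bar>c e - g e (X c x n)\<bar> \<le> R c x * (1/2)^n" by simp
        show "(\<lambda>n. R c x * (1/2)^n) \<longlonglongrightarrow> 0" by (intro tendsto_mult_right_zero LIMSEQ_realpow_zero) auto
      qed auto
      then have "(\<lambda>n. c e - (c e - g e (X c x n))) \<longlonglongrightarrow> c e - 0" by (intro tendsto_intros)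
      then show ?thesis using l1 LIMSEQ_unique by auto
    qed
    moreover have "\<bar>\<Phi> c x k - x k\<bar> \<le> 2 * C * (\<Sum>e\<in>E. \<bar>c e - g e x\<bar>)" for k
    proof -
      have "\<bar>\<Phi> c x k - x k\<bar> = norm (\<Sum>n. d c k n x)" by (simp add: \<Phi>_def)
      also have "\<dots> \<le> (\<Sum>n. norm (d c k n x))" by (rule summable_norm[OF sm])
      also have "\<dots> \<le> (\<Sum>n. C * R c x * (1/2)^n)" using dn sm geo by (intro suminf_le) auto
      finally show ?thesis by (simp only: geo_sum) (simp add: R_def)
    qed
    ultimately show "(\<forall>e\<in>E. g e (\<Phi> c x) = c e) \<and> (\<forall>k. \<bar>\<Phi> c x k - x k\<bar> \<le> 2 * C * (\<Sum>e\<in>E. \<bar>c e - g e x\<bar>))"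
      by blast
  qed
  have continuity: "\<forall>k. continuous_on T (\<lambda>s. \<Phi> c (Y s) k)"
    if Y: "(\<forall>k. continuous_on T (\<lambda>s. Y s k)) \<and>
      (\<forall>s\<in>T. (\<forall>k\<in>K. \<bar>Y s k - a k\<bar> \<le> \<epsilon>) \<and> (\<Sum>e\<in>E. \<bar>c e - g e (Y s)\<bar>) \<le> \<epsilon>)"
    for Y :: "real \<Rightarrow> 'k \<Rightarrow> real" and T c
  proof
    fix k
    from Y have cont: "\<And>k. continuous_on T (\<lambda>s. Y s k)"
      and near: "\<And>s k. s \<in> T \<Longrightarrow> k \<in> K \<Longrightarrow> \<bar>Y s k - a k\<bar> \<le> \<epsilon>"
      and small: "\<And>s. s \<in> T \<Longrightarrow> R c (Y s) \<le> \<epsilon>" by (auto simp: R_def)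
    have contX: "continuous_on T (\<lambda>s. X c (Y s) n k)" for n k
    proof (induction n arbitrary: k)
      case 0 then show ?case using cont by (simp add: X0)
    next
      case (Suc n)
      have "continuous_on T (\<lambda>s. g e (X c (Y s) n))" if "e \<in> E" for e
        using g[OF that] Suc by (rule ratpoly_continuous_on)
      then show ?case unfolding XS step_def by (intro continuous_intros Suc) auto
    qed
    have "uniform_limit T (\<lambda>n s. \<Sum>i<n. d c k i (Y s)) (\<lambda>s. \<Sum>n. d c k n (Y s)) sequentially"
    proof (rule Weierstrass_m_test[where M = "\<lambda>n. C * \<epsilon> * (1/2)^n"])
      fix n s assume s: "s \<in> T"
      have "norm (d c k n (Y s)) \<le> C * R c (Y s) * (1/2)^n" using d[OF near small, OF s _ s] by simp
      also have "\<dots> \<le> C * \<epsilon> * (1/2)^n" using C small[OF s] by (intro mult_right_mono mult_left_mono) auto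
      finally show "norm (d c k n (Y s)) \<le> C * \<epsilon> * (1/2)^n" .
    qed (rule geo)
    then have "continuous_on T (\<lambda>s. \<Sum>n. d c k n (Y s))"
      by (rule uniform_limit_theorem[rotated])
        (auto simp: d_def intro!: always_eventually continuous_intros contX)
    then show "continuous_on T (\<lambda>s. \<Phi> c (Y s) k)" unfolding \<Phi>_def by (intro continuous_intros cont)
  qed
  have "2 * C > 0" using C by simp
  then show ?thesis using \<epsilon>(1) solution continuity
    by (intro exI[of _ "2 * C"] exI[of _ \<epsilon>] exI[of _ \<Phi>]) blast
qed

theorem regular_locally_solvable:
  fixes g :: "'e \<Rightarrow> ('k \<Rightarrow> real) \<Rightarrow> real"
  assumes "finite K" "finite E" "\<And>e. e \<in> E \<Longrightarrow> ratpoly K (g e)" "regular_at E g a" "\<epsilon> > 0"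
  shows "\<exists>\<delta>>0. \<forall>c. (\<forall>e\<in>E. \<bar>c e - g e a\<bar> < \<delta>) \<longrightarrow> (\<exists>b. (\<forall>k. \<bar>b k - a k\<bar> < \<epsilon>) \<and> (\<forall>e\<in>E. g e b = c e))"
proof -
  obtain C \<epsilon>1 and \<Phi> :: "('e \<Rightarrow> real) \<Rightarrow> ('k \<Rightarrow> real) \<Rightarrow> 'k \<Rightarrow> real" where C: "C > 0" "\<epsilon>1 > 0"
    and \<Phi>: "\<And>x c. (\<forall>k\<in>K. \<bar>x k - a k\<bar> \<le> \<epsilon>1) \<and> (\<Sum>e\<in>E. \<bar>c e - g e x\<bar>) \<le> \<epsilon>1 \<Longrightarrow>
      (\<forall>e\<in>E. g e (\<Phi> c x) = c e) \<and> (\<forall>k. \<bar>\<Phi> c x k - x k\<bar> \<le> C * (\<Sum>e\<in>E. \<bar>c e - g e x\<bar>))"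
    using chord_method[OF assms(1-4)] by blast
  \<comment> \<open>The residual is a sum over \<open>E\<close>, hence the denominator; the two
    bounds keep it in the range of the chord method and the displacement below
    \<open>\<epsilon>\<close>.\<close>
  define \<delta> where "\<delta> = min \<epsilon>1 (\<epsilon> / (2 * C)) / (card E + 1)"
  have \<delta>: "\<delta> > 0" using C assms(5) by (simp add: \<delta>_def)
  have "\<exists>b. (\<forall>k. \<bar>b k - a k\<bar> < \<epsilon>) \<and> (\<forall>e\<in>E. g e b = c e)" if c: "\<forall>e\<in>E. \<bar>c e - g e a\<bar> < \<delta>" for c
  proof -
    have "(\<Sum>e\<in>E. \<bar>c e - g e a\<bar>) \<le> (\<Sum>e\<in>E. \<delta>)" using c by (intro sum_mono) auto
    also have "\<dots> \<le> (card E + 1) * \<delta>" using \<delta> by simp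
    also have "\<dots> = min \<epsilon>1 (\<epsilon> / (2 * C))" by (simp add: \<delta>_def)
    finally have le: "(\<Sum>e\<in>E. \<bar>c e - g e a\<bar>) \<le> \<epsilon>1" "(\<Sum>e\<in>E. \<bar>c e - g e a\<bar>) \<le> \<epsilon> / (2 * C)" by auto
    have "C * (\<Sum>e\<in>E. \<bar>c e - g e a\<bar>) \<le> C * (\<epsilon> / (2 * C))" using C le(2) by (intro mult_left_mono) auto
    also have "\<dots> < \<epsilon>" using C assms(5) by simp
    finally have "C * (\<Sum>e\<in>E. \<bar>c e - g e a\<bar>) < \<epsilon>" .
    then show ?thesis using \<Phi>[of a c] le(1) C(2) by (intro exI[of _ "\<Phi> c a"]) (auto intro: le_less_trans)
  qed
  then show ?thesis using \<delta> by blast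
qed

text \<open>The straight line in direction \<open>h\<close> is corrected back to the fibre by the
  chord method, started at each of its points. As \<open>h\<close> lies in the kernel, the residual
  on the line is \<open>o(s)\<close>, and so is the correction; hence the corrected path still has
  velocity \<open>h\<close> at 0.\<close>

theorem regular_fibre_path:
  fixes g :: "'e \<Rightarrow> ('k \<Rightarrow> real) \<Rightarrow> real"
  assumes K: "finite K" and E: "finite E" and g: "\<And>e. e \<in> E \<Longrightarrow> ratpoly K (g e)"
    and reg: "regular_at E g a" and h: "\<And>e. e \<in> E \<Longrightarrow> dir_deriv (g e) a h 0"
  obtains T and X :: "real \<Rightarrow> 'k \<Rightarrow> real" where "T > 0" "\<And>k. continuous_on {0..T} (\<lambda>s. X s k)" "X 0 = a"
    "\<And>s e. s \<in> {0..T} \<Longrightarrow> e \<in> E \<Longrightarrow> g e (X s) = g e a"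
    "\<And>k. ((\<lambda>s. (X s k - a k) / s) \<longlongrightarrow> h k) (at_right 0)"
proof -
  obtain C \<epsilon> and \<Phi> :: "('e \<Rightarrow> real) \<Rightarrow> ('k \<Rightarrow> real) \<Rightarrow> 'k \<Rightarrow> real" where C: "C > 0" "\<epsilon> > 0"
    and \<Phi>: "\<And>x c. (\<forall>k\<in>K. \<bar>x k - a k\<bar> \<le> \<epsilon>) \<and> (\<Sum>e\<in>E. \<bar>c e - g e x\<bar>) \<le> \<epsilon> \<Longrightarrow>
      (\<forall>e\<in>E. g e (\<Phi> c x) = c e) \<and> (\<forall>k. \<bar>\<Phi> c x k - x k\<bar> \<le> C * (\<Sum>e\<in>E. \<bar>c e - g e x\<bar>))"
    and cont: "\<And>(X :: real \<Rightarrow> 'k \<Rightarrow> real) T c. (\<forall>k. continuous_on T (\<lambda>s. X s k)) \<and>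
      (\<forall>s\<in>T. (\<forall>k\<in>K. \<bar>X s k - a k\<bar> \<le> \<epsilon>) \<and> (\<Sum>e\<in>E. \<bar>c e - g e (X s)\<bar>) \<le> \<epsilon>) \<Longrightarrow>
      \<forall>k. continuous_on T (\<lambda>s. \<Phi> c (X s) k)"
    using chord_method[OF K E g reg] by blast
  define Y where "Y = (\<lambda>s k. a k + s * h k)"
  define \<rho> where "\<rho> = (\<lambda>s. \<Sum>e\<in>E. \<bar>g e a - g e (Y s)\<bar>)"
  have Y0: "Y 0 = a" by (simp add: Y_def)
  have contY: "continuous_on S (\<lambda>s. Y s k)" for S k unfolding Y_def by (intro continuous_intros)
  have \<rho>0: "\<rho> 0 = 0" by (simp add: \<rho>_def Y0)
  have quot: "((\<lambda>s. \<rho> s / s) \<longlongrightarrow> 0) (at_right 0)"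
  proof -
    have "((\<lambda>s. (g e (Y s) - g e a) / s) \<longlongrightarrow> 0) (at_right 0)" if "e \<in> E" for e
      using h[OF that] unfolding dir_deriv_def DERIV_def Y_def
      by (intro tendsto_mono[OF at_le[of "{0<..}" UNIV]]) simp_all
    then have "((\<lambda>s. \<Sum>e\<in>E. \<bar>(g e (Y s) - g e a) / s\<bar>) \<longlongrightarrow> (\<Sum>e\<in>E. \<bar>0\<bar>)) (at_right 0)"
      by (intro tendsto_sum tendsto_rabs)
    then have "((\<lambda>s. \<Sum>e\<in>E. \<bar>(g e (Y s) - g e a) / s\<bar>) \<longlongrightarrow> 0) (at_right 0)" by simp
    moreover have "\<forall>\<^sub>F s in at_right 0. (\<Sum>e\<in>E. \<bar>(g e (Y s) - g e a) / s\<bar>) = \<rho> s / s"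
      unfolding eventually_at_right_field
      by (intro exI[of _ 1]) (auto simp: \<rho>_def sum_divide_distrib abs_divide abs_minus_commute)
    ultimately show ?thesis by (rule Lim_transform_eventually)
  qed
  have "\<forall>\<^sub>F s in at_right 0. (\<forall>k\<in>K. \<bar>Y s k - a k\<bar> \<le> \<epsilon>) \<and> \<rho> s \<le> \<epsilon>"
  proof (intro eventually_conj)
    have Y: "((\<lambda>s. Y s k) \<longlongrightarrow> Y 0 k) (at_right 0)" for k
      unfolding Y_def by (intro tendsto_intros)
    have "((\<lambda>s. g e (Y s)) \<longlongrightarrow> g e (Y 0)) (at_right 0)" if "e \<in> E" for e
      using g[OF that] Y by (rule ratpoly_tendsto)
    then have "(\<rho> \<longlongrightarrow> \<rho> 0) (at_right 0)" unfolding \<rho>_def by (intro tendsto_intros)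
    then have "\<forall>\<^sub>F s in at_right 0. \<rho> s < \<epsilon>" unfolding \<rho>0 using C(2) by (rule order_tendstoD)
    then show "\<forall>\<^sub>F s in at_right 0. \<rho> s \<le> \<epsilon>" by eventually_elim simp
    show "\<forall>\<^sub>F s in at_right 0. \<forall>k\<in>K. \<bar>Y s k - a k\<bar> \<le> \<epsilon>"
    proof (rule eventually_ball_finite[OF K], rule ballI)
      fix k
      have "((\<lambda>s. \<bar>Y s k - a k\<bar>) \<longlongrightarrow> 0) (at_right 0)" unfolding Y_def by (auto intro!: tendsto_eq_intros)
      then have "\<forall>\<^sub>F s in at_right 0. \<bar>Y s k - a k\<bar> < \<epsilon>" using C(2) by (rule order_tendstoD)
      then show "\<forall>\<^sub>F s in at_right 0. \<bar>Y s k - a k\<bar> \<le> \<epsilon>" by eventually_elim simp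
    qed
  qed
  then obtain b where b: "b > 0" "\<And>s. 0 < s \<Longrightarrow> s < b \<Longrightarrow> (\<forall>k\<in>K. \<bar>Y s k - a k\<bar> \<le> \<epsilon>) \<and> \<rho> s \<le> \<epsilon>"
    unfolding eventually_at_right_field by blast
  define T where "T = b / 2"
  have T: "T > 0" "T < b" using b(1) by (auto simp: T_def)
  have in_T: "(\<forall>k\<in>K. \<bar>Y s k - a k\<bar> \<le> \<epsilon>) \<and> \<rho> s \<le> \<epsilon>" if "s \<in> {0..T}" for s
    using b(2)[of s] that T C(2) by (cases "s = 0") (auto simp: Y0 \<rho>0)
  define X where "X = (\<lambda>s. \<Phi> (\<lambda>e. g e a) (Y s))"
  have X: "(\<forall>e\<in>E. g e (X s) = g e a) \<and> (\<forall>k. \<bar>X s k - Y s k\<bar> \<le> C * \<rho> s)" if "s \<in> {0..T}" for s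
    unfolding X_def \<rho>_def by (rule \<Phi>) (use in_T[OF that] in \<open>auto simp: \<rho>_def\<close>)
  show thesis
  proof (rule that[of T X])
    show "T > 0" by (rule T)
    show "continuous_on {0..T} (\<lambda>s. X s k)" for k
      unfolding X_def using in_T contY by (intro cont[rule_format]) (auto simp: \<rho>_def)
    show "X 0 = a" using X[of 0] T by (auto simp: \<rho>0 Y0)
    show "g e (X s) = g e a" if "s \<in> {0..T}" "e \<in> E" for s e using X that by blast
    fix k
    have "((\<lambda>s. (X s k - a k) / s - h k) \<longlongrightarrow> 0) (at_right 0)"
    proof (rule tendsto_rabs_zero_cancel, rule tendsto_sandwich[where f = "\<lambda>_. 0" and h = "\<lambda>s. C * (\<rho> s / s)"])
      show "\<forall>\<^sub>F s in at_right 0. \<bar>(X s k - a k) / s - h k\<bar> \<le> C * (\<rho> s / s)"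
        unfolding eventually_at_right_field
      proof (intro exI[of _ T] conjI allI impI)
        fix s assume s: "0 < s" "s < T"
        have "(X s k - a k) / s - h k = (X s k - Y s k) / s" using s by (simp add: Y_def field_simps)
        then have "\<bar>(X s k - a k) / s - h k\<bar> = \<bar>X s k - Y s k\<bar> / s" using s by (simp add: abs_divide)
        also have "\<dots> \<le> C * \<rho> s / s" using X[of s] s by (intro divide_right_mono) auto
        finally show "\<bar>(X s k - a k) / s - h k\<bar> \<le> C * (\<rho> s / s)" by simp
      qed (rule T)
      show "((\<lambda>s. C * (\<rho> s / s)) \<longlongrightarrow> 0) (at_right 0)" using tendsto_mult_right_zero[OF quot] .
    qed auto
    then show "((\<lambda>s. (X s k - a k) / s) \<longlongrightarrow> h k) (at_right 0)" by (simp add: LIM_zero_iff)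
  qed
qed

text \<open>The one case of the chain rule needed below: coefficients of a relation that depend only
  on functions stationary along \<open>h\<close> are stationary too.\<close>

lemma dir_deriv_compose_zero:
  assumes "ratpoly U p" "\<And>u. u \<in> U \<Longrightarrow> dir_deriv (G u) x h 0"
  shows "((\<lambda>s. p (\<lambda>u. G u (\<lambda>k. x k + s * h k))) has_real_derivative 0) (at 0)"
  using assms
proof induction
  case (ratpoly_var u) then show ?case by (simp add: dir_deriv_def)
qed (auto intro!: derivative_eq_intros)

text \<open>The Jacobian criterion. The polynomials \<open>F e\<close> are completed by coordinates to a
  transcendence basis; differentiating the relations for the remaining coordinates shows
  that the derivative of the completed system is injective.\<close>
theorem alg_indep_imp_regular:
  fixes K :: "'k set" and E :: "'e set"
  assumes K: "finite K" and E: "finite E" and F: "\<And>e. e \<in> E \<Longrightarrow> ratpoly K (F e)"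
    and x: "alg_indep_Q K x" and ind: "alg_indep_Q E (\<lambda>e. F e x)"
  shows "regular_at E F x"
proof -
  define G where "G = case_sum F (\<lambda>k z. z k)"
  define y where "y = (\<lambda>u. G u x)"
  define U where "U = (\<lambda>J. (Inl ` E \<union> Inr ` J :: ('e + 'k) set))"
  have G: "ratpoly K (G u)" if "u \<in> U K" for u
    using that F by (auto simp: U_def G_def intro: ratpoly_var)
  have "alg_indep_Q (U {}) y"
    using ind alg_indep_reindex[OF E, of Inl y] by (simp add: U_def y_def G_def)
  then have "\<exists>J. (J \<subseteq> K \<and> alg_indep_Q (U J) y) \<and> (\<forall>J'. J' \<subseteq> K \<and> alg_indep_Q (U J') y \<longrightarrow> card J' \<le> card J)"
    using K by (intro ex_has_greatest_nat[where b = "Suc (card K)" and k = "{}"]) (auto simp: less_Suc_eq_le intro: card_mono)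
  then obtain J where J: "J \<subseteq> K" "alg_indep_Q (U J) y"
    and max: "\<And>J'. J' \<subseteq> K \<Longrightarrow> alg_indep_Q (U J') y \<Longrightarrow> card J' \<le> card J" by blast
  have finJ: "finite J" using J(1) K by (rule finite_subset)
  have finU: "finite (U J)" using E finJ by (simp add: U_def)
  have sub: "U J \<subseteq> U K" using J(1) by (auto simp: U_def)
  \<comment> \<open>The completed system has at most as many functions as there are variables, so
    injectivity of its derivative will give surjectivity.\<close>
  have card: "card (U J) \<le> card K"
    using G sub J(2) by (intro alg_indep_card_le[OF K finU, of G x]) (auto simp: y_def)
  have inj: "\<forall>k\<in>K. h k = 0" if h: "\<And>u. u \<in> U J \<Longrightarrow> dir_deriv (G u) x h 0" for h
  proof
    fix k assume k: "k \<in> K"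
    show "h k = 0"
    proof (cases "k \<in> J")
      case True
      then have "dir_deriv (G (Inr k)) x h 0" by (intro h) (auto simp: U_def)
      moreover have "dir_deriv (G (Inr k)) x h (h k)"
        unfolding dir_deriv_def G_def by (auto intro!: derivative_eq_intros)
      ultimately show ?thesis using dir_deriv_unique by blast
    next
      case False
      have "\<not> alg_indep_Q (insert (Inr k) (U J)) y"
      proof
        assume "alg_indep_Q (insert (Inr k) (U J)) y"
        moreover have "insert (Inr k) (U J) = U (insert k J)" by (auto simp: U_def)
        ultimately have "card (insert k J) \<le> card J" using max[of "insert k J"] k J(1) by auto
        then show False using False finJ by simp
      qed
      then obtain n a where a: "\<And>l. ratpoly (U J) (a l)" "(\<Sum>l\<le>(n::nat). a l y * y (Inr k) ^ l) = 0"
        "(\<Sum>l\<le>n. a l y * (real l * y (Inr k) ^ (l - 1))) \<noteq> 0"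
        using dependent_separable_relation[OF finU _ J(2), of "Inr k"] False by (auto simp: U_def)
      let ?z = "\<lambda>s k. x k + s * h k"
      \<comment> \<open>The relation holds at the independent point \<open>x\<close>, hence
        identically, so it may be differentiated along the line. The coefficients contribute
        nothing, and separability leaves a nonzero multiple of \<open>h k\<close>.\<close>
      define R where "R = (\<lambda>z. \<Sum>l\<le>n. a l (\<lambda>u. G u z) * z k ^ l)"
      have "ratpoly K R"
        unfolding R_def using k sub
        by (intro ratpoly_sum ratpoly_mult ratpoly_power ratpoly_var ratpoly_subst[OF a(1)]) (auto intro: G)
      moreover have "R x = 0" using a(2) by (simp add: R_def y_def G_def)
      ultimately have "R z = 0" for z using alg_indep_vanish[OF K x] by blast
      then have "((\<lambda>s. R (?z s)) has_real_derivative 0) (at 0)" by simp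
      moreover have "((\<lambda>s. R (?z s)) has_real_derivative
          (\<Sum>l\<le>n. a l y * (real l * y (Inr k) ^ (l - 1) * h k))) (at 0)"
      proof -
        have "((\<lambda>s. a l (\<lambda>u. G u (?z s))) has_real_derivative 0) (at 0)" for l
          using a(1) h by (rule dir_deriv_compose_zero)
        then show ?thesis unfolding R_def
          by (auto intro!: derivative_eq_intros sum.cong simp: y_def G_def)
      qed
      ultimately have "(\<Sum>l\<le>n. a l y * (real l * y (Inr k) ^ (l - 1) * h k)) = 0"
        using DERIV_unique by blast
      then have "(\<Sum>l\<le>n. a l y * (real l * y (Inr k) ^ (l - 1))) * h k = 0"
        by (simp add: sum_distrib_right mult.assoc)
      then show ?thesis using a(3) by simp
    qed
  qed
  have "\<forall>u\<in>U J. \<exists>A. \<forall>h. dir_deriv (G u) x h (\<Sum>k\<in>K. A k * h k)"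
    using ratpoly_gradient[OF K G] sub by blast
  then obtain A where A: "\<And>u h. u \<in> U J \<Longrightarrow> dir_deriv (G u) x h (\<Sum>k\<in>K. A u k * h k)"
    unfolding bchoice_iff by blast
  show ?thesis unfolding regular_at_def
  proof
    fix r
    have "\<exists>h. \<forall>u\<in>U J. (\<Sum>k\<in>K. A u k * h k) = case_sum r (\<lambda>_. 0) u"
    proof (rule injective_square_solvable[OF finU K card])
      fix h assume "\<And>u. u \<in> U J \<Longrightarrow> (\<Sum>k\<in>K. A u k * h k) = 0"
      then show "\<forall>k\<in>K. h k = 0" using A[of _ h] by (intro inj) auto
    qed
    then obtain h where h: "\<And>u. u \<in> U J \<Longrightarrow> (\<Sum>k\<in>K. A u k * h k) = case_sum r (\<lambda>_. 0) u" by blast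
    have "dir_deriv (F e) x h (r e)" if "e \<in> E" for e
      using A[of "Inl e" h] h[of "Inl e"] that by (auto simp: U_def G_def)
    then show "\<exists>h. \<forall>e\<in>E. dir_deriv (F e) x h (r e)" by blast
  qed
qed

section \<open>Edge lengths of minimally rigid graphs\<close>

definition coords :: "('v \<Rightarrow> real^'d) \<Rightarrow> 'v \<times> 'd \<Rightarrow> real" where
  "coords p = (\<lambda>(v, i). p v $ i)"

definition sqlen :: "'v \<Rightarrow> 'v \<Rightarrow> ('v \<times> 'd::finite \<Rightarrow> real) \<Rightarrow> real" where
  "sqlen u v x = (\<Sum>i\<in>UNIV. (x (u, i) - x (v, i))\<^sup>2)"

text \<open>An arbitrary orientation of the unordered edges, so that squared lengths form a family
  of polynomials indexed by \<open>E\<close>.\<close>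

definition edge_ends :: "'v set \<Rightarrow> 'v set set \<Rightarrow> ('v set \<Rightarrow> 'v) \<Rightarrow> ('v set \<Rightarrow> 'v) \<Rightarrow> bool" where
  "edge_ends V E s t \<longleftrightarrow> (\<forall>e\<in>E. e = {s e, t e} \<and> s e \<noteq> t e \<and> s e \<in> V \<and> t e \<in> V)"

lemma coords_simp [simp]: "coords p (v, i) = p v $ i"
  by (simp add: coords_def)

lemma generic_iff: "generic V p \<longleftrightarrow> alg_indep_Q (V \<times> UNIV) (coords p)"
  by (simp add: generic_def coords_def)

lemma sqlen_coords: "sqlen u v (coords p) = (norm (p u - p v))\<^sup>2"
  by (simp add: sqlen_def norm_vec_def L2_set_def sum_nonneg)

lemma sqlen_commute: "sqlen u v x = sqlen v u x"
  unfolding sqlen_def by (intro sum.cong) (auto simp: power2_commute)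

lemma ratpoly_sqlen:
  assumes "\<And>i. (u, i) \<in> I" "\<And>i. (v, i) \<in> I" shows "ratpoly I (sqlen u v)"
  unfolding sqlen_def using assms by (intro ratpoly_sum ratpoly_power ratpoly_diff ratpoly_var)

lemma dir_deriv_sqlen:
  "dir_deriv (sqlen u v) a h (\<Sum>i\<in>UNIV. 2 * ((a (u, i) - a (v, i)) * (h (u, i) - h (v, i))))"
  unfolding dir_deriv_def sqlen_def
  by (auto intro!: derivative_eq_intros sum.cong simp: algebra_simps)

text \<open>Edges at \<open>x\<close> are oriented towards \<open>x\<close>; the first end
  \<open>s e\<close> is then the neighbour, from which the part \<open>N1\<close>, \<open>N2\<close>
  or \<open>W\<close> is read off.\<close>

lemma simple_graph_edge_ends:
  assumes "simple_graph V E"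
  obtains s t where "edge_ends V E s t" "\<And>e. e \<in> E \<Longrightarrow> x \<in> e \<Longrightarrow> t e = x"
proof -
  have "\<forall>e\<in>E. \<exists>p. e = {fst p, snd p} \<and> fst p \<noteq> snd p \<and> fst p \<in> V \<and> snd p \<in> V \<and> (x \<in> e \<longrightarrow> snd p = x)"
  proof
    fix e assume "e \<in> E"
    then obtain u v where uv: "e = {u, v}" "u \<noteq> v" "u \<in> V" "v \<in> V"
      using assms unfolding simple_graph_def by blast
    show "\<exists>p. e = {fst p, snd p} \<and> fst p \<noteq> snd p \<and> fst p \<in> V \<and> snd p \<in> V \<and> (x \<in> e \<longrightarrow> snd p = x)"
    proof (cases "x = u")
      case True then show ?thesis using uv by (intro exI[of _ "(v, u)"]) auto
    next
      case False then show ?thesis using uv by (intro exI[of _ "(u, v)"]) auto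
    qed
  qed
  then obtain f where f: "\<forall>e\<in>E. e = {fst (f e), snd (f e)} \<and> fst (f e) \<noteq> snd (f e) \<and> fst (f e) \<in> V \<and>
      snd (f e) \<in> V \<and> (x \<in> e \<longrightarrow> snd (f e) = x)"
    unfolding bchoice_iff by blast
  show thesis
  proof (rule that[of "\<lambda>e. fst (f e)" "\<lambda>e. snd (f e)"])
    show "edge_ends V E (\<lambda>e. fst (f e)) (\<lambda>e. snd (f e))" unfolding edge_ends_def using f by blast
  qed (use f in blast)
qed

lemma simple_graph_finite:
  assumes "simple_graph V E" shows "finite V" "finite E"
proof -
  show V: "finite V" using assms by (simp add: simple_graph_def)
  have "E \<subseteq> Pow V"
  proof
    fix e assume "e \<in> E"
    then obtain u v where "e = {u, v}" "u \<in> V" "v \<in> V" using assms unfolding simple_graph_def by blast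
    then show "e \<in> Pow V" by simp
  qed
  then show "finite E" using V by (simp add: finite_subset)
qed

lemma edge_endsD:
  assumes "edge_ends V E s t" "e \<in> E"
  shows "e = {s e, t e}" "s e \<noteq> t e" "s e \<in> V" "t e \<in> V"
proof -
  note ends = bspec[OF assms(1)[unfolded edge_ends_def] assms(2)]
  show "e = {s e, t e}" by (rule conjunct1[OF ends])
  show "s e \<noteq> t e" "s e \<in> V" "t e \<in> V" using conjunct2[OF ends] by blast+
qed

lemma equivalent_iff_sqlen:
  assumes ends: "edge_ends V E s t"
  shows "equivalent E p q \<longleftrightarrow> (\<forall>e\<in>E. sqlen (s e) (t e) (coords p) = sqlen (s e) (t e) (coords q))"
proof
  assume eq: "equivalent E p q"
  have "{s e, t e} \<in> E" if "e \<in> E" for e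
    using back_subst[of "\<lambda>X. X \<in> E", OF that edge_endsD(1)[OF ends that]] .
  then have "norm (p (s e) - p (t e)) = norm (q (s e) - q (t e))" if "e \<in> E" for e
    using eq that unfolding equivalent_def by blast
  then show "\<forall>e\<in>E. sqlen (s e) (t e) (coords p) = sqlen (s e) (t e) (coords q)"
    unfolding sqlen_coords by simp
next
  assume eq: "\<forall>e\<in>E. sqlen (s e) (t e) (coords p) = sqlen (s e) (t e) (coords q)"
  show "equivalent E p q" unfolding equivalent_def
  proof (intro allI impI)
    fix u v assume uv: "{u, v} \<in> E"
    define e where "e = {u, v}"
    have e: "e \<in> E" using uv by (simp only: e_def)
    then have "e = {s e, t e}" by (rule edge_endsD(1)[OF ends])
    then have "{u, v} = {s e, t e}" by (simp only: e_def)
    then have "(u = s e \<and> v = t e) \<or> (u = t e \<and> v = s e)" by (simp only: doubleton_eq_iff)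
    moreover have "sqlen (s e) (t e) (coords p) = sqlen (s e) (t e) (coords q)" using eq e by (rule bspec)
    then have "sqlen (t e) (s e) (coords p) = sqlen (t e) (s e) (coords q)"
      by (simp only: sqlen_commute[of "t e" "s e"])
    ultimately have "sqlen u v (coords p) = sqlen u v (coords q)"
      using \<open>sqlen (s e) (t e) (coords p) = sqlen (s e) (t e) (coords q)\<close> by blast
    then have "(norm (p u - p v))\<^sup>2 = (norm (q u - q v))\<^sup>2" by (simp only: sqlen_coords)
    then show "norm (p u - p v) = norm (q u - q v)" by (rule power2_eq_imp_eq) simp_all
  qed
qed

lemma equivalent_isometry:
  assumes "isometry T" shows "equivalent E p (\<lambda>v. T (q v)) \<longleftrightarrow> equivalent E p q"
  using assms by (simp add: equivalent_def isometry_def)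

lemma congruent_dist:
  assumes "congruent V p q" "u \<in> V" "v \<in> V" shows "norm (q u - q v) = norm (p u - p v)"
  using assms by (auto simp: congruent_def isometry_def)

lemma maximal_alg_indep_subset:
  assumes "finite E"
  obtains F where "F \<subseteq> E" "alg_indep_Q F y" "\<And>e. e \<in> E - F \<Longrightarrow> \<not> alg_indep_Q (insert e F) y"
proof -
  let ?P = "\<lambda>F. F \<subseteq> E \<and> alg_indep_Q F y"
  have "\<exists>F. ?P F \<and> (\<forall>F'. ?P F' \<longrightarrow> card F' \<le> card F)"
    using assms by (intro ex_has_greatest_nat[where b = "Suc (card E)" and k = "{}"])
      (auto simp: less_Suc_eq_le alg_indep_empty intro: card_mono)
  then obtain F where F: "?P F" "\<And>F'. ?P F' \<Longrightarrow> card F' \<le> card F" by blast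
  have "\<not> alg_indep_Q (insert e F) y" if "e \<in> E - F" for e
  proof
    assume "alg_indep_Q (insert e F) y"
    then have "card (insert e F) \<le> card F" using F that by blast
    moreover have "finite F" using F(1) assms by (blast intro: finite_subset)
    ultimately show False using that by simp
  qed
  then show thesis using that F(1) by blast
qed

text \<open>If the edge lengths were dependent, then along a motion that preserves a maximal
  independent set of lengths every other length would be a root of a fixed polynomial,
  hence constant; so some edge would be redundant.\<close>
lemma minimal_lengths_independent:
  fixes p0 :: "'v \<Rightarrow> real^'d::finite"
  assumes G: "simple_graph V E" and ends: "edge_ends V E s t"
    and gen: "generic V p0" and rig: "rigid_framework V E p0"
    and minimal: "\<And>e. e \<in> E \<Longrightarrow> \<not> rigid_framework V (E - {e}) p0"
  shows "alg_indep_Q E (\<lambda>e. sqlen (s e) (t e) (coords p0))"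
proof -
  let ?f = "\<lambda>e. sqlen (s e) (t e) :: ('v \<times> 'd \<Rightarrow> real) \<Rightarrow> real"
  let ?y = "\<lambda>e. ?f e (coords p0)"
  have fin: "finite V" "finite E" "finite (V \<times> (UNIV :: 'd set))" using simple_graph_finite[OF G] by auto
  have end_in: "s e \<in> V" "t e \<in> V" if "e \<in> E" for e using edge_endsD(3,4)[OF ends that] by blast+
  have f: "ratpoly (V \<times> UNIV) (?f e)" if "e \<in> E" for e using end_in[OF that] by (intro ratpoly_sqlen) auto
  obtain F where F: "F \<subseteq> E" "alg_indep_Q F ?y" "\<And>e. e \<in> E - F \<Longrightarrow> \<not> alg_indep_Q (insert e F) ?y"
    using maximal_alg_indep_subset[OF fin(2)] by blast
  have finF: "finite F" using F(1) fin(2) finite_subset by blast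
  show ?thesis
  proof (cases "F = E")
    case True then show ?thesis using F(2) by simp
  next
    case False
    then obtain e where e: "e \<in> E" "e \<notin> F" using F(1) by blast
    have "rigid_framework V (E - {e}) p0" unfolding rigid_framework_def
    proof (intro allI impI)
      fix P :: "real \<Rightarrow> 'v \<Rightarrow> real^'d"
      assume P: "(\<forall>v\<in>V. continuous_on {0..1} (\<lambda>t. P t v)) \<and> (\<forall>v\<in>V. P 0 v = p0 v) \<and>
        (\<forall>t\<in>{0..1}. equivalent (E - {e}) p0 (P t))"
      have ends': "edge_ends V (E - {e}) s t" using ends by (simp add: edge_ends_def)
      have F_const: "?f e' (coords (P r)) = ?y e'" if "r \<in> {0..1}" "e' \<in> F" for r e'
      proof -
        have "equivalent (E - {e}) p0 (P r)" using P that(1) by blast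
        moreover have "e' \<in> E - {e}" using that(2) e F(1) by blast
        ultimately show ?thesis unfolding equivalent_iff_sqlen[OF ends'] by simp
      qed
      have const: "?f e' (coords (P r)) = ?y e'" if e': "e' \<in> E" and r: "r \<in> {0..1}" for e' r
      proof (cases "e' \<in> F")
        case True then show ?thesis using F_const r by blast
      next
        case False
        then obtain n a where a: "\<And>l. ratpoly F (a l)" "(\<Sum>l\<le>(n::nat). a l ?y * ?y e' ^ l) = 0" "\<exists>l\<le>n. a l ?y \<noteq> 0"
          using dependent_relation[OF finF False F(2)] F(3) e' by blast
        \<comment> \<open>A relation between the lengths of the generic \<open>p0\<close> is a
          polynomial identity in the coordinates, so it continues to hold along \<open>P\<close>.
          With the lengths in \<open>F\<close> constant, the length of \<open>e'\<close> is confined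
          to the roots of one fixed polynomial.\<close>
        define R where "R = (\<lambda>z. \<Sum>l\<le>n. a l (\<lambda>e. ?f e z) * ?f e' z ^ l)"
        have "ratpoly (V \<times> UNIV) R" unfolding R_def
          by (intro ratpoly_sum ratpoly_mult ratpoly_power f[OF e'] ratpoly_subst[OF a(1)]) (use f F(1) in blast)
        moreover have "R (coords p0) = 0" using a(2) by (simp add: R_def)
        ultimately have R: "R z = 0" for z
          using alg_indep_vanish[OF fin(3)] gen unfolding generic_iff by blast
        let ?g = "\<lambda>r. ?f e' (coords (P r))"
        have "?g r \<in> {z. (\<Sum>l\<le>n. a l ?y * z ^ l) = 0}" if "r \<in> {0..1}" for r
        proof -
          have "a l (\<lambda>e. ?f e (coords (P r))) = a l ?y" for l
            using a(1) F_const[OF that] by (rule ratpoly_cong)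
          then show ?thesis using R[of "coords (P r)"] by (simp add: R_def)
        qed
        moreover have "finite {z. (\<Sum>l\<le>n. a l ?y * z ^ l) = 0}"
        proof -
          obtain l where "l \<le> n" "a l ?y \<noteq> 0" using a(3) by blast
          then show ?thesis using polyfun_roots_finite[of "\<lambda>l. a l ?y" l n] by blast
        qed
        ultimately have finite_range: "finite (?g ` {0..1})" by (meson finite_subset image_subsetI)
        have "continuous_on {0..1} ?g"
          unfolding sqlen_coords using P end_in[OF e'] by (intro continuous_intros) auto
        then have "?g constant_on {0..1}"
          using finite_range by (intro continuous_finite_range_constant) auto
        then have "?g r = ?g 0" using r unfolding constant_on_def by auto
        also have "\<dots> = ?y e'" using P end_in[OF e'] by (simp add: sqlen_coords)
        finally show ?thesis .
      qed
      then have "equivalent E p0 (P r)" if "r \<in> {0..1}" for r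
        using that unfolding equivalent_iff_sqlen[OF ends] by simp
      then show "\<forall>t\<in>{0..1}. congruent V p0 (P t)" using rig P unfolding rigid_framework_def by blast
    qed
    then show ?thesis using minimal e(1) by blast
  qed
qed

text \<open>Independence of the lengths belongs to the graph: a relation at the generic
  \<open>p\<close> is an identity in the coordinates and therefore holds at \<open>p0\<close> as
  well.\<close>

lemma generic_lengths_independent:
  fixes p0 p :: "'v \<Rightarrow> real^'d::finite"
  assumes fin: "finite V" "finite E" and ends: "edge_ends V E s t" and gen: "generic V p"
    and ind: "alg_indep_Q E (\<lambda>e. sqlen (s e) (t e) (coords p0))"
  shows "alg_indep_Q E (\<lambda>e. sqlen (s e) (t e) (coords p))"
  unfolding alg_indep_iff[OF fin(2)]
proof (intro allI impI)
  fix F z assume F: "ratpoly E F \<and> F (\<lambda>e. sqlen (s e) (t e) (coords p)) = 0"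
  have "ratpoly (V \<times> UNIV) (\<lambda>x. F (\<lambda>e. sqlen (s e) (t e) x))"
    by (rule ratpoly_subst[of E F]) (use F edge_endsD(3,4)[OF ends] in \<open>auto intro!: ratpoly_sqlen\<close>)
  then have "F (\<lambda>e. sqlen (s e) (t e) (coords p0)) = 0"
    using alg_indep_vanish[of "V \<times> UNIV" "coords p"] gen F fin(1) unfolding generic_iff by auto
  then show "F z = 0" using alg_indep_vanish[OF fin(2) ind] F by blast
qed

text \<open>Congruences are factored out by pinning along a flag: vertex \<open>fl j\<close> has to lie in the span of
  the first \<open>j\<close> coordinate axes, in the order given by \<open>\<iota>\<close>.\<close>

definition pinned :: "(nat \<Rightarrow> 'v) \<Rightarrow> ('d \<Rightarrow> nat) \<Rightarrow> ('v \<Rightarrow> real^'d) \<Rightarrow> bool" where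
  "pinned fl \<iota> q \<longleftrightarrow> (\<forall>j<CARD('d). \<forall>i. j \<le> \<iota> i \<longrightarrow> q (fl j) $ i = 0)"

definition free_coords :: "'v set \<Rightarrow> (nat \<Rightarrow> 'v) \<Rightarrow> ('d \<Rightarrow> nat) \<Rightarrow> ('v \<times> 'd) set" where
  "free_coords V fl \<iota> = V \<times> UNIV - {(fl j, i) | j i. j < CARD('d) \<and> j \<le> \<iota> i}"

text \<open>The rows of the orthogonal matrix are chosen from the last axis downwards. The row with
  index \<open>n\<close> has to be orthogonal to the later rows and to \<open>a 1, ..., a n\<close>,
  fewer than \<open>CARD('d)\<close> vectors, so a dimension count suffices even for a degenerate
  flag.\<close>

lemma exists_pinning_isometry:
  fixes q :: "'v \<Rightarrow> real^'d::finite"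
  assumes \<iota>: "bij_betw \<iota> (UNIV :: 'd set) {..<CARD('d)}"
  shows "\<exists>T. isometry T \<and> pinned fl \<iota> (\<lambda>v. T (q v))"
proof -
  define a where "a = (\<lambda>j. q (fl j) - q (fl 0))"
  have "\<exists>b :: 'd \<Rightarrow> real^'d. (\<forall>i. n \<le> \<iota> i \<longrightarrow> norm (b i) = 1 \<and> (\<forall>j\<le>\<iota> i. j < CARD('d) \<longrightarrow> b i \<bullet> a j = 0) \<and>
      (\<forall>i'. n \<le> \<iota> i' \<and> i \<noteq> i' \<longrightarrow> b i \<bullet> b i' = 0))" if "n \<le> CARD('d)" for n
    using that
  proof (induction n rule: inc_induct)
    case base
    have "\<iota> i < CARD('d)" for i using \<iota> by (auto dest: bij_betwE)
    then show ?case by (metis linorder_not_le)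
  next
    case (step n)
    then obtain b :: "'d \<Rightarrow> real^'d" where b: "\<And>i. Suc n \<le> \<iota> i \<Longrightarrow> norm (b i) = 1 \<and>
      (\<forall>j\<le>\<iota> i. j < CARD('d) \<longrightarrow> b i \<bullet> a j = 0) \<and> (\<forall>i'. Suc n \<le> \<iota> i' \<and> i \<noteq> i' \<longrightarrow> b i \<bullet> b i' = 0)" by blast
    obtain i0 where i0: "\<iota> i0 = n" using \<iota> step(2) unfolding bij_betw_def by (metis imageE lessThan_iff)
    have inj: "inj \<iota>" using \<iota> by (simp add: bij_betw_def)
    \<comment> \<open>At most \<open>(CARD('d) - Suc n) + n\<close> vectors; \<open>a 0\<close> is
      zero and therefore left out, which makes the count strict.\<close>
    let ?S = "b ` {i. Suc n \<le> \<iota> i} \<union> a ` {1..n}"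
    have "card {i. Suc n \<le> \<iota> i} = card {Suc n..<CARD('d)}"
    proof (rule bij_betw_same_card[of \<iota>], rule bij_betw_imageI)
      show "inj_on \<iota> {i. Suc n \<le> \<iota> i}" using inj by (rule inj_on_subset) simp
      show "\<iota> ` {i. Suc n \<le> \<iota> i} = {Suc n..<CARD('d)}"
        using \<iota> unfolding bij_betw_def by (auto simp: set_eq_iff image_iff) metis+
    qed
    then have "card ?S \<le> (CARD('d) - Suc n) + n"
      by (intro order_trans[OF card_Un_le] add_mono order_trans[OF card_image_le]) auto
    then have "card ?S < CARD('d)" using step(2) by simp
    then have "dim (span ?S) < DIM(real^'d)"
      using dim_le_card[of ?S ?S] by (simp add: span_superset)
    then obtain z where z: "z \<noteq> 0" "\<And>y. y \<in> span ?S \<Longrightarrow> orthogonal z y"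
      using orthogonal_to_subspace_exists[of "span ?S"] by (metis dim_span span_span)
    have zS: "z \<bullet> y = 0" if "y \<in> ?S" for y using z(2)[OF span_base[OF that]] by (simp add: orthogonal_def)
    define c where "c = b(i0 := z /\<^sub>R norm z)"
    have c_other: "c i = b i" "Suc n \<le> \<iota> i" if "n \<le> \<iota> i" "i \<noteq> i0" for i
    proof -
      show "c i = b i" using that by (simp add: c_def)
      have "\<iota> i \<noteq> n" using that(2) i0 inj by (auto dest: injD)
      then show "Suc n \<le> \<iota> i" using that(1) by simp
    qed
    have c0: "c i0 = z /\<^sub>R norm z" by (simp add: c_def)
    have a0: "a 0 = 0" by (simp add: a_def)
    have "norm (c i) = 1 \<and> (\<forall>j\<le>\<iota> i. j < CARD('d) \<longrightarrow> c i \<bullet> a j = 0) \<and>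
      (\<forall>i'. n \<le> \<iota> i' \<and> i \<noteq> i' \<longrightarrow> c i \<bullet> c i' = 0)" if i: "n \<le> \<iota> i" for i
    proof (cases "i = i0")
      case True
      have "z \<bullet> a j = 0" if "j \<le> n" for j using that zS[of "a j"] a0 by (cases "j = 0") auto
      moreover have "z \<bullet> c i' = 0" if "n \<le> \<iota> i'" "i' \<noteq> i0" for i'
        using c_other[OF that] zS[of "b i'"] by auto
      ultimately show ?thesis using True z(1) i0 by (auto simp: c0)
    next
      case False
      note ci = c_other[OF i False]
      have "c i \<bullet> c i' = 0" if "n \<le> \<iota> i'" "i \<noteq> i'" for i'
      proof (cases "i' = i0")
        case True
        have "z \<bullet> b i = 0" using zS[of "b i"] ci(2) by auto
        then show ?thesis using True ci(1) by (simp add: c0 inner_commute)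
      next
        case False
        then show ?thesis using c_other[OF that(1) False] ci b that(2) by simp
      qed
      then show ?thesis using b[OF ci(2)] ci(1) by simp
    qed
    then show ?case by blast
  qed
  from this[of 0] obtain b :: "'d \<Rightarrow> real^'d" where b: "\<And>i. norm (b i) = 1"
    "\<And>i j. j \<le> \<iota> i \<Longrightarrow> j < CARD('d) \<Longrightarrow> b i \<bullet> a j = 0" "\<And>i i'. i \<noteq> i' \<Longrightarrow> b i \<bullet> b i' = 0" by auto
  define B :: "real^'d^'d" where "B = (\<chi> i. b i)"
  have row: "row i B = b i" for i by (simp add: row_def B_def)
  have "orthogonal_matrix B" unfolding orthogonal_matrix_orthonormal_rows row using b by (simp add: orthogonal_def)
  then have "orthogonal_transformation ((*v) B)" by (simp add: orthogonal_transformation_matrix)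
  then have norm: "norm (B *v y) = norm y" for y by (rule orthogonal_transformation_norm)
  define T where "T = (\<lambda>y. B *v (y - q (fl 0)))"
  have "isometry T"
    unfolding isometry_def T_def
    by (simp add: norm matrix_vector_mult_diff_distrib[symmetric])
  moreover have "pinned fl \<iota> (\<lambda>v. T (q v))"
    unfolding pinned_def T_def using b(2) by (simp add: matrix_vector_mul_component B_def a_def)
  ultimately show ?thesis by blast
qed

text \<open>The \<open>j\<close> orthogonality conditions, completed by unit rows for the remaining
  coordinates, form a square matrix whose determinant is a polynomial in the coordinates of the
  framework. It is nonzero at one placement, hence at every generic one.\<close>

lemma generic_flag_kernel:
  fixes p :: "'v \<Rightarrow> real^'d::finite" and u :: "'d \<Rightarrow> real" and \<iota> :: "'d \<Rightarrow> nat"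
  assumes V: "finite V" and gen: "generic V p" and \<iota>: "inj \<iota>"
    and v: "v \<in> V" and fl: "\<And>l. l < j \<Longrightarrow> fl l \<in> V" "\<And>l. l < j \<Longrightarrow> fl l \<noteq> v" "inj_on fl {..<j}"
    and zero: "\<And>i. j \<le> \<iota> i \<Longrightarrow> u i = 0"
    and orth: "\<And>l. l < j \<Longrightarrow> (\<Sum>i\<in>UNIV. (p v $ i - p (fl l) $ i) * u i) = 0"
  shows "u i = 0"
proof -
  define M :: "('v \<times> 'd \<Rightarrow> real) \<Rightarrow> real^'d^'d" where
    "M = (\<lambda>x. \<chi> r c. if \<iota> r < j then x (v, c) - x (fl (\<iota> r), c) else if c = r then 1 else 0)"
  have "ratpoly (V \<times> UNIV) (\<lambda>x. M x $ r $ c)" for r c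
    unfolding M_def vec_lambda_beta using v fl(1)
    by (intro ratpoly_if ratpoly_diff ratpoly_var) auto
  then have rp: "ratpoly (V \<times> UNIV) (\<lambda>x. det (M x))"
    unfolding det_def using ratpoly_const[of _ "of_int _"]
    by (intro ratpoly_sum ratpoly_mult ratpoly_prod) simp_all
  \<comment> \<open>The vertex \<open>v\<close> sits at the origin and each \<open>fl l\<close> at
    the negative of the unit vector with index \<open>l\<close>; this turns \<open>M\<close> into
    the identity.\<close>
  define z where "z = (\<lambda>(w, c). if w \<noteq> v \<and> (\<exists>l<j. w = fl l \<and> \<iota> c = l) then -1 else 0 :: real)"
  note z = z_def
  have "det (M z) = 1"
  proof -
    have "z (v, c) = 0" for c by (simp add: z)
    moreover have "z (fl (\<iota> r), c) = (if c = r then -1 else 0)" if "\<iota> r < j" for r c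
      using that fl(2,3) \<iota> by (auto simp: z inj_on_def inj_def)
    ultimately have "M z = mat 1" by (auto simp: M_def mat_def vec_eq_iff)
    then show ?thesis by simp
  qed
  moreover have "finite (V \<times> (UNIV :: 'd set))" using V by simp
  ultimately have "det (M (coords p)) \<noteq> 0"
    using alg_indep_vanish[OF _ gen[unfolded generic_iff] rp, of z] by auto
  then have inj: "inj ((*v) (M (coords p)))" by (rule inj_matrix_vector_mult[OF iffD2[OF invertible_det_nz]])
  have "M (coords p) *v (\<chi> i. u i) = 0"
  proof (rule iffD2[OF vec_eq_iff], rule allI)
    fix r
    have "(M (coords p) *v (\<chi> i. u i)) $ r = (\<Sum>c\<in>UNIV. M (coords p) $ r $ c * u c)"
      by (simp add: matrix_vector_mult_def)
    also have "\<dots> = 0"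
    proof (cases "\<iota> r < j")
      case True
      then show ?thesis using orth[OF True] by (simp add: M_def)
    next
      case False
      have "(\<Sum>c\<in>UNIV. M (coords p) $ r $ c * u c) = (\<Sum>c\<in>UNIV. if c = r then u c else 0)"
        using False by (intro sum.cong) (auto simp: M_def)
      moreover have "u r = 0" by (rule zero) (use False in simp)
      ultimately show ?thesis by simp
    qed
    finally show "(M (coords p) *v (\<chi> i. u i)) $ r = 0 $ r" by simp
  qed
  then have "M (coords p) *v (\<chi> i. u i) = M (coords p) *v 0" by simp
  then have "(\<chi> i. u i) = (0 :: real^'d)" by (rule injD[OF inj])
  then have "(\<chi> i. u i) $ i = (0 :: real^'d) $ i" by (rule arg_cong)
  then show ?thesis by simp
qed

text \<open>Otherwise the lengths, which are regular at \<open>p0\<close>, would leave room for a flex whose velocity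
  satisfies the pinning conditions; as all distances are preserved, the velocity vanishes.\<close>
lemma rigid_edge_count:
  fixes p0 :: "'v \<Rightarrow> real^'d::finite"
  assumes G: "simple_graph V E" and ends: "edge_ends V E s t"
    and gen: "generic V p0" and rig: "rigid_framework V E p0"
    and ind: "alg_indep_Q E (\<lambda>e. sqlen (s e) (t e) (coords p0))"
    and \<iota>: "bij_betw \<iota> (UNIV :: 'd set) {..<CARD('d)}"
    and fl: "inj_on fl {..<CARD('d)}" "fl ` {..<CARD('d)} \<subseteq> V"
  shows "card (free_coords V fl \<iota>) \<le> card E"
proof (rule ccontr)
  let ?K = "free_coords V fl \<iota>" and ?I = "V \<times> (UNIV :: 'd set)"
  let ?f = "\<lambda>e. sqlen (s e) (t e) :: ('v \<times> 'd \<Rightarrow> real) \<Rightarrow> real"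
  let ?a = "coords p0"
  assume "\<not> card ?K \<le> card E"
  then have less: "card E < card ?K" by simp
  have fin: "finite V" "finite E" "finite ?I" using simple_graph_finite[OF G] by auto
  have KI: "?K \<subseteq> ?I" by (auto simp: free_coords_def)
  have finK: "finite ?K" using KI fin(3) by (rule finite_subset)
  have end_in: "s e \<in> V" "t e \<in> V" if "e \<in> E" for e using edge_endsD(3,4)[OF ends that] by blast+
  have f: "ratpoly ?I (?f e)" if "e \<in> E" for e using end_in[OF that] by (intro ratpoly_sqlen) auto
  have reg: "regular_at E ?f ?a"
    using gen ind f unfolding generic_iff by (intro alg_indep_imp_regular[OF fin(3,2)])
  have "\<forall>e\<in>E. \<exists>A. \<forall>h. dir_deriv (?f e) ?a h (\<Sum>k\<in>?I. A k * h k)"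
    using ratpoly_gradient[OF fin(3) f] by blast
  then obtain A where A: "\<And>e h. e \<in> E \<Longrightarrow> dir_deriv (?f e) ?a h (\<Sum>k\<in>?I. A e k * h k)"
    unfolding bchoice_iff by blast
  \<comment> \<open>With more free coordinates than lengths, some nonzero velocity on the free
    coordinates preserves all lengths to first order; regularity will turn it into a genuine
    motion.\<close>
  obtain h0 where h0: "\<exists>k\<in>?K. h0 k \<noteq> 0" "\<forall>e\<in>E. (\<Sum>k\<in>?K. A e k * h0 k) = 0"
    using homogeneous_solution[OF fin(2) finK less] by blast
  define h where "h = (\<lambda>k. if k \<in> ?K then h0 k else 0)"
  have "dir_deriv (?f e) ?a h 0" if "e \<in> E" for e
  proof -
    have "(\<Sum>k\<in>?I. A e k * h k) = (\<Sum>k\<in>?K. A e k * h0 k)"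
      using fin(3) KI by (intro sum.mono_neutral_cong_right) (auto simp: h_def)
    then show ?thesis using A[OF that, of h] h0(2) that by simp
  qed
  then obtain \<tau> X where X: "\<tau> > 0" "\<And>k. continuous_on {0..\<tau>} (\<lambda>s. X s k)" "X 0 = ?a"
    "\<And>s e. s \<in> {0..\<tau>} \<Longrightarrow> e \<in> E \<Longrightarrow> ?f e (X s) = ?f e ?a"
    "\<And>k. ((\<lambda>s. (X s k - ?a k) / s) \<longlongrightarrow> h k) (at_right 0)"
    using regular_fibre_path[OF fin(3,2) f reg, of h] by blast
  define P where "P = (\<lambda>r v. \<chi> i. X (\<tau> * r) (v, i))"
  have coordsP: "coords (P r) = X (\<tau> * r)" for r by (auto simp: P_def coords_def)
  have "\<forall>r\<in>{0..1}. congruent V p0 (P r)"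
  proof -
    have "continuous_on {0..1} (\<lambda>r. P r v)" for v
      unfolding P_def using X(1)
      by (intro continuous_on_vec_lambda continuous_on_compose2[OF X(2), of "{0..1}" "\<lambda>r. \<tau> * r"] continuous_intros)
        (auto simp: mult_left_le)
    moreover have "P 0 v = p0 v" for v by (simp add: P_def X(3) vec_eq_iff)
    moreover have "equivalent E p0 (P r)" if "r \<in> {0..1}" for r
      unfolding equivalent_iff_sqlen[OF ends] coordsP using that X(1,4) by (auto simp: mult_left_le)
    ultimately show ?thesis using rig unfolding rigid_framework_def by blast
  qed
  then have "sqlen u v (X (\<tau> * r)) = sqlen u v ?a" if "r \<in> {0..1}" "u \<in> V" "v \<in> V" for r u v
    unfolding coordsP[symmetric] sqlen_coords using congruent_dist that by metis
  then have const: "sqlen u v (X s) = sqlen u v ?a" if "s \<in> {0..\<tau>}" "u \<in> V" "v \<in> V" for s u v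
    using that X(1) by (metis (no_types) atLeastAtMost_iff divide_le_eq_1 nonzero_mult_div_cancel_left
      order_less_le times_divide_eq_right zero_le_divide_iff)
  have limX: "((\<lambda>s. X s k) \<longlongrightarrow> ?a k) (at_right 0)" for k
  proof -
    have "((\<lambda>s. (X s k - ?a k) / s * s + ?a k) \<longlongrightarrow> h k * 0 + ?a k) (at_right 0)"
      by (intro tendsto_intros X(5))
    moreover have "\<forall>\<^sub>F s in at_right 0. (X s k - ?a k) / s * s + ?a k = X s k"
      unfolding eventually_at_right_field by (intro exI[of _ 1]) auto
    ultimately have "((\<lambda>s. X s k) \<longlongrightarrow> h k * 0 + ?a k) (at_right 0)" by (rule Lim_transform_eventually)
    then show ?thesis by simp
  qed
  have trivial: "(\<Sum>i\<in>UNIV. (p0 u $ i - p0 v $ i) * (h (u, i) - h (v, i))) = 0" if uv: "u \<in> V" "v \<in> V" for u v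
  proof -
    \<comment> \<open>The quotient of the change of squared distance by \<open>s\<close>, factored
      as a difference of squares so that its limit can be taken termwise. It is constantly 0, as
      rigidity preserves all distances.\<close>
    let ?q = "\<lambda>s. \<Sum>i\<in>UNIV. ((X s (u, i) - X s (v, i)) + (?a (u, i) - ?a (v, i))) *
      ((X s (u, i) - ?a (u, i)) / s - (X s (v, i) - ?a (v, i)) / s)"
    let ?L = "(\<Sum>i\<in>UNIV. ((?a (u, i) - ?a (v, i)) + (?a (u, i) - ?a (v, i))) * (h (u, i) - h (v, i)))"
    have "(?q \<longlongrightarrow> ?L) (at_right 0)"
      by (intro tendsto_intros limX X(5))
    moreover have "\<forall>\<^sub>F s in at_right 0. ?q s = 0"
      unfolding eventually_at_right_field
    proof (intro exI[of _ \<tau>] conjI allI impI)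
      fix s assume s: "0 < s" "s < \<tau>"
      have "?q s = (\<Sum>i\<in>UNIV. ((X s (u, i) - X s (v, i))\<^sup>2 - (?a (u, i) - ?a (v, i))\<^sup>2) / s)"
        using s by (intro sum.cong) (auto simp: field_simps power2_eq_square)
      also have "\<dots> = (sqlen u v (X s) - sqlen u v ?a) / s"
        by (simp only: sqlen_def sum_subtractf sum_divide_distrib[symmetric])
      also have "\<dots> = 0" using const[of s u v] s uv by simp
      finally show "?q s = 0" .
    qed (rule X(1))
    ultimately have "((\<lambda>_. 0) \<longlongrightarrow> ?L) (at_right (0::real))"
      by (rule Lim_transform_eventually)
    then have "?L = 0"
      by (simp add: tendsto_const_iff)
    moreover have "?L
      = 2 * (\<Sum>i\<in>UNIV. (p0 u $ i - p0 v $ i) * (h (u, i) - h (v, i)))"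
      unfolding sum_distrib_left by (intro sum.cong) (auto simp: algebra_simps)
    ultimately show ?thesis by simp
  qed
  have inj\<iota>: "inj \<iota>" and ran\<iota>: "\<And>i. \<iota> i < CARD('d)" using \<iota> by (auto simp: bij_betw_def)
  have kernel: "h (v, i) = 0"
    if v: "v \<in> V" and j: "j \<le> CARD('d)" "\<And>l. l < j \<Longrightarrow> fl l \<noteq> v" "\<And>i. j \<le> \<iota> i \<Longrightarrow> h (v, i) = 0"
      and prev: "\<And>l i. l < j \<Longrightarrow> h (fl l, i) = 0" for v j i
  proof (rule generic_flag_kernel[where u = "\<lambda>i. h (v, i)", OF fin(1) gen inj\<iota> v _ j(2) _ j(3)])
    show flV: "fl l \<in> V" if "l < j" for l using that j(1) fl(2) by auto
    show "inj_on fl {..<j}" using fl(1) by (rule inj_on_subset) (use j(1) in auto)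
    show "(\<Sum>i\<in>UNIV. (p0 v $ i - p0 (fl l) $ i) * h (v, i)) = 0" if "l < j" for l
      using trivial[OF v flV[OF that]] prev[OF that] by simp
  qed
  \<comment> \<open>Along the flag, pinning removes the velocity coordinates from \<open>j\<close>
    on, and orthogonality to the differences with the earlier, already motionless vertices removes
    the first \<open>j\<close>.\<close>
  have flag: "h (fl j, i) = 0" if "j < CARD('d)" for j i
    using that
  proof (induction j arbitrary: i rule: less_induct)
    case (less j)
    show ?case
    proof (rule kernel[of _ j])
      show "fl j \<in> V" using less(2) fl(2) by auto
      show "fl l \<noteq> fl j" if "l < j" for l using that less(2) fl(1) by (auto simp: inj_on_def)
      show "h (fl j, i) = 0" if "j \<le> \<iota> i" for i using that less(2) by (auto simp: h_def free_coords_def)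
    qed (use less in auto)
  qed
  have "h (v, i) = 0" if "v \<in> V" for v i
  proof (cases "v \<in> fl ` {..<CARD('d)}")
    case True then show ?thesis using flag by auto
  next
    case False
    show ?thesis
    proof (rule kernel[OF that, of "CARD('d)"])
      show "h (v, i) = 0" if "CARD('d) \<le> \<iota> i" for i using that ran\<iota>[of i] by simp
    qed (use False flag in auto)
  qed
  moreover obtain v i where "(v, i) \<in> ?K" "h0 (v, i) \<noteq> 0" using h0(1) by auto
  ultimately have "h (v, i) = 0" using KI by blast
  then show False using \<open>(v, i) \<in> ?K\<close> \<open>h0 (v, i) \<noteq> 0\<close> by (simp add: h_def)
qed

theorem pinned_realisation_regular:
  fixes p q :: "'v \<Rightarrow> real^'d::finite"
  assumes G: "simple_graph V E" and ends: "edge_ends V E s t"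
    and rigid: "minimally_d_rigid TYPE('d) V E"
    and gen: "generic V p" and eq: "equivalent E p q"
    and \<iota>: "bij_betw \<iota> (UNIV :: 'd set) {..<CARD('d)}"
    and fl: "inj_on fl {..<CARD('d)}" "fl ` {..<CARD('d)} \<subseteq> V" and pin: "pinned fl \<iota> q"
  shows "regular_at E (\<lambda>e. sqlen (s e) (t e)) (coords q)"
    and "\<And>k. k \<in> free_coords V fl \<iota> \<Longrightarrow> coords q k \<noteq> 0"
proof -
  let ?K = "free_coords V fl \<iota>"
  let ?f = "\<lambda>e. sqlen (s e) (t e) :: ('v \<times> 'd \<Rightarrow> real) \<Rightarrow> real"
  have fin: "finite V" "finite E" using simple_graph_finite[OF G] by auto
  have KI: "?K \<subseteq> V \<times> UNIV" by (auto simp: free_coords_def)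
  have finK: "finite ?K" by (rule finite_subset[OF KI]) (use fin(1) in simp)
  have end_in: "s e \<in> V" "t e \<in> V" if "e \<in> E" for e using edge_endsD(3,4)[OF ends that] by blast+
  obtain p0 :: "'v \<Rightarrow> real^'d" where p0: "generic V p0" "rigid_framework V E p0"
    using rigid unfolding minimally_d_rigid_def d_rigid_def by blast
  have ind0: "alg_indep_Q E (\<lambda>e. ?f e (coords p0))"
    using rigid p0 unfolding minimally_d_rigid_def d_rigid_def
    by (intro minimal_lengths_independent[OF G ends p0]) blast
  have count: "card ?K \<le> card E" by (rule rigid_edge_count[OF G ends p0 ind0 \<iota> fl])
  have "alg_indep_Q E (\<lambda>e. ?f e (coords p))"
    by (rule generic_lengths_independent[OF fin ends gen ind0])
  then have ind: "alg_indep_Q E (\<lambda>e. ?f e (coords q))"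
    using alg_indep_cong[of E "\<lambda>e. ?f e (coords q)" "\<lambda>e. ?f e (coords p)"] eq
    unfolding equivalent_iff_sqlen[OF ends] by simp
  \<comment> \<open>Pinned coordinates are filled with zeros, which makes the lengths polynomials in
    the free coordinates alone. The same padding turns directions for the restricted system into
    directions for the full one.\<close>
  define ext where "ext = (\<lambda>x k. if k \<in> ?K then x k else (0::real))"
  define F where "F = (\<lambda>e x. ?f e (ext x))"
  have cong: "?f e x = ?f e y" if "e \<in> E" "\<And>k. k \<in> V \<times> UNIV \<Longrightarrow> x k = y k" for e x y
    unfolding sqlen_def using that end_in by (intro sum.cong) auto
  have zero: "coords q k = 0" if "k \<in> V \<times> UNIV - ?K" for k
    using that pin by (auto simp: free_coords_def pinned_def)
  have F: "ratpoly ?K (F e)" for e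
    unfolding F_def ext_def
    by (rule ratpoly_subst[where I = UNIV and \<phi> = "\<lambda>k x. if k \<in> ?K then x k else 0"])
      (auto intro!: ratpoly_sqlen ratpoly_if ratpoly_var)
  have Fq: "F e (coords q) = ?f e (coords q)" if "e \<in> E" for e
    unfolding F_def using zero by (intro cong[OF that]) (auto simp: ext_def)
  have indF: "alg_indep_Q E (\<lambda>e. F e (coords q))"
    using ind alg_indep_cong[of E "\<lambda>e. F e (coords q)" "\<lambda>e. ?f e (coords q)"] Fq by simp
  have indK: "alg_indep_Q ?K (coords q)"
    using dependent_variables_bound[OF finK fin(2) F indF] count by (meson leD)
  then show "coords q k \<noteq> 0" if "k \<in> ?K" for k using alg_indep_nonzero[OF finK] that by blast
  have regF: "regular_at E F (coords q)"
    by (rule alg_indep_imp_regular[OF finK fin(2) F indK indF])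
  show "regular_at E ?f (coords q)" unfolding regular_at_def
  proof
    fix r
    obtain h where h: "\<And>e. e \<in> E \<Longrightarrow> dir_deriv (F e) (coords q) h (r e)"
      using regF unfolding regular_at_def by blast
    have "dir_deriv (?f e) (coords q) (ext h) (r e)" if "e \<in> E" for e
    proof -
      have "?f e (\<lambda>k. coords q k + s * ext h k) = F e (\<lambda>k. coords q k + s * h k)" for s
        unfolding F_def using zero by (intro cong[OF that]) (auto simp: ext_def)
      then show ?thesis using h[OF that] by (simp add: dir_deriv_def)
    qed
    then show "\<exists>h. \<forall>e\<in>E. dir_deriv (?f e) (coords q) h (r e)" by blast
  qed
qed

section \<open>Congruence and triangular systems\<close>

text \<open>\<open>isometry\<close> demands preservation of distances only; surjectivity comes from
  \<open>T - T 0\<close> being an orthogonal transformation.\<close>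

lemma isometry_inverse:
  fixes T :: "real^'d \<Rightarrow> real^'d"
  assumes "isometry T"
  obtains T' where "isometry T'" "\<And>y. T' (T y) = y"
proof -
  define f where "f = (\<lambda>y. T y - T 0)"
  have "orthogonal_transformation f"
    unfolding orthogonal_transformation_isometry f_def
    using assms by (simp add: isometry_def dist_norm)
  then obtain g where g: "orthogonal_transformation g" "g \<circ> f = id"
    by (metis bij_is_inj inv_o_cancel orthogonal_transformation_bij orthogonal_transformation_inv)
  have inv: "g (f y) = y" for y using g(2) by (metis comp_apply id_apply)
  show thesis
  proof (rule that[of "\<lambda>y. g (y - T 0)"])
    show "isometry (\<lambda>y. g (y - T 0))"
    proof -
      have "linear g" using g(1) by (rule orthogonal_transformation_linear)
      then show ?thesis
        by (simp add: isometry_def linear_diff[symmetric] orthogonal_transformation_norm[OF g(1)])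
    qed
    show "g (T y - T 0) = y" for y using inv[of y] by (simp add: f_def)
  qed
qed

lemma congruent_refl: "congruent V q q"
  unfolding congruent_def isometry_def by (intro exI[of _ id]) auto

lemma congruent_sym:
  assumes "congruent V p q" shows "congruent V q p"
proof -
  obtain T where T: "isometry T" "\<forall>v\<in>V. q v = T (p v)" using assms unfolding congruent_def by blast
  obtain T' where "isometry T'" "\<And>y. T' (T y) = y" using isometry_inverse[OF T(1)] by blast
  then show ?thesis unfolding congruent_def using T(2) by (intro exI[of _ T']) simp
qed

lemma congruent_trans:
  assumes "congruent V p q" "congruent V q r" shows "congruent V p r"
proof -
  obtain S where S: "isometry S" "\<forall>v\<in>V. q v = S (p v)" using assms(1) unfolding congruent_def by blast
  obtain T where T: "isometry T" "\<forall>v\<in>V. r v = T (q v)" using assms(2) unfolding congruent_def by blast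
  have "isometry (\<lambda>y. T (S y))" using S(1) T(1) by (simp add: isometry_def)
  then show ?thesis unfolding congruent_def using S(2) T(2) by (intro exI[of _ "\<lambda>y. T (S y)"]) simp
qed

lemma congruent_classes_eq:
  assumes "congruent V p q" shows "{r. congruent V p r} = {r. congruent V q r}"
  using congruent_trans[OF assms] congruent_trans[OF congruent_sym[OF assms]] by blast

text \<open>Incongruent realisations must differ in some distance, a polynomial quantity.
  Polarisation turns distances into inner products, a basis among the vectors
  \<open>p v - p x\<close> defines \<open>L\<close>, and \<open>L\<close> is the right map on all
  vertices because the squared norm of the error expands into inner products that cancel.\<close>

lemma equal_distances_imp_congruent:
  fixes p q :: "'v \<Rightarrow> real^'d"
  assumes x: "x \<in> V" and span: "span ((\<lambda>v. p v - p x) ` V) = UNIV"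
    and dist: "\<And>u v. u \<in> V \<Longrightarrow> v \<in> V \<Longrightarrow> norm (q u - q v) = norm (p u - p v)"
  shows "congruent V p q"
proof -
  let ?a = "\<lambda>v. p v - p x" and ?b = "\<lambda>v. q v - q x"
  have inner: "?b u \<bullet> ?b v = ?a u \<bullet> ?a v" if "u \<in> V" "v \<in> V" for u v
  proof -
    have polar: "y \<bullet> z = ((norm y)\<^sup>2 + (norm z)\<^sup>2 - (norm (y - z))\<^sup>2) / 2" for y z :: "real^'d"
      by (simp add: power2_norm_eq_inner inner_diff inner_commute)
    have "?b u - ?b v = q u - q v" "?a u - ?a v = p u - p v" by simp_all
    then show ?thesis unfolding polar using dist[OF that] dist[OF that(1) x] dist[OF that(2) x] by (simp only:)
  qed
  obtain B where B: "B \<subseteq> ?a ` V" "independent B" "?a ` V \<subseteq> span B"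
    using maximal_independent_subset[of "?a ` V"] by blast
  have finB: "finite B" using B(2) by (rule independent_imp_finite)
  have spanB: "span B = UNIV" using B(3) span by (metis span_mono span_span top.extremum_uniqueI)
  have "\<forall>b\<in>B. \<exists>v. v \<in> V \<and> b = ?a v" using B(1) by blast
  then obtain w where w: "\<And>b. b \<in> B \<Longrightarrow> w b \<in> V" "\<And>b. b \<in> B \<Longrightarrow> ?a (w b) = b"
    unfolding bchoice_iff by metis
  obtain L :: "real^'d \<Rightarrow> real^'d" where L: "linear L" "\<forall>b\<in>B. L b = ?b (w b)"
    using linear_independent_extend[OF B(2), of "\<lambda>b. ?b (w b)"] by blast
  have expand: "\<exists>c. y = (\<Sum>b\<in>B. c b *\<^sub>R b)" for y
    using spanB finB span_finite[OF finB] by (metis (mono_tags, lifting) UNIV_I imageE)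
  have Linner: "L y \<bullet> ?b v = y \<bullet> ?a v" if "v \<in> V" for y v
  proof -
    obtain c where c: "y = (\<Sum>b\<in>B. c b *\<^sub>R b)" using expand by blast
    have "L b \<bullet> ?b v = b \<bullet> ?a v" if "b \<in> B" for b
      using inner[OF w(1)[OF that] \<open>v \<in> V\<close>] L(2) w(2)[OF that] that by simp
    then show ?thesis
      unfolding c by (simp add: linear_sum[OF L(1)] linear_scale[OF L(1)] inner_sum_left)
  qed
  have Lnorm: "norm (L y) = norm y" for y
  proof -
    obtain c where c: "y = (\<Sum>b\<in>B. c b *\<^sub>R b)" using expand by blast
    have "z \<bullet> L b = L b \<bullet> z" for z b by (rule inner_commute)
    have "L y \<bullet> L y = (\<Sum>b\<in>B. c b *\<^sub>R (L y \<bullet> L b))"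
      by (subst (2) c) (simp add: linear_sum[OF L(1)] linear_scale[OF L(1)] inner_sum_right)
    also have "\<dots> = (\<Sum>b\<in>B. c b *\<^sub>R (y \<bullet> b))"
      using L(2) Linner w by (intro sum.cong) auto
    also have "\<dots> = y \<bullet> y" by (subst (3) c) (simp add: inner_sum_right)
    finally show ?thesis by (simp add: norm_eq_sqrt_inner)
  qed
  have "L (?a v) = ?b v" if v: "v \<in> V" for v
  proof -
    have "(L (?a v) - ?b v) \<bullet> (L (?a v) - ?b v)
        = L (?a v) \<bullet> L (?a v) - 2 * (L (?a v) \<bullet> ?b v) + ?b v \<bullet> ?b v"
      by (simp only: inner_diff_left inner_diff_right) (simp add: inner_commute)
    also have "L (?a v) \<bullet> L (?a v) = ?a v \<bullet> ?a v" using Lnorm by (simp only: dot_square_norm)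
    finally have "(L (?a v) - ?b v) \<bullet> (L (?a v) - ?b v) = 0"
      using Linner[OF v, of "?a v"] inner[OF v v] by simp
    then show ?thesis by simp
  qed
  then have "q v = L (p v - p x) + q x" if "v \<in> V" for v using that by simp
  moreover have "isometry (\<lambda>y. L (y - p x) + q x)"
    unfolding isometry_def by (simp add: linear_diff[OF L(1), symmetric] Lnorm)
  ultimately show ?thesis unfolding congruent_def by blast
qed

text \<open>Forward substitution in the order of \<open>\<iota>\<close>. The rows in mind are the
  vertices of a pinned flag, completed by one vector off their hyperplane.\<close>

lemma triangular_kernel:
  fixes r :: "nat \<Rightarrow> real^'d::finite"
  assumes \<iota>: "bij_betw \<iota> (UNIV :: 'd set) {..<CARD('d)}"
    and upper: "\<And>n i. n < \<iota> i \<Longrightarrow> n < CARD('d) \<Longrightarrow> r n $ i = 0" and diag: "\<And>i. r (\<iota> i) $ i \<noteq> 0"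
    and z: "\<And>n. n < CARD('d) \<Longrightarrow> r n \<bullet> z = 0"
  shows "z = 0"
proof -
  have inj: "inj \<iota>" and ran: "\<And>i. \<iota> i < CARD('d)" using \<iota> by (auto simp: bij_betw_def)
  have "z $ i = 0" if "\<iota> i = n" for n i
    using that
  proof (induction n arbitrary: i rule: less_induct)
    case (less n)
    have "r n \<bullet> z = (\<Sum>i'\<in>UNIV. if i' = i then r n $ i * z $ i else 0)"
      unfolding inner_vec_def
    proof (intro sum.cong refl)
      fix i'
      consider "\<iota> i' < n" | "i' = i" | "n < \<iota> i'"
        using less(2) inj by (metis injD linorder_neqE_nat)
      then show "inner (r n $ i') (z $ i') = (if i' = i then r n $ i * z $ i else 0)"
      proof cases
        case 1 then show ?thesis using less by auto
      next
        case 3 then show ?thesis using upper ran[of i] less(2) by auto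
      qed simp
    qed
    then have "r n $ i * z $ i = 0" using z ran[of i] less(2) by auto
    then show ?case using diag[of i] less(2) by simp
  qed
  then show ?thesis by (simp add: vec_eq_iff)
qed

lemma triangular_solvable:
  fixes r :: "nat \<Rightarrow> real^'d::finite"
  assumes \<iota>: "bij_betw \<iota> (UNIV :: 'd set) {..<CARD('d)}"
    and upper: "\<And>n i. n < \<iota> i \<Longrightarrow> n < CARD('d) \<Longrightarrow> r n $ i = 0" and diag: "\<And>i. r (\<iota> i) $ i \<noteq> 0"
  shows "\<exists>z. \<forall>n<CARD('d). r n \<bullet> z = c n"
proof -
  define L :: "real^'d \<Rightarrow> real^'d" where "L = (\<lambda>z. \<chi> i. r (\<iota> i) \<bullet> z)"
  have lin: "linear L" unfolding L_def by (rule linearI) (auto simp: vec_eq_iff inner_add_right)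
  have surj\<iota>: "\<exists>i. \<iota> i = n" if "n < CARD('d)" for n
  proof -
    have "n \<in> range \<iota>" using \<iota> that by (simp add: bij_betw_def)
    then show ?thesis by auto
  qed
  have "inj L" unfolding linear_injective_0[OF lin]
  proof (intro allI impI)
    fix z assume "L z = 0"
    then have "r (\<iota> i) \<bullet> z = 0" for i by (simp add: L_def vec_eq_iff)
    then have z: "r n \<bullet> z = 0" if "n < CARD('d)" for n using surj\<iota>[OF that] by blast
    show "z = 0" by (rule triangular_kernel[OF \<iota> upper diag z])
  qed
  then have "surj L" by (rule linear_injective_imp_surjective[OF lin]) simp
  then obtain z where "L z = (\<chi> i. c (\<iota> i))" by (metis surjD)
  then have "r (\<iota> i) \<bullet> z = c (\<iota> i)" for i by (simp add: L_def vec_eq_iff)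
  then show ?thesis using surj\<iota> by metis
qed

lemma ratpoly_continuous_at:
  assumes "ratpoly K F" "\<omega> > 0"
  shows "\<exists>\<epsilon>>0. \<forall>b. (\<forall>k\<in>K. \<bar>b k - a k\<bar> < \<epsilon>) \<longrightarrow> \<bar>F b - F a\<bar> < \<omega>"
proof -
  have "((\<lambda>p. F (fst p)) \<longlongrightarrow> F a) (near2 K a)"
    using assms(1) near2_coordinates(1) by (rule ratpoly_tendsto)
  then have "\<forall>\<^sub>F p in near2 K a. \<bar>F (fst p) - F a\<bar> < \<omega>" using assms(2) by (auto simp: tendsto_iff dist_real_def)
  then obtain \<epsilon> where "\<epsilon> > 0" "\<And>b. (\<forall>k\<in>K. \<bar>b k - a k\<bar> \<le> \<epsilon>) \<Longrightarrow> \<bar>F b - F a\<bar> < \<omega>"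
    unfolding eventually_near2 by fastforce
  then show ?thesis by (intro exI[of _ \<epsilon>]) (auto intro: less_imp_le)
qed

lemma finite_uniform_bound:
  assumes "finite S" "\<And>i. i \<in> S \<Longrightarrow> \<exists>\<epsilon>>0::real. \<forall>\<delta>. 0 < \<delta> \<and> \<delta> \<le> \<epsilon> \<longrightarrow> P i \<delta>"
  shows "\<exists>\<epsilon>>0. \<forall>i\<in>S. P i \<epsilon>"
proof -
  obtain f where f: "\<And>i. i \<in> S \<Longrightarrow> f i > 0 \<and> (\<forall>\<delta>. 0 < \<delta> \<and> \<delta> \<le> f i \<longrightarrow> P i \<delta>)"
    using bchoice[of S "\<lambda>i \<epsilon>. \<epsilon> > 0 \<and> (\<forall>\<delta>. 0 < \<delta> \<and> \<delta> \<le> \<epsilon> \<longrightarrow> P i \<delta>)"] assms(2) by blast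
  define \<epsilon> where "\<epsilon> = Min (insert 1 (f ` S))"
  have "\<epsilon> > 0" unfolding \<epsilon>_def using assms(1) f by auto
  moreover have "\<epsilon> \<le> f i" if "i \<in> S" for i unfolding \<epsilon>_def using assms(1) that by (intro Min_le) auto
  ultimately show ?thesis using f by blast
qed

section \<open>The degenerate split framework\<close>

lemma norm2_sum: "(norm v)\<^sup>2 = (\<Sum>i\<in>UNIV. (v $ i)\<^sup>2)" for v :: "real^'d"
  by (simp add: norm_vec_def L2_set_def sum_nonneg)

lemma inner_sum: "v \<bullet> w = (\<Sum>i\<in>UNIV. v $ i * w $ i)" for v w :: "real^'d"
  by (simp add: inner_vec_def)

text \<open>A framework of the split graph is encoded by a framework \<open>pos\<close> of the original graph, a direction
  \<open>dir\<close> and a scale: \<open>x1\<close> and \<open>x2\<close> sit at \<open>pos x\<close> plus and minus \<open>scale\<close> times \<open>dir\<close>. At scale 0 both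
  new vertices collapse to \<open>x\<close>, but the direction remains a variable.\<close>

type_synonym ('v, 'd) split_coord = "('v \<times> 'd) + 'd option"

definition pos :: "(('v, 'd::finite) split_coord \<Rightarrow> real) \<Rightarrow> 'v \<Rightarrow> real^'d" where
  "pos b v = (\<chi> i. b (Inl (v, i)))"

definition dir :: "(('v, 'd::finite) split_coord \<Rightarrow> real) \<Rightarrow> real^'d" where
  "dir b = (\<chi> i. b (Inr (Some i)))"

definition scale :: "(('v, 'd::finite) split_coord \<Rightarrow> real) \<Rightarrow> real" where
  "scale b = b (Inr None)"

definition split_vars :: "'v set \<Rightarrow> ('v, 'd) split_coord set" where
  "split_vars V = Inl ` (V \<times> UNIV) \<union> range Inr"

definition collapsed :: "('v \<Rightarrow> real^'d) \<Rightarrow> real^'d \<Rightarrow> ('v, 'd::finite) split_coord \<Rightarrow> real" where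
  "collapsed q z k = (case k of Inl vi \<Rightarrow> coords q vi | Inr (Some i) \<Rightarrow> z $ i | Inr None \<Rightarrow> 0)"

lemma collapsed_simps [simp]:
  "pos (collapsed q z) = q" "dir (collapsed q z) = z" "scale (collapsed q z) = 0"
  by (auto simp: pos_def dir_def scale_def collapsed_def vec_eq_iff)

lemma split_coord_line [simp]:
  "pos (\<lambda>k. b k + s * h k) v = pos b v + s *\<^sub>R pos h v"
  "dir (\<lambda>k. b k + s * h k) = dir b + s *\<^sub>R dir h"
  "scale (\<lambda>k. b k + s * h k) = scale b + s * scale h"
  by (auto simp: pos_def dir_def scale_def vec_eq_iff)

lemma ratpoly_pos: "v \<in> V \<Longrightarrow> ratpoly (split_vars V) (\<lambda>b. pos b v $ i)"
  unfolding pos_def vec_lambda_beta by (intro ratpoly_var) (auto simp: split_vars_def)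

lemma ratpoly_dir: "ratpoly (split_vars V) (\<lambda>b. dir b $ i)"
  unfolding dir_def vec_lambda_beta by (intro ratpoly_var) (auto simp: split_vars_def)

lemma ratpoly_scale: "ratpoly (split_vars V) scale"
  unfolding scale_def by (intro ratpoly_var) (auto simp: split_vars_def)

lemma ratpoly_of_int: "ratpoly I (\<lambda>x. of_int n)"
  using ratpoly_const[of I "of_int n"] by simp

lemmas ratpoly_split_intros = ratpoly_sum ratpoly_mult ratpoly_add ratpoly_diff ratpoly_power
  ratpoly_of_int ratpoly_pos ratpoly_dir ratpoly_scale

definition split_conf :: "'v \<Rightarrow> 'v \<Rightarrow> 'v \<Rightarrow> (('v, 'd::finite) split_coord \<Rightarrow> real) \<Rightarrow> 'v \<Rightarrow> real^'d" where
  "split_conf x x1 x2 b v = (if v = x1 then pos b x + scale b *\<^sub>R dir b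
     else if v = x2 then pos b x - scale b *\<^sub>R dir b else pos b v)"

text \<open>Since \<open>x\<close> and \<open>W\<close> make up the flag, they lie in the hyperplane
  where coordinate \<open>top\<close> vanishes, for every pinned realisation. The vertex
  \<open>vd\<close> off the flag serves to tell the two sides of this hyperplane apart.\<close>

locale split_setting =
  fixes V E :: "_" and x :: "'v" and N1 N2 W x1 x2 V' E' s t fl
    and \<iota> :: "'d::finite \<Rightarrow> nat" and vd :: 'v and top :: 'd
  assumes G: "simple_graph V E" and rigid: "minimally_d_rigid TYPE('d) V E"
    and split: "vertex_split CARD('d) V E x N1 N2 W x1 x2 V' E'"
    and ends: "edge_ends V E s t" and ends_x: "\<And>e. e \<in> E \<Longrightarrow> x \<in> e \<Longrightarrow> t e = x"
    and \<iota>: "bij_betw \<iota> (UNIV :: 'd set) {..<CARD('d)}"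
    and fl: "inj_on fl {..<CARD('d)}" "fl 0 = x" "fl ` {1..<CARD('d)} = W"
    and vd: "vd \<in> V" "vd \<notin> fl ` {..<CARD('d)}" and top: "Suc (\<iota> top) = CARD('d)"
begin

text \<open>The sign with which the displacement of the split vertex enters the length of an edge at \<open>x\<close>,
  according to the part of the neighbourhood it leads to; an edge to \<open>W\<close> is replaced by two,
  whose squared lengths are recorded by their mean and their difference.\<close>

definition side :: "'v set \<Rightarrow> int" where
  "side e = (if x \<in> e \<and> s e \<in> N1 then -1 else if x \<in> e \<and> s e \<in> N2 then 1 else 0)"

definition shared :: "'v set \<Rightarrow> int" where
  "shared e = (if x \<in> e \<and> s e \<in> W then 1 else 0)"

text \<open>The entry at \<open>w\<close> is the difference of the squared lengths from
  \<open>w\<close> to \<open>x2\<close> and \<open>x1\<close>, divided by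
  \<open>4 * scale b\<close>. The edge \<open>x1 x2\<close>, of length
  \<open>2 * \<bar>scale b\<bar> * norm (dir b)\<close>, is recorded by two entries, since its
  squared length has zero derivative at scale 0.\<close>

definition sys :: "'v set + ('v + bool) \<Rightarrow> (('v, 'd) split_coord \<Rightarrow> real) \<Rightarrow> real" where
  "sys j b = (case j of
      Inl e \<Rightarrow> (norm (pos b (s e) - pos b (t e) + (of_int (side e) * scale b) *\<^sub>R dir b))\<^sup>2
        + of_int (shared e) * (norm (scale b *\<^sub>R dir b))\<^sup>2
    | Inr (Inl w) \<Rightarrow> (pos b w - pos b x) \<bullet> dir b
    | Inr (Inr True) \<Rightarrow> (norm (dir b))\<^sup>2
    | Inr (Inr False) \<Rightarrow> scale b)"

definition eqs :: "('v set + ('v + bool)) set" where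
  "eqs = Inl ` E \<union> Inr ` Inl ` W \<union> {Inr (Inr True), Inr (Inr False)}"

lemma fin: "finite V" "finite E" "finite W"
  using simple_graph_finite[OF G] split by (auto simp: vertex_split_def)

lemma splitD:
  "x \<in> V" "N1 \<union> N2 \<union> W = neighbours E x" "N1 \<inter> N2 = {}" "N1 \<inter> W = {}" "N2 \<inter> W = {}"
  "x1 \<noteq> x2" "x1 \<notin> V - {x}" "x2 \<notin> V - {x}" "V' = (V - {x}) \<union> {x1, x2}"
  "E' = {e \<in> E. x \<notin> e} \<union> {{x1, u} | u. u \<in> N1} \<union> {{x2, u} | u. u \<in> N2}
      \<union> {{x1, w} | w. w \<in> W} \<union> {{x2, w} | w. w \<in> W} \<union> {{x1, x2}}"
  using split unfolding vertex_split_def by blast+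

lemma neighbour_in: "u \<in> V - {x}" if "u \<in> neighbours E x"
proof -
  have e: "{x, u} \<in> E" using that by (simp add: neighbours_def)
  obtain a b where "{x, u} = {a, b}" "a \<noteq> b" "a \<in> V" "b \<in> V"
    using G e unfolding simple_graph_def by blast
  then show ?thesis by (auto simp: doubleton_eq_iff)
qed

lemma N_in: "u \<in> N1 \<or> u \<in> N2 \<or> u \<in> W \<Longrightarrow> u \<in> V - {x} \<and> {x, u} \<in> E"
  using splitD(2) neighbour_in unfolding neighbours_def by blast

lemma edge_at_x:
  assumes "e \<in> E" "x \<in> e" shows "t e = x" "e = {x, s e}"
proof -
  show t: "t e = x" using ends_x assms by blast
  have "e = {s e, t e}" by (rule edge_endsD(1)[OF ends assms(1)])
  also have "\<dots> = {x, s e}" unfolding t by (rule insert_commute)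
  finally show "e = {x, s e}" .
qed

lemma fl_in: "fl ` {..<CARD('d)} \<subseteq> V"
proof -
  have "{..<CARD('d)} = insert 0 {1..<CARD('d)}" by auto
  then have "fl ` {..<CARD('d)} = insert x W" using fl(2,3) by simp
  then show ?thesis using N_in splitD(1) by auto
qed

lemma finite_eqs: "finite eqs"
  unfolding eqs_def using fin by simp

lemma finite_vars: "finite (split_vars V :: ('v, 'd) split_coord set)"
  unfolding split_vars_def using fin by simp

lemma ratpoly_sys: "ratpoly (split_vars V) (sys j)" if "j \<in> eqs"
proof -
  have W: "W \<subseteq> V" using N_in by auto
  have "ratpoly (split_vars V) (sys (Inl e))" if "e \<in> E" for e
    unfolding sys_def sum.case norm2_sum vector_add_component vector_minus_component vector_scaleR_component real_scaleR_def
    using edge_endsD(3,4)[OF ends that] by (intro ratpoly_split_intros)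
  moreover have "ratpoly (split_vars V) (sys (Inr (Inl w)))" if "w \<in> W" for w
    unfolding sys_def sum.case inner_sum vector_minus_component
    using that W splitD(1) by (intro ratpoly_split_intros) auto
  moreover have "ratpoly (split_vars V) (sys (Inr (Inr c)))" for c
    unfolding sys_def sum.case by (cases c) (auto simp: norm2_sum intro!: ratpoly_split_intros ratpoly_scale)
  ultimately show ?thesis using that unfolding eqs_def by blast
qed

lemma dir_deriv_sys:
  assumes "scale b = 0"
  shows "dir_deriv (sys (Inl e)) b h (\<Sum>i\<in>UNIV. 2 * ((pos b (s e) - pos b (t e)) $ i *
      (pos h (s e) - pos h (t e) + (of_int (side e) * scale h) *\<^sub>R dir b) $ i))"
    and "dir_deriv (sys (Inr (Inl w))) b h ((pos b w - pos b x) \<bullet> dir h + (pos h w - pos h x) \<bullet> dir b)"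
    and "dir_deriv (sys (Inr (Inr True))) b h (2 * (dir b \<bullet> dir h))"
    and "dir_deriv (sys (Inr (Inr False))) b h (scale h)"
  unfolding dir_deriv_def sys_def sum.case bool.case split_coord_line norm2_sum inner_sum
    vector_add_component vector_minus_component vector_scaleR_component real_scaleR_def assms sum_distrib_left[of 2] sum.distrib[symmetric]
  by (auto intro!: derivative_eq_intros sum.cong simp: algebra_simps)

lemma lengths_derivative_onto:
  assumes "regular_at E (\<lambda>e. sqlen (s e) (t e)) (coords q)"
  shows "\<exists>h :: 'v \<Rightarrow> real^'d. \<forall>e\<in>E. (\<Sum>i\<in>UNIV. 2 * ((q (s e) - q (t e)) $ i * (h (s e) - h (t e)) $ i)) = r e"
proof -
  obtain h where h: "\<And>e. e \<in> E \<Longrightarrow> dir_deriv (sqlen (s e) (t e)) (coords q) h (r e)"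
    using assms unfolding regular_at_def by blast
  have "(\<Sum>i\<in>UNIV. 2 * ((q (s e) - q (t e)) $ i * (h (s e, i) - h (t e, i)))) = r e" if "e \<in> E" for e
    using dir_deriv_unique[OF dir_deriv_sqlen h[OF that]] by simp
  then show ?thesis by (intro exI[of _ "\<lambda>v. \<chi> i. h (v, i)"]) simp
qed

definition realisation :: "('v \<Rightarrow> real^'d) \<Rightarrow> bool" where
  "realisation q \<longleftrightarrow> pinned fl \<iota> q \<and> (\<exists>p. generic V p \<and> equivalent E p q)"

lemma realisation_regular:
  assumes "realisation q"
  shows "regular_at E (\<lambda>e. sqlen (s e) (t e)) (coords q)"
    and "\<And>j i. Suc (\<iota> i) = j \<Longrightarrow> j < CARD('d) \<Longrightarrow> q (fl j) $ i \<noteq> 0"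
    and "q vd $ i \<noteq> 0"
proof -
  obtain p where p: "generic V p" "equivalent E p q" and pin: "pinned fl \<iota> q"
    using assms unfolding realisation_def by blast
  note reg = pinned_realisation_regular[OF G ends rigid p \<iota> fl(1) fl_in pin]
  show "regular_at E (\<lambda>e. sqlen (s e) (t e)) (coords q)" by (rule reg(1))
  show "q (fl j) $ i \<noteq> 0" if "Suc (\<iota> i) = j" "j < CARD('d)" for j i
  proof -
    have "(fl j, i) \<notin> {(fl j, i) | j i. j < CARD('d) \<and> j \<le> \<iota> i}"
    proof
      assume "(fl j, i) \<in> {(fl j, i) | j i. j < CARD('d) \<and> j \<le> \<iota> i}"
      then obtain j' where "fl j = fl j'" "j' < CARD('d)" "j' \<le> \<iota> i" by auto
      moreover from this have "j' = j" using fl(1) that(2) by (auto simp: inj_on_def)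
      ultimately show False using that(1) by simp
    qed
    moreover have "fl j \<in> V" using fl_in that(2) by auto
    ultimately have "(fl j, i) \<in> free_coords V fl \<iota>" by (simp add: free_coords_def)
    from reg(2)[OF this] show ?thesis by simp
  qed
  have "(vd, i) \<in> free_coords V fl \<iota>" using vd by (auto simp: free_coords_def)
  from reg(2)[OF this] show "q vd $ i \<noteq> 0" by simp
qed

text \<open>The vertex \<open>fl 0\<close> is the origin, so row \<open>n\<close> is the vertex
  \<open>fl (Suc n)\<close>. This leaves the last row to \<open>z\<close>, whose diagonal entry is
  at \<open>top\<close>.\<close>

lemma flag_rows:
  assumes "realisation q"
  shows "\<And>n i. n < \<iota> i \<Longrightarrow> n < CARD('d) \<Longrightarrow> (if Suc n < CARD('d) then q (fl (Suc n)) else z) $ i = 0"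
    and "z $ top \<noteq> 0 \<Longrightarrow> (if Suc (\<iota> i) < CARD('d) then q (fl (Suc (\<iota> i))) else z) $ i \<noteq> 0"
proof -
  have ran: "\<iota> i < CARD('d)" and inj: "inj \<iota>" for i using \<iota> by (auto simp: bij_betw_def)
  show "(if Suc n < CARD('d) then q (fl (Suc n)) else z) $ i = 0" if "n < \<iota> i" "n < CARD('d)" for n i
    using assms that ran[of i] unfolding realisation_def pinned_def by auto
  assume z: "z $ top \<noteq> 0"
  show "(if Suc (\<iota> i) < CARD('d) then q (fl (Suc (\<iota> i))) else z) $ i \<noteq> 0"
  proof (cases "Suc (\<iota> i) < CARD('d)")
    case True then show ?thesis using realisation_regular(2)[OF assms refl True] by simp
  next
    case False
    then have "\<iota> i = \<iota> top" using top ran[of i] by simp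
    then show ?thesis using False z inj by (auto dest: injD)
  qed
qed

lemma realisation_origin: "realisation q \<Longrightarrow> q x = 0"
  using fl(2) unfolding realisation_def pinned_def by (auto simp: vec_eq_iff)

text \<open>At scale 0 the velocity of \<open>dir\<close> does not affect the lengths, so the
  derivative is block triangular: the scale velocity is prescribed, regularity of the lengths of
  \<open>G\<close> yields the vertex velocities, and the other equations form a triangular system
  for the velocity of \<open>dir\<close>.\<close>

lemma regular_collapsed:
  assumes q: "realisation q" and z: "z = axis top c" "c \<noteq> 0"
  shows "regular_at eqs sys (collapsed q z)"
  unfolding regular_at_def
proof
  fix r :: "'v set + ('v + bool) \<Rightarrow> real"
  let ?b = "collapsed q z" and ?\<theta> = "r (Inr (Inr False))"
  \<comment> \<open>The contribution of the scale velocity \<open>?\<theta>\<close> is moved to the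
    right-hand side before the vertex velocities are solved for.\<close>
  let ?r = "\<lambda>e. r (Inl e) - (\<Sum>i\<in>UNIV. 2 * ((q (s e) - q (t e)) $ i * ((of_int (side e) * ?\<theta>) *\<^sub>R z) $ i))"
  obtain h :: "'v \<Rightarrow> real^'d" where h: "\<forall>e\<in>E.
      (\<Sum>i\<in>UNIV. 2 * ((q (s e) - q (t e)) $ i * (h (s e) - h (t e)) $ i))
      = ?r e"
    using lengths_derivative_onto[OF realisation_regular(1)[OF q], of ?r] by (rule exE)
  have zt: "z $ top \<noteq> 0" using z by (simp add: axis_def)
  \<comment> \<open>The rows are the vectors to \<open>W\<close> and, in last place,
    \<open>z\<close> itself; differentiating the squared norm of \<open>dir\<close> explains the
    factor 1/2.\<close>
  obtain \<zeta> where \<zeta>: "\<And>n. n < CARD('d) \<Longrightarrow> (if Suc n < CARD('d) then q (fl (Suc n)) else z) \<bullet> \<zeta> =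
      (if Suc n < CARD('d) then r (Inr (Inl (fl (Suc n)))) - (h (fl (Suc n)) - h x) \<bullet> z else r (Inr (Inr True)) / 2)"
    using triangular_solvable[OF \<iota> flag_rows(1)[OF q, of _ _ z] flag_rows(2)[OF q zt],
      of "\<lambda>n. if Suc n < CARD('d) then r (Inr (Inl (fl (Suc n)))) - (h (fl (Suc n)) - h x) \<bullet> z else r (Inr (Inr True)) / 2"]
    by blast
  define k where "k = (\<lambda>k. case k of Inl vi \<Rightarrow> coords h vi | Inr (Some i) \<Rightarrow> \<zeta> $ i | Inr None \<Rightarrow> ?\<theta>)"
  have k: "pos k = h" "dir k = \<zeta>" "scale k = ?\<theta>"
    by (auto simp: k_def pos_def dir_def scale_def vec_eq_iff)
  have "dir_deriv (sys (Inl e)) ?b k (r (Inl e))" if "e \<in> E" for e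
  proof -
    have "(\<Sum>i\<in>UNIV. 2 * ((q (s e) - q (t e)) $ i * (h (s e) - h (t e) + (of_int (side e) * ?\<theta>) *\<^sub>R z) $ i)) = r (Inl e)"
      using bspec[OF h that] by (simp only: vector_add_component distrib_left sum.distrib)
    then show ?thesis using dir_deriv_sys(1)[of ?b e k] by (simp add: k)
  qed
  moreover have "dir_deriv (sys (Inr (Inl w))) ?b k (r (Inr (Inl w)))" if "w \<in> W" for w
  proof -
    obtain j where j: "j \<in> {1..<CARD('d)}" "w = fl j" using \<open>w \<in> W\<close> fl(3) by blast
    then have "Suc (j - 1) < CARD('d)" "Suc (j - 1) = j" by auto
    then have "q w \<bullet> \<zeta> = r (Inr (Inl w)) - (h w - h x) \<bullet> z" using \<zeta>[of "j - 1"] j(2) by auto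
    then show ?thesis using dir_deriv_sys(2)[of ?b w k] realisation_origin[OF q] by (simp add: k)
  qed
  moreover have "dir_deriv (sys (Inr (Inr True))) ?b k (r (Inr (Inr True)))"
    using dir_deriv_sys(3)[of ?b k] \<zeta>[of "\<iota> top"] top by (simp add: k mult.commute)
  moreover have "dir_deriv (sys (Inr (Inr False))) ?b k (r (Inr (Inr False)))"
    using dir_deriv_sys(4)[of ?b k] by (simp add: k)
  ultimately show "\<exists>h. \<forall>j\<in>eqs. dir_deriv (sys j) ?b h (r j)"
    unfolding eqs_def by (intro exI[of _ k]) blast
qed

lemma sys_collapsed_eq:
  assumes q: "realisation q" "realisation q'" and eq: "equivalent E q q'"
    and z: "z = axis top c" "z' = axis top c'" "c\<^sup>2 = c'\<^sup>2" and j: "j \<in> eqs"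
  shows "sys j (collapsed q z) = sys j (collapsed q' z')"
proof -
  have "sys (Inl e) (collapsed q z) = sys (Inl e) (collapsed q' z')" if "e \<in> E" for e
  proof -
    have "sqlen (s e) (t e) (coords q) = sqlen (s e) (t e) (coords q')"
      using eq that unfolding equivalent_iff_sqlen[OF ends] by blast
    then show ?thesis by (simp add: sys_def sqlen_coords)
  qed
  moreover have "sys (Inr (Inl w)) (collapsed q z) = 0"
    if q: "realisation q" and "w \<in> W" and z: "z = axis top c" for w q z c
  proof -
    obtain j where j: "j \<in> {1..<CARD('d)}" "w = fl j" using \<open>w \<in> W\<close> fl(3) by blast
    \<comment> \<open>Here \<open>j < CARD('d) = Suc (\<iota> top)\<close>, so coordinate
      \<open>top\<close> of \<open>fl j\<close> is pinned.\<close>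
    then have "q w $ top = 0" using q top unfolding realisation_def pinned_def by auto
    then show ?thesis using realisation_origin[OF q] z by (simp add: sys_def inner_axis)
  qed
  moreover have "(norm z)\<^sup>2 = (norm z')\<^sup>2"
    unfolding z(1,2) power2_norm_eq_inner using z(3) by (simp add: inner_axis power2_eq_square)
  ultimately show ?thesis using j assms unfolding eqs_def by (auto simp: sys_def)
qed

end

section \<open>Doubling the number of realisations\<close>

context split_setting begin

section \<open>From values of the system to edge lengths of the split graph\<close>

abbreviation conf :: "(('v, 'd) split_coord \<Rightarrow> real) \<Rightarrow> 'v \<Rightarrow> real^'d" where
  "conf \<equiv> split_conf x x1 x2"

lemma conf_old: "u \<in> V - {x} \<Longrightarrow> conf b u = pos b u"
  using splitD(7,8) by (auto simp: split_conf_def)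

lemma conf_new: "conf b x1 = pos b x + scale b *\<^sub>R dir b" "conf b x2 = pos b x - scale b *\<^sub>R dir b"
  using splitD(6) by (auto simp: split_conf_def)

lemma norm_diff_displaced:
  fixes a y z :: "real^'d"
  shows "(norm (a - (y + r *\<^sub>R z)))\<^sup>2 = (norm (a - y))\<^sup>2 + (norm (r *\<^sub>R z))\<^sup>2 - 2 * r * ((a - y) \<bullet> z)"
    and "(norm (a - (y - r *\<^sub>R z)))\<^sup>2 = (norm (a - y))\<^sup>2 + (norm (r *\<^sub>R z))\<^sup>2 + 2 * r * ((a - y) \<bullet> z)"
  unfolding power2_norm_eq_inner by (simp_all add: algebra_simps inner_commute)

lemma edge_to_neighbour:
  assumes "u \<in> N1 \<or> u \<in> N2 \<or> u \<in> W"
  shows "{x, u} \<in> E" "t {x, u} = x" "s {x, u} = u"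
proof -
  show e: "{x, u} \<in> E" using N_in[OF assms] by blast
  show "t {x, u} = x" using edge_at_x(1)[OF e] by simp
  have "{x, u} = {x, s {x, u}}" by (rule edge_at_x(2)[OF e]) simp
  moreover have "u \<noteq> x" using N_in[OF assms] by blast
  ultimately show "s {x, u} = u" by (auto simp: doubleton_eq_iff)
qed

lemma conf_neighbour: "u \<in> N1 \<or> u \<in> N2 \<or> u \<in> W \<Longrightarrow> conf b u = pos b u"
  using N_in[of u] by (intro conf_old) blast

lemma sys_Inl_neighbour:
  assumes "u \<in> N1 \<or> u \<in> N2 \<or> u \<in> W"
  shows "sys (Inl {x, u}) b = (norm (pos b u - pos b x + (of_int (side {x, u}) * scale b) *\<^sub>R dir b))\<^sup>2
    + of_int (shared {x, u}) * (norm (scale b *\<^sub>R dir b))\<^sup>2"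
  by (simp only: sys_def sum.case edge_to_neighbour[OF assms])

lemma side_shared:
  "u \<in> N1 \<Longrightarrow> side {x, u} = -1 \<and> shared {x, u} = 0"
  "u \<in> N2 \<Longrightarrow> side {x, u} = 1 \<and> shared {x, u} = 0"
  "u \<in> W \<Longrightarrow> side {x, u} = 0 \<and> shared {x, u} = 1"
  using edge_to_neighbour(3)[of u] splitD(3-5) unfolding side_def shared_def by auto

lemma sys_edge_N1:
  assumes u: "u \<in> N1" shows "sys (Inl {x, u}) b = (norm (conf b x1 - conf b u))\<^sup>2"
proof -
  have N: "u \<in> N1 \<or> u \<in> N2 \<or> u \<in> W" using u by blast
  have "conf b u - conf b x1 = pos b u - pos b x + (of_int (-1) * scale b) *\<^sub>R dir b"
    by (simp add: conf_neighbour[OF N] conf_new)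
  then show ?thesis using side_shared(1)[OF u] by (simp add: sys_Inl_neighbour[OF N] norm_minus_commute[of "conf b x1"])
qed

lemma sys_edge_N2:
  assumes u: "u \<in> N2" shows "sys (Inl {x, u}) b = (norm (conf b x2 - conf b u))\<^sup>2"
proof -
  have N: "u \<in> N1 \<or> u \<in> N2 \<or> u \<in> W" using u by blast
  have "conf b u - conf b x2 = pos b u - pos b x + (of_int 1 * scale b) *\<^sub>R dir b"
    by (simp add: conf_neighbour[OF N] conf_new)
  then show ?thesis using side_shared(2)[OF u] by (simp add: sys_Inl_neighbour[OF N] norm_minus_commute[of "conf b x2"])
qed

lemma sys_edge_W:
  assumes u: "u \<in> W"
  shows "(norm (conf b x1 - conf b u))\<^sup>2 = sys (Inl {x, u}) b - 2 * scale b * sys (Inr (Inl u)) b"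
    and "(norm (conf b x2 - conf b u))\<^sup>2 = sys (Inl {x, u}) b + 2 * scale b * sys (Inr (Inl u)) b"
proof -
  have N: "u \<in> N1 \<or> u \<in> N2 \<or> u \<in> W" using u by blast
  have W: "sys (Inl {x, u}) b = (norm (pos b u - pos b x))\<^sup>2 + (norm (scale b *\<^sub>R dir b))\<^sup>2"
    using side_shared(3)[OF u] by (simp add: sys_Inl_neighbour[OF N])
  have I: "sys (Inr (Inl u)) b = (pos b u - pos b x) \<bullet> dir b" by (simp add: sys_def)
  show "(norm (conf b x1 - conf b u))\<^sup>2 = sys (Inl {x, u}) b - 2 * scale b * sys (Inr (Inl u)) b"
  proof -
    have n: "norm (conf b x1 - conf b u) = norm (pos b u - (pos b x + scale b *\<^sub>R dir b))"
      unfolding conf_neighbour[OF N] conf_new by (rule norm_minus_commute)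
    show ?thesis unfolding n norm_diff_displaced W I ..
  qed
  show "(norm (conf b x2 - conf b u))\<^sup>2 = sys (Inl {x, u}) b + 2 * scale b * sys (Inr (Inl u)) b"
  proof -
    have n: "norm (conf b x2 - conf b u) = norm (pos b u - (pos b x - scale b *\<^sub>R dir b))"
      unfolding conf_neighbour[OF N] conf_new by (rule norm_minus_commute)
    show ?thesis unfolding n norm_diff_displaced W I ..
  qed
qed

lemma sys_edge_old:
  assumes e: "e \<in> E" "x \<notin> e" shows "sys (Inl e) b = (norm (conf b (s e) - conf b (t e)))\<^sup>2"
proof -
  note st = edge_endsD[OF ends e(1)]
  have "s e \<in> e" by (rule subsetD[OF equalityD2[OF st(1)]]) (rule insertI1)
  moreover have "t e \<in> e" by (rule subsetD[OF equalityD2[OF st(1)]]) (rule insertI2[OF insertI1])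
  ultimately have "s e \<in> V - {x}" "t e \<in> V - {x}" using st(3,4) e(2) by blast+
  then show ?thesis using e(2) by (simp add: sys_def side_def shared_def conf_old)
qed

lemma equal_sys_imp_equivalent:
  assumes eq: "\<And>j. j \<in> eqs \<Longrightarrow> sys j b = sys j b'"
  shows "equivalent E' (conf b) (conf b')"
proof -
  let ?good = "\<lambda>u v. norm (conf b u - conf b v) = norm (conf b' u - conf b' v)"
  have goodI: "?good u v" if "(norm (conf b u - conf b v))\<^sup>2 = (norm (conf b' u - conf b' v))\<^sup>2" for u v
    using that by (rule power2_eq_imp_eq) simp_all
  have sc: "scale b = scale b'" using eq[of "Inr (Inr False)"] by (simp add: eqs_def sys_def)
  have nd: "norm (dir b) = norm (dir b')"
    using eq[of "Inr (Inr True)"] by (simp add: eqs_def sys_def)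
  have E: "sys (Inl e) b = sys (Inl e) b'" if "e \<in> E" for e using that by (intro eq) (simp add: eqs_def)
  have W: "sys (Inr (Inl w)) b = sys (Inr (Inl w)) b'" if "w \<in> W" for w using that by (intro eq) (simp add: eqs_def)
  have g1: "?good (s e) (t e)" if "e \<in> E" "x \<notin> e" for e
    using E[OF that(1)] unfolding sys_edge_old[OF that] by (rule goodI)
  have EN: "sys (Inl {x, u}) b = sys (Inl {x, u}) b'" if "u \<in> N1 \<or> u \<in> N2 \<or> u \<in> W" for u
    by (rule E[OF edge_to_neighbour(1)[OF that]])
  have g2: "?good x1 u" if "u \<in> N1" for u
    using EN[of u] that unfolding sys_edge_N1[OF that] by (intro goodI) blast
  have g3: "?good x2 u" if "u \<in> N2" for u
    using EN[of u] that unfolding sys_edge_N2[OF that] by (intro goodI) blast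
  have g4: "?good x1 u" "?good x2 u" if "u \<in> W" for u
  proof -
    have "sys (Inl {x, u}) b = sys (Inl {x, u}) b'" using EN[of u] that by blast
    then show "?good x1 u" "?good x2 u"
      using W[OF that] sc by (auto intro!: goodI simp only: sys_edge_W[OF that])
  qed
  have g5: "?good x1 x2"
  proof -
    have "conf c x1 - conf c x2 = (2 * scale c) *\<^sub>R dir c" for c
      unfolding conf_new by (simp add: scaleR_2[symmetric])
    then show ?thesis using sc nd by simp
  qed
  have good_sets: "\<exists>a c. e = {a, c} \<and> ?good a c" if "e \<in> E'" for e
  proof -
    consider "e \<in> E" "x \<notin> e" | u where "e = {x1, u}" "u \<in> N1" | u where "e = {x2, u}" "u \<in> N2"
      | u where "e = {x1, u}" "u \<in> W" | u where "e = {x2, u}" "u \<in> W" | "e = {x1, x2}"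
      using \<open>e \<in> E'\<close> unfolding splitD(10) by blast
    then show ?thesis
    proof cases
      case 1
      show ?thesis
        by (intro exI conjI, rule edge_endsD(1)[OF ends 1(1)], rule g1[OF 1])
    next
      case (2 u) show ?thesis by (intro exI conjI, rule 2(1), rule g2[OF 2(2)])
    next
      case (3 u) show ?thesis by (intro exI conjI, rule 3(1), rule g3[OF 3(2)])
    next
      case (4 u) show ?thesis by (intro exI conjI, rule 4(1), rule g4(1)[OF 4(2)])
    next
      case (5 u) show ?thesis by (intro exI conjI, rule 5(1), rule g4(2)[OF 5(2)])
    next
      case 6 show ?thesis by (intro exI conjI, rule 6, rule g5)
    qed
  qed
  show ?thesis unfolding equivalent_def
  proof (intro allI impI)
    fix u v assume "{u, v} \<in> E'"
    then obtain a c where ac: "{u, v} = {a, c}" "?good a c" using good_sets by blast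
    then have "(u = a \<and> v = c) \<or> (u = c \<and> v = a)" by (simp only: doubleton_eq_iff)
    then show "?good u v" using ac(2) by (elim disjE conjE) (simp_all add: norm_minus_commute)
  qed
qed

text \<open>Being polynomial, such a function extends its separating power to scale 0, where
  \<open>conf\<close> no longer sees the direction. The scale is excluded from being 0 because some
  invariants arise by dividing by it.\<close>

definition invariant :: "((('v, 'd) split_coord \<Rightarrow> real) \<Rightarrow> real) \<Rightarrow> bool" where
  "invariant F \<longleftrightarrow> ratpoly (split_vars V) F \<and>
    (\<forall>b b'. congruent V' (conf b) (conf b') \<and> scale b = scale b' \<and> scale b \<noteq> 0 \<longrightarrow> F b = F b')"

text \<open>The vertex \<open>x\<close> need not survive the split, so \<open>x1\<close> takes its
  place; the displacement vanishes at collapsed points.\<close>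

lemma invariant_distance:
  assumes uv: "u \<in> V" "v \<in> V"
  shows "\<exists>F. invariant F \<and> (\<forall>q z. F (collapsed q z) = (norm (q u - q v))\<^sup>2)"
proof -
  define lift where "lift = (\<lambda>u. if u = x then x1 else u)"
  define F :: "(('v, 'd) split_coord \<Rightarrow> real) \<Rightarrow> real"
    where "F = (\<lambda>b. (norm (conf b (lift u) - conf b (lift v)))\<^sup>2)"
  have conf: "conf b (lift w) $ i = pos b w $ i + (if w = x then scale b * dir b $ i else 0)" if "w \<in> V" for b w i
    using that conf_old[of w b] by (simp add: lift_def conf_new)
  have "ratpoly (split_vars V) F"
    unfolding F_def norm2_sum vector_minus_component conf[OF uv(1)] conf[OF uv(2)]
    using uv by (intro ratpoly_split_intros ratpoly_if ratpoly_0)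
  moreover have "F b = F b'" if "congruent V' (conf b) (conf b')" for b b'
  proof -
    have "lift w \<in> V'" if "w \<in> V" for w using that splitD(9) by (auto simp: lift_def)
    then show ?thesis using congruent_dist[OF that] uv unfolding F_def by simp
  qed
  moreover have "F (collapsed q z) = (norm (q u - q v))\<^sup>2" for q z
    unfolding F_def norm2_sum vector_minus_component conf[OF uv(1)] conf[OF uv(2)] by (simp cong: if_cong)
  ultimately show ?thesis unfolding invariant_def by blast
qed

text \<open>Multiplied by \<open>4 * scale b\<close>, this is the difference of the squared
  distances from \<open>vd\<close> to \<open>x2\<close> and \<open>x1\<close>. At a collapsed point
  with direction \<open>axis top c\<close> it is \<open>c\<close> times coordinate
  \<open>top\<close> of \<open>vd\<close>, so it separates the two normals.\<close>

lemma invariant_side: "invariant (\<lambda>b. (pos b vd - pos b x) \<bullet> dir b)"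
proof -
  let ?F = "\<lambda>b :: ('v, 'd) split_coord \<Rightarrow> real. (pos b vd - pos b x) \<bullet> dir b"
  have vdx: "vd \<in> V - {x}"
  proof -
    have "x \<in> fl ` {..<CARD('d)}" using fl(2) by (intro image_eqI[of _ _ 0]) auto
    then show ?thesis using vd by blast
  qed
  have "ratpoly (split_vars V) ?F"
    unfolding inner_sum vector_minus_component using vd(1) splitD(1)
    by (intro ratpoly_split_intros)
  moreover have "?F b = ?F b'" if c: "congruent V' (conf b) (conf b')" and sc: "scale b = scale b'" "scale b \<noteq> 0" for b b'
  proof -
    have F: "(norm (conf b vd - conf b x2))\<^sup>2 - (norm (conf b vd - conf b x1))\<^sup>2 = 4 * scale b * ?F b" for b
      unfolding conf_old[OF vdx] conf_new norm_diff_displaced by simp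
    have "x1 \<in> V'" "x2 \<in> V'" "vd \<in> V'" using splitD(9) vdx by auto
    then have "4 * scale b * ?F b = 4 * scale b' * ?F b'"
      unfolding F[symmetric] using congruent_dist[OF c] by simp
    then show ?thesis using sc by simp
  qed
  ultimately show ?thesis unfolding invariant_def by blast
qed

text \<open>A vector orthogonal to all positions is annihilated by the flag rows, with
  \<open>q vd\<close> as the last row.\<close>

lemma realisation_spans:
  assumes "realisation q" shows "span ((\<lambda>v. q v - q x) ` V) = UNIV"
proof (rule ccontr)
  let ?S = "(\<lambda>v. q v - q x) ` V"
  assume "span ?S \<noteq> UNIV"
  then have "dim (span ?S) < DIM(real^'d)" by (metis dim_eq_full dim_span dim_subset_UNIV le_neq_implies_less span_span)
  then obtain z where z: "z \<noteq> 0" "\<And>y. y \<in> span (span ?S) \<Longrightarrow> orthogonal z y"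
    using orthogonal_to_subspace_exists[of "span ?S"] by blast
  have zero: "q v \<bullet> z = 0" if "v \<in> V" for v
  proof -
    have "q v - q x \<in> span (span ?S)" using that by (intro span_base imageI)
    then have "z \<bullet> (q v - q x) = 0" using z(2) unfolding orthogonal_def by blast
    then show ?thesis using realisation_origin[OF assms] by (simp add: inner_commute)
  qed
  have "z = 0"
  proof (rule triangular_kernel[OF \<iota>, where r = "\<lambda>n. if Suc n < CARD('d) then q (fl (Suc n)) else q vd"])
    show "(if Suc n < CARD('d) then q (fl (Suc n)) else q vd) $ i = 0" if "n < \<iota> i" "n < CARD('d)" for n i
      using flag_rows(1)[OF assms that] .
    show "(if Suc (\<iota> i) < CARD('d) then q (fl (Suc (\<iota> i))) else q vd) $ i \<noteq> 0" for i
      using flag_rows(2)[OF assms realisation_regular(3)[OF assms]] .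
    show "(if Suc n < CARD('d) then q (fl (Suc n)) else q vd) \<bullet> z = 0" for n
      using zero vd(1) fl_in by auto
  qed
  then show False using z(1) by blast
qed

lemma distinguishing_invariant:
  assumes q: "realisation q" "realisation q'"
    and ne: "\<not> congruent V q q' \<or> (q = q' \<and> c \<noteq> c')"
  shows "\<exists>F. invariant F \<and> F (collapsed q (axis top c)) \<noteq> F (collapsed q' (axis top c'))"
  using ne
proof
  assume "\<not> congruent V q q'"
  then obtain u v where uv: "u \<in> V" "v \<in> V" "norm (q' u - q' v) \<noteq> norm (q u - q v)"
    using equal_distances_imp_congruent[OF splitD(1) realisation_spans[OF q(1)]] by blast
  obtain F where F: "invariant F" "\<And>q z. F (collapsed q z) = (norm (q u - q v))\<^sup>2"
    using invariant_distance[OF uv(1,2)] by blast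
  have "(norm (q u - q v))\<^sup>2 \<noteq> (norm (q' u - q' v))\<^sup>2" using uv(3) by simp
  then show ?thesis using F by metis
next
  assume "q = q' \<and> c \<noteq> c'"
  then show ?thesis using invariant_side realisation_regular(3)[OF q(1)] realisation_origin[OF q(1)]
    by (intro exI[of _ "\<lambda>b. (pos b vd - pos b x) \<bullet> dir b"]) (auto simp: inner_axis)
qed

section \<open>Generic frameworks near a collapsed one\<close>

lemma generic_approximation:
  assumes "\<epsilon> > 0"
  shows "\<exists>b. (\<forall>k\<in>split_vars V. \<bar>b k - collapsed q z k\<bar> < \<epsilon>) \<and> scale b \<noteq> 0 \<and> generic V' (conf b)"
proof -
  define \<tau> where "\<tau> = min 1 (\<epsilon> / 2)"
  \<comment> \<open>Recovering the direction divides by \<open>2 * \<tau>\<close>, which magnifies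
    an error in the positions of \<open>x1\<close> and \<open>x2\<close>; \<open>\<eta>\<close>
    compensates for this.\<close>
  define \<eta> where "\<eta> = \<epsilon> * \<tau> / 2"
  have \<tau>: "0 < \<tau>" "\<tau> < \<epsilon>" "\<tau> \<le> 1" using assms by (auto simp: \<tau>_def)
  have \<eta>: "0 < \<eta>" "\<eta> < \<epsilon>" using assms \<tau> mult_left_le[of \<tau> \<epsilon>] by (auto simp: \<eta>_def)
  define p where "p = conf ((collapsed q z)(Inr None := \<tau>))"
  have pos0: "pos ((collapsed q z)(Inr None := \<tau>)) = q" "dir ((collapsed q z)(Inr None := \<tau>)) = z"
    "scale ((collapsed q z)(Inr None := \<tau>)) = \<tau>"
    by (auto simp: pos_def dir_def scale_def collapsed_def vec_eq_iff)
  have "finite (V' \<times> (UNIV :: 'd set))" using fin(1) splitD(9) by simp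
  then obtain y where y: "alg_indep_Q (V' \<times> UNIV) y" "\<And>k. \<bar>y k - coords p k\<bar> < \<eta>"
    using alg_indep_dense[OF _ \<eta>(1)] by blast
  \<comment> \<open>Inverts \<open>conf\<close> at scale \<open>\<tau>\<close>: \<open>x\<close> is
    the midpoint of \<open>x1\<close> and \<open>x2\<close>, and the direction is their difference
    over \<open>2 * \<tau>\<close>.\<close>
  define b :: "('v, 'd) split_coord \<Rightarrow> real" where "b = (\<lambda>k. case k of
      Inl (v, i) \<Rightarrow> if v = x then (y (x1, i) + y (x2, i)) / 2 else y (v, i)
    | Inr (Some i) \<Rightarrow> (y (x1, i) - y (x2, i)) / (2 * \<tau>) | Inr None \<Rightarrow> \<tau>)"
  have sb: "scale b = \<tau>" by (simp add: scale_def b_def)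
  have conf: "conf b v $ i = y (v, i)" if v: "v \<in> V'" for v i
  proof -
    consider "v = x1" | "v = x2" | "v \<in> V - {x}" using v splitD(9) by blast
    then show ?thesis
    proof cases
      case 1 then show ?thesis using \<tau>(1) by (simp add: conf_new pos_def dir_def scale_def b_def field_simps)
    next
      case 2 then show ?thesis using \<tau>(1) by (simp add: conf_new pos_def dir_def scale_def b_def field_simps)
    next
      case 3 then show ?thesis by (simp add: conf_old pos_def b_def)
    qed
  qed
  have y1: "\<bar>y (x1, i) - (q x $ i + \<tau> * z $ i)\<bar> < \<eta>" for i
    using y(2)[of "(x1, i)"] by (simp add: p_def conf_new pos0)
  have y2: "\<bar>y (x2, i) - (q x $ i - \<tau> * z $ i)\<bar> < \<eta>" for i
    using y(2)[of "(x2, i)"] by (simp add: p_def conf_new pos0)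
  have "\<bar>b k - collapsed q z k\<bar> < \<epsilon>" if k: "k \<in> split_vars V" for k
  proof -
    consider v i where "k = Inl (v, i)" "v \<in> V" | i where "k = Inr (Some i)" | "k = Inr None"
      using k unfolding split_vars_def by (auto, metis not_None_eq)
    then show ?thesis
    proof cases
      case (1 v i)
      show ?thesis
      proof (cases "v = x")
        case True
        have "y (x1, i) + y (x2, i) - 2 * q x $ i < 2 * \<eta>" "2 * q x $ i - (y (x1, i) + y (x2, i)) < 2 * \<eta>"
          using y1[of i] y2[of i] unfolding abs_less_iff by (elim conjE, simp)+
        then have "\<bar>(y (x1, i) + y (x2, i)) / 2 - q x $ i\<bar> < \<eta>" unfolding abs_less_iff by (simp add: field_simps)
        then show ?thesis using True 1 \<eta>(2) by (simp add: b_def collapsed_def)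
      next
        case False
        then have "\<bar>y (v, i) - q v $ i\<bar> < \<eta>" using y(2)[of "(v, i)"] 1 by (simp add: p_def conf_old pos0)
        then show ?thesis using False 1 \<eta>(2) by (simp add: b_def collapsed_def)
      qed
    next
      case (2 i)
      have "\<bar>(y (x1, i) - y (x2, i)) - 2 * \<tau> * z $ i\<bar> < \<epsilon> * \<tau>"
      proof -
        have "2 * \<eta> = \<epsilon> * \<tau>" by (simp add: \<eta>_def)
        moreover have "y (x1, i) - y (x2, i) - 2 * (\<tau> * z $ i) < 2 * \<eta>"
          "2 * (\<tau> * z $ i) - (y (x1, i) - y (x2, i)) < 2 * \<eta>"
          using y1[of i] y2[of i] unfolding abs_less_iff by (elim conjE, simp)+
        ultimately show ?thesis unfolding abs_less_iff by simp
      qed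
      moreover have "(y (x1, i) - y (x2, i)) / (2 * \<tau>) - z $ i = ((y (x1, i) - y (x2, i)) - 2 * \<tau> * z $ i) / (2 * \<tau>)"
        using \<tau>(1) by (simp add: field_simps)
      moreover have "\<epsilon> * \<tau> / (2 * \<tau>) < \<epsilon>" using \<tau>(1) assms by simp
      ultimately have "\<bar>(y (x1, i) - y (x2, i)) / (2 * \<tau>) - z $ i\<bar> < \<epsilon>"
        using \<tau>(1) by (simp add: abs_divide) (simp add: divide_less_eq)
      then show ?thesis using 2 by (simp add: b_def collapsed_def)
    next
      case 3
      then show ?thesis using \<tau> by (simp add: b_def collapsed_def)
    qed
  qed
  moreover have "generic V' (conf b)"
    unfolding generic_iff using y(1) alg_indep_cong[of "V' \<times> UNIV" "coords (conf b)" y] conf by auto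
  ultimately show ?thesis using sb \<tau>(1) by (intro exI[of _ b]) auto
qed

lemma class_representative:
  fixes p :: "'v \<Rightarrow> real^'d"
  assumes "generic V p" "equivalent E p q"
  shows "\<exists>q'. realisation q' \<and> equivalent E p q' \<and> {r. congruent V q r} = {r. congruent V q' r}"
proof -
  obtain T where T: "isometry T" "pinned fl \<iota> (\<lambda>v. T (q v))"
    using exists_pinning_isometry[OF \<iota>] by blast
  have "equivalent E p (\<lambda>v. T (q v))" using assms(2) equivalent_isometry[OF T(1)] by blast
  moreover have "congruent V q (\<lambda>v. T (q v))" using T(1) unfolding congruent_def by blast
  ultimately show ?thesis using T(2) assms(1) congruent_classes_eq[of V q "\<lambda>v. T (q v)"]
    unfolding realisation_def by blast
qed

text \<open>Phrased for all smaller \<open>\<delta>\<close> so that finitely many pairs can share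
  one radius by \<open>finite_uniform_bound\<close>.\<close>

lemma separated_neighbourhoods:
  assumes F: "invariant F" and ne: "F a \<noteq> F a'"
  shows "\<exists>\<epsilon>>0. \<forall>\<delta>. 0 < \<delta> \<and> \<delta> \<le> \<epsilon> \<longrightarrow> (\<forall>b b'. (\<forall>k\<in>split_vars V. \<bar>b k - a k\<bar> < \<delta>) \<and>
    (\<forall>k\<in>split_vars V. \<bar>b' k - a' k\<bar> < \<delta>) \<and> scale b = scale b' \<and> scale b \<noteq> 0 \<longrightarrow>
    \<not> congruent V' (conf b) (conf b'))"
proof -
  define \<omega> where "\<omega> = \<bar>F a - F a'\<bar> / 2"
  have \<omega>: "\<omega> > 0" using ne by (simp add: \<omega>_def)
  have rp: "ratpoly (split_vars V) F" using F by (simp add: invariant_def)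
  obtain \<epsilon>1 where e1: "\<epsilon>1 > 0" "\<And>b. (\<forall>k\<in>split_vars V. \<bar>b k - a k\<bar> < \<epsilon>1) \<Longrightarrow> \<bar>F b - F a\<bar> < \<omega>"
    using ratpoly_continuous_at[OF rp \<omega>] by blast
  obtain \<epsilon>2 where e2: "\<epsilon>2 > 0" "\<And>b. (\<forall>k\<in>split_vars V. \<bar>b k - a' k\<bar> < \<epsilon>2) \<Longrightarrow> \<bar>F b - F a'\<bar> < \<omega>"
    using ratpoly_continuous_at[OF rp \<omega>] by blast
  show ?thesis
  proof (intro exI[of _ "min \<epsilon>1 \<epsilon>2"] conjI allI impI notI)
    show "0 < min \<epsilon>1 \<epsilon>2" using e1 e2 by simp
    fix \<delta> b b'
    assume d: "0 < \<delta> \<and> \<delta> \<le> min \<epsilon>1 \<epsilon>2"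
      and b: "(\<forall>k\<in>split_vars V. \<bar>b k - a k\<bar> < \<delta>) \<and> (\<forall>k\<in>split_vars V. \<bar>b' k - a' k\<bar> < \<delta>) \<and>
        scale b = scale b' \<and> scale b \<noteq> 0" and c: "congruent V' (conf b) (conf b')"
    have "\<bar>F b - F a\<bar> < \<omega>" using b d by (intro e1(2)) force
    moreover have "\<bar>F b' - F a'\<bar> < \<omega>" using b d by (intro e2(2)) force
    moreover have "F b = F b'" using F b c unfolding invariant_def by blast
    moreover have "\<bar>F a - F a'\<bar> \<le> \<bar>F b - F a\<bar> + \<bar>F b - F a'\<bar>" by linarith
    ultimately show False unfolding \<omega>_def by simp
  qed
qed

text \<open>Finite sets of classes are doubled because the number of classes may be infinite a
  priori. The radii are chosen backwards: \<open>\<epsilon>\<close> separates the collapsed points,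
  \<open>\<delta>\<close> makes the system solvable within \<open>\<epsilon>\<close> of each of
  them, and \<open>\<epsilon>'\<close> keeps the values at a generic framework near one of them
  within \<open>\<delta>\<close>. Those values are then realised near all of them.\<close>

lemma twice_classes_le:
  fixes p :: "'v \<Rightarrow> real^'d"
  assumes gen: "generic V p" and A: "finite A" "A \<subseteq> (\<lambda>q. {q'. congruent V q q'}) ` {q. equivalent E p q}"
  shows "enat (2 * card A) \<le> r_d TYPE('d) V' E'"
proof (cases "A = {}")
  case False
  let ?K = "split_vars V :: ('v, 'd) split_coord set"
  have "\<forall>C\<in>A. \<exists>q. realisation q \<and> equivalent E p q \<and> C = {r. congruent V q r}"
    using A(2) class_representative[OF gen] by blast
  then obtain rep where "\<forall>C\<in>A. realisation (rep C) \<and> equivalent E p (rep C) \<and> C = {r. congruent V (rep C) r}"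
    unfolding bchoice_iff by (rule exE)
  then have rep: "\<And>C. C \<in> A \<Longrightarrow> realisation (rep C) \<and> equivalent E p (rep C)"
    and rep_class: "\<And>C. C \<in> A \<Longrightarrow> C = {r. congruent V (rep C) r}" by simp_all
  \<comment> \<open>A class together with the sign of the normal: one index for each collapsed
    point.\<close>
  define I where "I = A \<times> {1, -1 :: real}"
  define base where "base = (\<lambda>(C, c). collapsed (rep C) (axis top c))"
  have I: "finite I" "card I = 2 * card A" using A(1) by (auto simp: I_def)
  define near where "near = (\<lambda>\<epsilon> b a. \<forall>k\<in>?K. \<bar>b k - a k :: real\<bar> < \<epsilon>)"
  have "\<exists>\<epsilon>>0. \<forall>ij\<in>{ij \<in> I \<times> I. fst ij \<noteq> snd ij}. \<forall>b b'. near \<epsilon> b (base (fst ij)) \<and> near \<epsilon> b' (base (snd ij)) \<and>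
      scale b = scale b' \<and> scale b \<noteq> 0 \<longrightarrow> \<not> congruent V' (conf b) (conf b')"
  proof (rule finite_uniform_bound)
    show "finite {ij \<in> I \<times> I. fst ij \<noteq> snd ij}" using I(1) by simp
    fix ij assume ij: "ij \<in> {ij \<in> I \<times> I. fst ij \<noteq> snd ij}"
    obtain C c C' c' where eq: "ij = ((C, c), (C', c'))" by (metis surj_pair)
    then have C: "C \<in> A" "C' \<in> A" "(C, c) \<noteq> (C', c')" using ij by (auto simp: I_def)
    have "\<not> congruent V (rep C) (rep C') \<or> (rep C = rep C' \<and> c \<noteq> c')"
    proof (cases "C = C'")
      case False
      have "C = C'" if "congruent V (rep C) (rep C')"
        using trans[OF trans[OF rep_class[OF C(1)] congruent_classes_eq[OF that]] rep_class[OF C(2), symmetric]] .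
      then show ?thesis using False by blast
    qed (use C(3) in simp)
    then obtain F where "invariant F" "F (base (fst ij)) \<noteq> F (base (snd ij))"
      using distinguishing_invariant[of "rep C" "rep C'" c c'] rep[OF C(1)] rep[OF C(2)]
      unfolding eq base_def fst_conv snd_conv prod.case by blast
    then show "\<exists>\<epsilon>>0. \<forall>\<delta>. 0 < \<delta> \<and> \<delta> \<le> \<epsilon> \<longrightarrow> (\<forall>b b'. near \<delta> b (base (fst ij)) \<and> near \<delta> b' (base (snd ij)) \<and>
      scale b = scale b' \<and> scale b \<noteq> 0 \<longrightarrow> \<not> congruent V' (conf b) (conf b'))"
      unfolding near_def by (rule separated_neighbourhoods)
  qed
  then obtain \<epsilon> where \<epsilon>: "\<epsilon> > 0" and sep: "\<And>i j b b'. i \<in> I \<Longrightarrow> j \<in> I \<Longrightarrow> i \<noteq> j \<Longrightarrow>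
      near \<epsilon> b (base i) \<Longrightarrow> near \<epsilon> b' (base j) \<Longrightarrow> scale b = scale b' \<Longrightarrow> scale b \<noteq> 0 \<Longrightarrow>
      \<not> congruent V' (conf b) (conf b')" by fastforce
  have "\<exists>\<delta>>0. \<forall>i\<in>I. \<forall>r. (\<forall>j\<in>eqs. \<bar>r j - sys j (base i)\<bar> < \<delta>) \<longrightarrow>
      (\<exists>b. near \<epsilon> b (base i) \<and> (\<forall>j\<in>eqs. sys j b = r j))"
  proof (rule finite_uniform_bound[OF I(1)])
    fix i assume "i \<in> I"
    then obtain C c where i: "i = (C, c)" "C \<in> A" "c \<noteq> 0" by (auto simp: I_def)
    have reg: "regular_at eqs sys (base i)"
      using regular_collapsed[OF _ refl i(3)] rep[OF i(2)] by (simp add: base_def i(1))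
    obtain \<delta> where \<delta>: "\<delta> > 0" "\<And>r. \<forall>j\<in>eqs. \<bar>r j - sys j (base i)\<bar> < \<delta> \<Longrightarrow>
        \<exists>b. (\<forall>k. \<bar>b k - base i k\<bar> < \<epsilon>) \<and> (\<forall>j\<in>eqs. sys j b = r j)"
      using regular_locally_solvable[OF finite_vars finite_eqs ratpoly_sys reg \<epsilon>] by blast
    show "\<exists>\<epsilon>'>0. \<forall>\<delta>. 0 < \<delta> \<and> \<delta> \<le> \<epsilon>' \<longrightarrow> (\<forall>r. (\<forall>j\<in>eqs. \<bar>r j - sys j (base i)\<bar> < \<delta>) \<longrightarrow>
      (\<exists>b. near \<epsilon> b (base i) \<and> (\<forall>j\<in>eqs. sys j b = r j)))"
    proof (intro exI[of _ \<delta>] conjI allI impI)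
      fix \<delta>' r assume "0 < \<delta>' \<and> \<delta>' \<le> \<delta>" "\<forall>j\<in>eqs. \<bar>r j - sys j (base i)\<bar> < \<delta>'"
      then have "\<forall>j\<in>eqs. \<bar>r j - sys j (base i)\<bar> < \<delta>" by force
      then show "\<exists>b. near \<epsilon> b (base i) \<and> (\<forall>j\<in>eqs. sys j b = r j)" using \<delta>(2) unfolding near_def by blast
    qed (rule \<delta>(1))
  qed
  then obtain \<delta> where \<delta>: "\<delta> > 0" and solve: "\<And>i r. i \<in> I \<Longrightarrow> \<forall>j\<in>eqs. \<bar>r j - sys j (base i)\<bar> < \<delta> \<Longrightarrow>
      \<exists>b. near \<epsilon> b (base i) \<and> (\<forall>j\<in>eqs. sys j b = r j)" by blast
  obtain C0 where C0: "C0 \<in> A" using False by blast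
  let ?a = "collapsed (rep C0) (axis top 1)"
  have "\<exists>\<epsilon>'>0. \<forall>j\<in>eqs. \<forall>b. near \<epsilon>' b ?a \<longrightarrow> \<bar>sys j b - sys j ?a\<bar> < \<delta>"
  proof (rule finite_uniform_bound[OF finite_eqs])
    fix j assume "j \<in> eqs"
    then obtain \<epsilon>' where e: "\<epsilon>' > 0" "\<And>b. near \<epsilon>' b ?a \<Longrightarrow> \<bar>sys j b - sys j ?a\<bar> < \<delta>"
      using ratpoly_continuous_at[OF ratpoly_sys \<delta>, of j ?a] unfolding near_def by blast
    have "near \<epsilon>' b ?a" if "near \<delta>' b ?a" "\<delta>' \<le> \<epsilon>'" for b \<delta>' using that unfolding near_def by force
    then show "\<exists>\<epsilon>'>0. \<forall>\<delta>'. 0 < \<delta>' \<and> \<delta>' \<le> \<epsilon>' \<longrightarrow> (\<forall>b. near \<delta>' b ?a \<longrightarrow> \<bar>sys j b - sys j ?a\<bar> < \<delta>)"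
      using e by (intro exI[of _ \<epsilon>']) blast
  qed
  then obtain \<epsilon>' where \<epsilon>': "\<epsilon>' > 0" "\<And>j b. j \<in> eqs \<Longrightarrow> near \<epsilon>' b ?a \<Longrightarrow> \<bar>sys j b - sys j ?a\<bar> < \<delta>" by blast
  obtain b where b: "near \<epsilon>' b ?a" "scale b \<noteq> 0" "generic V' (conf b)"
    using generic_approximation[OF \<epsilon>'(1)] unfolding near_def by blast
  have "\<forall>i\<in>I. \<exists>b'. near \<epsilon> b' (base i) \<and> (\<forall>j\<in>eqs. sys j b' = sys j b)"
  proof
    fix i assume i: "i \<in> I"
    then obtain C c where Cc: "i = (C, c)" "C \<in> A" "c\<^sup>2 = 1" by (auto simp: I_def)
    have "equivalent E (rep C0) (rep C)" using rep[OF C0] rep[OF Cc(2)] unfolding equivalent_def by simp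
    then have "sys j ?a = sys j (base i)" if "j \<in> eqs" for j
      unfolding base_def Cc(1) prod.case
      using sys_collapsed_eq[OF _ _ _ refl refl _ that] rep[OF C0] rep[OF Cc(2)] Cc(3) by simp
    then have "\<forall>j\<in>eqs. \<bar>sys j b - sys j (base i)\<bar> < \<delta>" using \<epsilon>'(2) b(1) by metis
    then show "\<exists>b'. near \<epsilon> b' (base i) \<and> (\<forall>j\<in>eqs. sys j b' = sys j b)" by (rule solve[OF i])
  qed
  then obtain sol where sol: "\<And>i. i \<in> I \<Longrightarrow> near \<epsilon> (sol i) (base i) \<and> (\<forall>j\<in>eqs. sys j (sol i) = sys j b)"
    unfolding bchoice_iff by blast
  have sc: "scale (sol i) = scale b" if "i \<in> I" for i
  proof -
    have "sys (Inr (Inr False)) (sol i) = sys (Inr (Inr False)) b" using sol[OF that] by (auto simp: eqs_def)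
    then show ?thesis by (simp add: sys_def)
  qed
  define cls where "cls = (\<lambda>i. {q'. congruent V' (conf (sol i)) q'})"
  let ?X = "(\<lambda>q. {q'. congruent V' q q'}) ` {q. equivalent E' (conf b) q}"
  have "cls ` I \<subseteq> ?X"
    using equal_sys_imp_equivalent[of b] sol unfolding cls_def by (auto intro!: imageI)
  moreover have "inj_on cls I"
  proof (rule inj_onI, rule ccontr)
    fix i j assume ij: "i \<in> I" "j \<in> I" "cls i = cls j" "i \<noteq> j"
    have "conf (sol j) \<in> cls j" by (simp add: cls_def congruent_refl)
    then have "congruent V' (conf (sol i)) (conf (sol j))" using ij(3) by (auto simp: cls_def)
    then show False using sep[OF ij(1,2,4)] sol ij sc b(2) by metis
  qed
  then have "card (cls ` I) = 2 * card A" using I(2) by (simp add: card_image)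
  ultimately have "enat (2 * card A) \<le> ecard ?X"
    unfolding ecard_def using card_mono[of ?X "cls ` I"] by auto
  also have "\<dots> = num_classes V' E' (conf b)" by (simp add: num_classes_def)
  also have "\<dots> \<le> r_d TYPE('d) V' E'" unfolding r_d_def using b(3) by (intro SUP_upper) simp
  finally show ?thesis .
qed (simp add: zero_enat_def[symmetric])

end

theorem theorem4p13:
  fixes V V' :: "'v set" and E E' :: "'v set set"
    and x x1 x2 :: 'v and N1 N2 W :: "'v set"
  assumes "simple_graph V E"
    and "minimally_d_rigid TYPE('d::finite) V E"
    and "card V \<ge> CARD('d) + 1"
    and "vertex_split CARD('d) V E x N1 N2 W x1 x2 V' E'"
  shows "r_d TYPE('d) V' E' \<ge> 2 * r_d TYPE('d) V E"
proof -
  obtain s t where st: "edge_ends V E s t" "\<And>e. e \<in> E \<Longrightarrow> x \<in> e \<Longrightarrow> t e = x"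
    using simple_graph_edge_ends[OF assms(1), of x] by blast
  have W: "finite W" "card W = CARD('d) - 1" "x \<in> V" and WN: "W \<subseteq> neighbours E x"
    using assms(4) unfolding vertex_split_def by blast+
  have xW: "x \<notin> W"
  proof
    assume "x \<in> W"
    then have "{x, x} \<in> E" using WN unfolding neighbours_def by blast
    then show False using assms(1) unfolding simple_graph_def by (auto simp: doubleton_eq_iff)
  qed
  obtain \<iota> where "bij_betw \<iota> (UNIV :: 'd set) {0..<CARD('d)}"
    using ex_bij_betw_finite_nat[of "UNIV :: 'd set"] by auto
  then have \<iota>: "bij_betw \<iota> (UNIV :: 'd set) {..<CARD('d)}" by (simp add: atLeast0LessThan)
  have "CARD('d) - 1 \<in> {..<CARD('d)}" by simp
  then obtain top where top: "Suc (\<iota> top) = CARD('d)"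
    using \<iota> by (metis Suc_pred' bij_betw_def imageE zero_less_card_finite)
  obtain g where g: "bij_betw g {1..<CARD('d)} W"
    using W(1,2) finite_same_card_bij[of "{1..<CARD('d)}" W] by auto
  define fl where "fl = (\<lambda>j. if j = 0 then x else g j)"
  have split: "{..<CARD('d)} = insert 0 {1..<CARD('d)}" by auto
  have flW: "fl ` {1..<CARD('d)} = W" using g by (auto simp: fl_def bij_betw_def)
  have "inj_on fl {1..<CARD('d)}" using g by (auto simp: fl_def bij_betw_def inj_on_def)
  then have fl: "inj_on fl {..<CARD('d)}" unfolding split using flW xW by (auto simp: fl_def)
  have "card (fl ` {..<CARD('d)}) \<le> CARD('d)" using card_image_le[of "{..<CARD('d)}" fl] by simp
  \<comment> \<open>The flag has at most \<open>CARD('d)\<close> vertices, so the bound on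
    \<open>card V\<close> leaves a vertex for \<open>vd\<close>.\<close>
  then have "\<not> V \<subseteq> fl ` {..<CARD('d)}" using assms(3) card_mono[of "fl ` {..<CARD('d)}" V] by auto
  then obtain vd where vd: "vd \<in> V" "vd \<notin> fl ` {..<CARD('d)}" by blast
  interpret split_setting V E x N1 N2 W x1 x2 V' E' s t fl \<iota> vd top
    by unfold_locales (use assms st \<iota> fl flW vd top in \<open>auto simp: fl_def\<close>)
  show ?thesis
  proof (cases "r_d TYPE('d) V' E'")
    case (enat N)
    have bound: "2 * card A \<le> N"
      if "generic V p" "finite A" "A \<subseteq> (\<lambda>q. {q'. congruent V q q'}) ` {q. equivalent E p q}"
      for p :: "'v \<Rightarrow> real^'d" and A
      using twice_classes_le[OF that] enat by simp
    \<comment> \<open>If there were infinitely many classes, a set of \<open>Suc N\<close> of them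
      would already violate the bound; otherwise the bound applies to the set of all
      classes.\<close>
    have "num_classes V E p \<le> enat (N div 2)" if "generic V p" for p :: "'v \<Rightarrow> real^'d"
    proof -
      let ?X = "(\<lambda>q. {q'. congruent V q q'}) ` {q. equivalent E p q}"
      have "finite ?X"
      proof (rule ccontr)
        assume "infinite ?X"
        then obtain A where "A \<subseteq> ?X" "finite A" "card A = Suc N" by (meson infinite_arbitrarily_large)
        then show False using bound[OF that, of A] by simp
      qed
      then show ?thesis using bound[OF that, of ?X] by (simp add: num_classes_def ecard_def)
    qed
    then have "r_d TYPE('d) V E \<le> enat (N div 2)" unfolding r_d_def by (intro SUP_least) simp
    then have "2 * r_d TYPE('d) V E \<le> 2 * enat (N div 2)" by (rule mult_left_mono) simp
    also have "\<dots> \<le> enat N" by (simp add: numeral_eq_enat)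
    finally show ?thesis using enat by simp
  qed simp
qed

end
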